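(* Let the min-max assumptions in the context hold, let $\delta>0$ and $(x_0,y_0)\in X\times Y$, and consider the AIPP.S method (described in the context) with parameter $\xi>0$ and tolerance $\rho$ satisfying, for some $\tau>0$, $$\xi\ge\frac{D_y}\tau,\qquad\rho=\frac\delta2,\qquad\tau\le\min\left\{\frac{m\delta^2}{2D_y},\frac{\delta^2}{32mD_y}\right\}.$$ Then, with $\lambda=1/(2m)$: (a) the AIPP.S method performs $$\mathcal O\left(\Omega_\xi\left[\frac{R_{1/(2m)}\hat p(x_0)}{\lambda^2\delta^2}+\frac{D_y^2}{\lambda\xi\delta^2}+\log_1^+(\Omega_\xi)\right]\right)$$ oracle calls, where $\Omega_\xi=1+\dfrac{\sqrt\xi L_y+\sqrt{L_x}}{\sqrt m}$; (b) the first argument $x$ of the pair output by the AIPP.S method satisfies: there exists $\hat x\in X$ such that $$\inf_{\|d\|\le1}\hat p'(\hat x;d)\ge-\delta,\qquad\|\hat x-x\|\le\delta .$$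
   Context: Min-max assumptions. $\mathcal X,\mathcal Y$ are finite dimensional inner product spaces; $X\subset\mathcal X$, $Y\subset\mathcal Y$ are nonempty convex sets and $Y$ is compact; there is an open $\Omega\supseteq X$ with $\Phi$ finite and continuous on $\Omega\times Y$, and $\nabla_x\Phi$ exists and is continuous on $\Omega\times Y$; $h\in\overline{\mathrm{Conv}}(X)$ and $-\Phi(x,\cdot)\in\overline{\mathrm{Conv}}(Y)$ for $x\in\Omega$; there are $L_x,L_y>0$ and $m\in(0,L_x]$ such that for all $x,x'\in X$, $y,y'\in Y$: $\Phi(x,y)-[\Phi(x',y)+\langle\nabla_x\Phi(x',y),x-x'\rangle]\ge-\frac m2\|x-x'\|^2$ and $\|\nabla_x\Phi(x,y)-\nabla_x\Phi(x',y')\|\le L_x\|x-x'\|+L_y\|y-y'\|$; with $p(x)=\max_{y\in Y}\Phi(x,y)$ and $\hat p=p+h$, $\hat p_*=\inf_{x\in X}\hat p(x)>-\infty$. Here $\overline{\mathrm{Conv}}(C)$ denotes proper lower semicontinuous convex functions real-valued exactly on $C$ ($+\infty$ outside). $\hat p'(x;d)$ is the (one-sided) directional derivative. Notation. $D_y$ is the diameter of $Y$; $a/0=+\infty$ for $a>0$. $\ell_F(u;z)=F(z)+\langle\nabla F(z),u-z\rangle$. $p_\xi(x)=\max_{y\in Y}\{\Phi(x,y)-\frac1{2\xi}\|y-y_0\|^2\}$. $\log_1^+(t)=\max\{1,\log t\}$. $R_\lambda\psi(x_0)=\inf_u\{\frac12\|x_0-u\|^2+\lambda[\psi(u)-\inf\psi]\}$.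 $\mathcal O(B)$ means at most $C\max\{1,B\}$ for a universal constant $C$. An oracle call is a collection of $\mathcal O(1)$ oracles, each appearing at least once, for: evaluating $\Phi$, $\nabla_x\Phi$, $h$, and solving exactly $\min_{x\in X}\{\lambda h(x)+\frac12\|x-x'\|^2\}$ and $\max_{y\in Y}\{\lambda\Phi(x',y)-\frac12\|y-y'\|^2\}$ for any given $x',y'$ and $\lambda>0$. ACG iterations with inputs $(\psi_s,\psi_n,y_0,\mu,L)$ (here $y_0$ is a generic starting point): $\psi=\psi_s+\psi_n$, $A_0=0$, $\Gamma_0\equiv0$, $x_0=y_0$, and for $k\ge1$: $\tau_{k-1}=(1+\mu A_{k-1})/L$, $a_{k-1}=\frac12(\tau_{k-1}+\sqrt{\tau_{k-1}^2+4\tau_{k-1}A_{k-1}})$, $A_k=A_{k-1}+a_{k-1}$, $\tilde x_{k-1}=\frac{A_{k-1}}{A_k}y_{k-1}+\frac{a_{k-1}}{A_k}x_{k-1}$, $q_k=\ell_{\psi_s}(\cdot;\tilde x_{k-1})+\psi_n+\frac\mu2\|\cdot-\tilde x_{k-1}\|^2$, $y_k=\operatorname{argmin}_y\{\frac1Lq_k(y)+\frac12\|y-\tilde x_{k-1}\|^2\}$, $x_k=x_{k-1}+\frac{a_{k-1}}{1+\mu A_k}[L(y_k-\tilde x_{k-1})+\mu(y_k-x_{k-1})]$, $\gamma_{k-1}=q_k(y_k)+L\langle\tilde x_{k-1}-y_k,\cdot-y_k\rangle+\frac\mu2\|\cdot-y_k\|^2$, $\Gamma_k=\frac{A_{k-1}}{A_k}\Gamma_{k-1}+\frac{a_{k-1}}{A_k}\gamma_{k-1}$,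 $r_k=(x_0-x_k)/A_k$, $\eta_k=\psi(y_k)-\Gamma_k(x_k)-\langle r_k,y_k-x_k\rangle$. ACG1 (with parameter $\sigma$) returns $(y_k,r_k,\eta_k)$ at the first $k$ with $\|r_k\|^2+2\eta_k\le\sigma\|y_0-y_k+r_k\|^2$ and $A_k\ge\max\{8,9/\mu\}$; ACG2, with extra input $\bar\eta$, at the first $k$ with $\|r_k\|^2+2\eta_k\le\sigma\|y_0-y_k+r_k\|^2$ and $\eta_k\le\bar\eta$. AIPP.S method with inputs $(\xi,\rho)$: set $\lambda=1/(2m)$, $\sigma=1/2$, $L_\xi=L_y[\xi L_y+\sqrt{\xi(L_x+m)}]+L_x$, $f=p_\xi$, $M=L_\xi$, $\mu=1-\lambda m$, $L=1+\lambda M$, $\bar\rho=\rho/4$, $\bar\varepsilon=\rho^2/(32[\max\{m,M\}+\lambda^{-1}])$, $z_0=x_0$. For $k=1,2,\dots$: let $(z_k,\tilde v_k,\tilde\varepsilon_k)$ be the output of ACG1 with inputs $(\lambda f+\frac12\|\cdot-z_{k-1}\|^2,\lambda h,z_{k-1},\mu,L)$. If $\|z_{k-1}-z_k+\tilde v_k\|\le\lambda\bar\rho/5$, let $(z,\tilde v,\tilde\varepsilon)$ be the output of ACG2 with the same inputs and $\bar\eta=\lambda\bar\varepsilon$, put $\bar L=\max\{m,M\}+\lambda^{-1}$, $x=\operatorname{argmin}_{x'}\{\ell_f(x';z)+h(x')+\frac{\bar L}2\|x'-z\|^2\}$, $u=\bar L(z-x)+\nabla f(x)-\nabla f(z)$,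 stop and output $(x,u)$.
   Formalization: Added hypothesis: every point x̃ at which an executed ACG iteration linearizes lies in a convex set S, X ⊆ S ⊆ Ω, on which the two curvature inequalities hold; without it x̃ may leave Ω, where the gradient of p_ξ is undefined. *)

theory Defs
  imports "HOL-Analysis.Analysis"
begin

definition grad :: "('a::real_inner \<Rightarrow> real) \<Rightarrow> 'a \<Rightarrow> 'a" where
  "grad f x = (THE g. GDERIV f x :> g)"

definition linearization :: "('a::real_inner \<Rightarrow> real) \<Rightarrow> 'a \<Rightarrow> 'a \<Rightarrow> real" where
  "linearization f z u = f z + inner (grad f z) (u - z)"

text \<open>Lower semicontinuous convex functions that are finite exactly on \<open>C\<close> and \<open>\<infinity>\<close> outside
  (proper as soon as \<open>C\<close> is nonempty).\<close>

definition closed_convex_fun :: "'a::euclidean_space set \<Rightarrow> ('a \<Rightarrow> ereal) \<Rightarrow> bool" where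
  "closed_convex_fun C f \<longleftrightarrow>
     (\<forall>x\<in>C. \<bar>f x\<bar> \<noteq> \<infinity>) \<and> (\<forall>x. x \<notin> C \<longrightarrow> f x = \<infinity>) \<and>
     (\<forall>x y t. 0 < t \<and> t < 1 \<longrightarrow>
        f ((1 - t) *\<^sub>R x + t *\<^sub>R y) \<le> ereal (1 - t) * f x + ereal t * f y) \<and>
     (\<forall>x. f x \<le> Liminf (at x) f)"

definition has_dir_deriv :: "('a::real_normed_vector \<Rightarrow> ereal) \<Rightarrow> 'a \<Rightarrow> 'a \<Rightarrow> ereal \<Rightarrow> bool" where
  "has_dir_deriv F x d l \<longleftrightarrow>
     ((\<lambda>t. (F (x + t *\<^sub>R d) - F x) / ereal t) \<longlongrightarrow> l) (at_right 0)"

definition dir_deriv :: "('a::real_normed_vector \<Rightarrow> ereal) \<Rightarrow> 'a \<Rightarrow> 'a \<Rightarrow> ereal" where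
  "dir_deriv F x d = (THE l. has_dir_deriv F x d l)"

definition moreau_R :: "real \<Rightarrow> ('a::real_normed_vector \<Rightarrow> ereal) \<Rightarrow> 'a \<Rightarrow> ereal" where
  "moreau_R lam psi x0 =
     (INF u. ereal ((norm (x0 - u))\<^sup>2 / 2) + ereal lam * (psi u - (INF w. psi w)))"

definition log1_plus :: "real \<Rightarrow> real" where
  "log1_plus t = max 1 (ln t)"

text \<open>Under the assumptions below the supremum is attained at every point of \<open>Om\<close>, because
  \<open>Y\<close> is compact.\<close>

definition max_fun :: "'b set \<Rightarrow> ('a \<Rightarrow> 'b \<Rightarrow> real) \<Rightarrow> 'a \<Rightarrow> real" where
  "max_fun Y Phi x = (SUP y\<in>Y. Phi x y)"

definition primal_obj :: "'b set \<Rightarrow> ('a \<Rightarrow> 'b \<Rightarrow> real) \<Rightarrow> ('a \<Rightarrow> ereal) \<Rightarrow> 'a \<Rightarrow> ereal" where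
  "primal_obj Y Phi h x = ereal (max_fun Y Phi x) + h x"

definition smooth_max :: "'b::real_normed_vector set \<Rightarrow> ('a \<Rightarrow> 'b \<Rightarrow> real) \<Rightarrow> real \<Rightarrow> 'b \<Rightarrow> 'a \<Rightarrow> real" where
  "smooth_max Y Phi xi y0 = max_fun Y (\<lambda>x y. Phi x y - (norm (y - y0))\<^sup>2 / (2 * xi))"

abbreviation gradx :: "('a::real_inner \<Rightarrow> 'b \<Rightarrow> real) \<Rightarrow> 'a \<Rightarrow> 'b \<Rightarrow> 'a" where
  "gradx Phi x y \<equiv> grad (\<lambda>x'. Phi x' y) x"

definition curvature_bounds ::
  "'a::euclidean_space set \<Rightarrow> 'b::euclidean_space set \<Rightarrow> ('a \<Rightarrow> 'b \<Rightarrow> real) \<Rightarrow>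
   real \<Rightarrow> real \<Rightarrow> real \<Rightarrow> bool" where
  "curvature_bounds S Y Phi m Lx Ly \<longleftrightarrow>
     (\<forall>x\<in>S. \<forall>x'\<in>S. \<forall>y\<in>Y.
        Phi x y - (Phi x' y + inner (gradx Phi x' y) (x - x')) \<ge> - (m / 2) * (norm (x - x'))\<^sup>2) \<and>
     (\<forall>x\<in>S. \<forall>x'\<in>S. \<forall>y\<in>Y. \<forall>y'\<in>Y.
        norm (gradx Phi x y - gradx Phi x' y') \<le> Lx * norm (x - x') + Ly * norm (y - y'))"

text \<open>Values of \<open>Phi\<close> outside \<open>Om \<times> Y\<close> are irrelevant: \<open>- Phi x\<close> is explicitly extended by
  \<open>\<infinity>\<close> outside \<open>Y\<close>.\<close>

locale minmax =
  fixes X :: "'a::euclidean_space set" and Y :: "'b::euclidean_space set" and Om :: "'a set"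
    and Phi :: "'a \<Rightarrow> 'b \<Rightarrow> real" and h :: "'a \<Rightarrow> ereal" and m Lx Ly :: real
  assumes X_nonempty: "X \<noteq> {}" and X_convex: "convex X"
    and Y_nonempty: "Y \<noteq> {}" and Y_convex: "convex Y" and Y_compact: "compact Y"
    and Om_open: "open Om" and X_sub_Om: "X \<subseteq> Om"
    and Phi_continuous: "continuous_on (Om \<times> Y) (\<lambda>(x, y). Phi x y)"
    and Phi_grad: "\<And>x y. x \<in> Om \<Longrightarrow> y \<in> Y \<Longrightarrow> \<exists>g. GDERIV (\<lambda>x'. Phi x' y) x :> g"
    and Phi_grad_continuous: "continuous_on (Om \<times> Y) (\<lambda>(x, y). gradx Phi x y)"
    and h_convex: "closed_convex_fun X h"
    and Phi_concave:
      "\<And>x. x \<in> Om \<Longrightarrow> closed_convex_fun Y (\<lambda>y. if y \<in> Y then ereal (- Phi x y) else \<infinity>)"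
    and m_pos: "0 < m" and m_le: "m \<le> Lx" and Lx_pos: "0 < Lx" and Ly_pos: "0 < Ly"
    and curvature: "curvature_bounds X Y Phi m Lx Ly"
    and bounded_below: "(INF x\<in>X. primal_obj Y Phi h x) > - \<infinity>"

record 'a acg_state =
  acg_A :: real
  acg_Gam :: "'a \<Rightarrow> real"
  acg_y :: 'a
  acg_x :: 'a

definition acg_init :: "'a \<Rightarrow> 'a acg_state" where
  "acg_init w0 = \<lparr> acg_A = 0, acg_Gam = (\<lambda>_. 0), acg_y = w0, acg_x = w0 \<rparr>"

definition acg_a :: "real \<Rightarrow> real \<Rightarrow> 'a acg_state \<Rightarrow> real" where
  "acg_a mu L s = (let tau = (1 + mu * acg_A s) / L in
     (tau + sqrt (tau\<^sup>2 + 4 * tau * acg_A s)) / 2)"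

text \<open>The point at which the smooth part is linearized in the iteration that starts from
  state \<open>s\<close>.\<close>

definition acg_xt :: "real \<Rightarrow> real \<Rightarrow> ('a::real_inner) acg_state \<Rightarrow> 'a" where
  "acg_xt mu L s = (let A = acg_A s; a = acg_a mu L s in
     (A / (A + a)) *\<^sub>R acg_y s + (a / (A + a)) *\<^sub>R acg_x s)"

definition acg_step ::
  "('a::real_inner \<Rightarrow> real) \<Rightarrow> ('a \<Rightarrow> ereal) \<Rightarrow> real \<Rightarrow> real \<Rightarrow> 'a acg_state \<Rightarrow> 'a acg_state" where
  "acg_step psis psin mu L s =
    (let A = acg_A s; a = acg_a mu L s; A' = A + a; xt = acg_xt mu L s;
         q = (\<lambda>u. ereal (linearization psis xt u) + psin u + ereal (mu / 2 * (norm (u - xt))\<^sup>2));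
         y' = arg_min (\<lambda>u. ereal (1 / L) * q u + ereal ((norm (u - xt))\<^sup>2 / 2)) (\<lambda>_. True);
         x' = acg_x s + (a / (1 + mu * A')) *\<^sub>R (L *\<^sub>R (y' - xt) + mu *\<^sub>R (y' - acg_x s));
         gam = (\<lambda>u. real_of_ereal (q y') + L * inner (xt - y') (u - y')
                     + mu / 2 * (norm (u - y'))\<^sup>2)
     in \<lparr> acg_A = A',
          acg_Gam = (\<lambda>u. A / A' * acg_Gam s u + a / A' * gam u),
          acg_y = y', acg_x = x' \<rparr>)"

definition acg ::
  "('a::real_inner \<Rightarrow> real) \<Rightarrow> ('a \<Rightarrow> ereal) \<Rightarrow> 'a \<Rightarrow> real \<Rightarrow> real \<Rightarrow> nat \<Rightarrow> 'a acg_state" where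
  "acg psis psin w0 mu L k = (acg_step psis psin mu L ^^ k) (acg_init w0)"

definition acg_r :: "'a::real_inner \<Rightarrow> 'a acg_state \<Rightarrow> 'a" where
  "acg_r w0 s = (1 / acg_A s) *\<^sub>R (w0 - acg_x s)"

definition acg_eta ::
  "('a::real_inner \<Rightarrow> real) \<Rightarrow> ('a \<Rightarrow> ereal) \<Rightarrow> 'a \<Rightarrow> 'a acg_state \<Rightarrow> real" where
  "acg_eta psis psin w0 s =
     real_of_ereal (ereal (psis (acg_y s)) + psin (acg_y s)) - acg_Gam s (acg_x s)
       - inner (acg_r w0 s) (acg_y s - acg_x s)"

definition acg_accurate ::
  "('a::real_inner \<Rightarrow> real) \<Rightarrow> ('a \<Rightarrow> ereal) \<Rightarrow> 'a \<Rightarrow> real \<Rightarrow> 'a acg_state \<Rightarrow> bool" where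
  "acg_accurate psis psin w0 sig s \<longleftrightarrow>
     (norm (acg_r w0 s))\<^sup>2 + 2 * acg_eta psis psin w0 s
       \<le> sig * (norm (w0 - acg_y s + acg_r w0 s))\<^sup>2"

definition acg1_test ::
  "('a::real_inner \<Rightarrow> real) \<Rightarrow> ('a \<Rightarrow> ereal) \<Rightarrow> 'a \<Rightarrow> real \<Rightarrow> real \<Rightarrow> 'a acg_state \<Rightarrow> bool" where
  "acg1_test psis psin w0 mu sig s \<longleftrightarrow>
     acg_accurate psis psin w0 sig s \<and> acg_A s \<ge> max 8 (9 / mu)"

definition acg2_test ::
  "('a::real_inner \<Rightarrow> real) \<Rightarrow> ('a \<Rightarrow> ereal) \<Rightarrow> 'a \<Rightarrow> real \<Rightarrow> real \<Rightarrow> 'a acg_state \<Rightarrow> bool" where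
  "acg2_test psis psin w0 sig etabar s \<longleftrightarrow>
     acg_accurate psis psin w0 sig s \<and> acg_eta psis psin w0 s \<le> etabar"

definition not_yet :: "(nat \<Rightarrow> bool) \<Rightarrow> nat \<Rightarrow> bool" where
  "not_yet P k \<longleftrightarrow> (\<forall>j. 1 \<le> j \<and> j < k \<longrightarrow> \<not> P j)"

definition stops_at :: "(nat \<Rightarrow> bool) \<Rightarrow> nat \<Rightarrow> bool" where
  "stops_at P k \<longleftrightarrow> 1 \<le> k \<and> P k \<and> not_yet P k"

text \<open>
  \<^item> \<open>EvalPhi x y\<close>, \<open>EvalGradPhi x y\<close>, \<open>EvalH x\<close>: evaluate \<open>Phi\<close>, its \<open>x\<close>-gradient, and \<open>h\<close>;
  \<^item> \<open>ProxH lam x'\<close>: solve \<open>min {lam * h x + |x - x'|^2 / 2}\<close> over \<open>X\<close>;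
  \<^item> \<open>ProxPhi lam x' y'\<close>: solve \<open>max {lam * Phi x' y - |y - y'|^2 / 2}\<close> over \<open>Y\<close>.
\<close>

datatype ('a, 'b) query =
    EvalPhi 'a 'b
  | EvalGradPhi 'a 'b
  | EvalH 'a
  | ProxH real 'a
  | ProxPhi real 'a 'b

definition all_oracles_used :: "('a, 'b) query list \<Rightarrow> bool" where
  "all_oracles_used qs \<longleftrightarrow>
     (\<exists>x y. EvalPhi x y \<in> set qs) \<and> (\<exists>x y. EvalGradPhi x y \<in> set qs) \<and>
     (\<exists>x. EvalH x \<in> set qs) \<and> (\<exists>t x. ProxH t x \<in> set qs) \<and> (\<exists>t x y. ProxPhi t x y \<in> set qs)"

text \<open>A sequence of queries amounts to \<open>T\<close> oracle calls if it splits into \<open>T\<close> consecutive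
  groups of boundedly many queries, each of which uses every oracle.\<close>

definition oracle_call_size :: nat where
  "oracle_call_size = 20"

definition oracle_calls :: "('a, 'b) query list \<Rightarrow> nat \<Rightarrow> bool" where
  "oracle_calls qs T \<longleftrightarrow>
     (\<exists>bs. concat bs = qs \<and> length bs = T \<and>
        (\<forall>b\<in>set bs. all_oracles_used b \<and> length b \<le> oracle_call_size))"

text \<open>The universal constant of the complexity bound is an explicit numeral, because an
  existentially quantified one would be allowed to depend on the types of the two spaces, and
  hence on their dimensions.\<close>

definition univ_const :: ereal where
  "univ_const = 10000000"

definition within_O :: "nat \<Rightarrow> ereal \<Rightarrow> bool" where
  "within_O T B \<longleftrightarrow> ereal (real T) \<le> univ_const * max 1 B"

locale aipp_s =
  fixes Y :: "'b::euclidean_space set" and Phi :: "'a::euclidean_space \<Rightarrow> 'b \<Rightarrow> real"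
    and h :: "'a \<Rightarrow> ereal" and m Lx Ly :: real
    and x0 :: 'a and y0 :: 'b and xi rho :: real
begin

definition "lam = 1 / (2 * m)"
definition "sig = (1 / 2 :: real)"
definition "M = Ly * (xi * Ly + sqrt (xi * (Lx + m))) + Lx"
definition "f = smooth_max Y Phi xi y0"
definition "mu = 1 - lam * m"
definition "L = 1 + lam * M"
definition "rho_bar = rho / 4"
definition "eps_bar = rho\<^sup>2 / (32 * (max m M + 1 / lam))"
definition "L_bar = max m M + 1 / lam"

definition psis :: "'a \<Rightarrow> 'a \<Rightarrow> real" where
  "psis z u = lam * f u + (norm (u - z))\<^sup>2 / 2"

definition psin :: "'a \<Rightarrow> ereal" where
  "psin u = ereal lam * h u"

definition inner_state :: "'a \<Rightarrow> nat \<Rightarrow> 'a acg_state" where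
  "inner_state z k = acg (psis z) psin z mu L k"

definition test1 :: "'a \<Rightarrow> nat \<Rightarrow> bool" where
  "test1 z k \<longleftrightarrow> acg1_test (psis z) psin z mu sig (inner_state z k)"

definition test2 :: "'a \<Rightarrow> nat \<Rightarrow> bool" where
  "test2 z k \<longleftrightarrow> acg2_test (psis z) psin z sig (lam * eps_bar) (inner_state z k)"

definition outer_test :: "'a \<Rightarrow> nat \<Rightarrow> bool" where
  "outer_test z k \<longleftrightarrow>
     norm (z - acg_y (inner_state z k) + acg_r z (inner_state z k)) \<le> lam * rho_bar / 5"

definition refine_x :: "'a \<Rightarrow> 'a" where
  "refine_x z = arg_min (\<lambda>x'. ereal (linearization f z x') + h x'
                               + ereal (L_bar / 2 * (norm (x' - z))\<^sup>2)) (\<lambda>_. True)"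

definition refine_u :: "'a \<Rightarrow> 'a" where
  "refine_u z = L_bar *\<^sub>R (z - refine_x z) + grad f (refine_x z) - grad f z"

text \<open>How the method uses the oracles.  Let \<open>y_max x\<close> be the maximizer defining \<open>f x\<close>; it is
  returned by \<open>ProxPhi xi x y0\<close>.  A value of \<open>f\<close> is obtained from \<open>Phi x (y_max x)\<close>, and its
  gradient is the \<open>x\<close>-gradient of \<open>Phi\<close> at \<open>(x, y_max x)\<close>.\<close>

definition y_max :: "'a \<Rightarrow> 'b" where
  "y_max x = arg_max (\<lambda>y. xi * Phi x y - (norm (y - y0))\<^sup>2 / 2) (\<lambda>y. y \<in> Y)"

definition value_queries :: "'a \<Rightarrow> ('a, 'b) query list" where
  "value_queries x = [ProxPhi xi x y0, EvalPhi x (y_max x)]"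

definition grad_queries :: "'a \<Rightarrow> ('a, 'b) query list" where
  "grad_queries x = [ProxPhi xi x y0, EvalGradPhi x (y_max x)]"

text \<open>Iteration \<open>k + 1\<close> linearizes the smooth part at \<open>xt\<close>; completing the square in the
  subproblem for \<open>y'\<close> turns it into a proximal step on \<open>h\<close>; finally, \<open>q y'\<close> and \<open>eta\<close> need
  the values of \<open>h\<close> and \<open>f\<close> at \<open>y'\<close>.\<close>

definition iteration_queries :: "'a \<Rightarrow> nat \<Rightarrow> ('a, 'b) query list" where
  "iteration_queries z k =
    (let xt = acg_xt mu L (inner_state z k); y' = acg_y (inner_state z (Suc k))
     in value_queries xt @ grad_queries xt
        @ [ProxH (lam / (L + mu)) (xt - (1 / (L + mu)) *\<^sub>R grad (psis z) xt), EvalH y']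
        @ value_queries y')"

definition acg_queries :: "'a \<Rightarrow> nat \<Rightarrow> ('a, 'b) query list" where
  "acg_queries z n = concat (map (iteration_queries z) [0..<n])"

definition refine_queries :: "'a \<Rightarrow> ('a, 'b) query list" where
  "refine_queries z =
     grad_queries z @ [ProxH (1 / L_bar) (z - (1 / L_bar) *\<^sub>R grad f z)]
       @ grad_queries (refine_x z)"

text \<open>\<open>run z qs (x, u)\<close>: started with prox center \<open>z\<close>, the outer loop terminates with
  output \<open>(x, u)\<close> after issuing the queries \<open>qs\<close>.\<close>

inductive run :: "'a \<Rightarrow> ('a, 'b) query list \<Rightarrow> 'a \<times> 'a \<Rightarrow> bool" where
  finish:
    "stops_at (test1 z) k \<Longrightarrow> outer_test z k \<Longrightarrow> stops_at (test2 z) l \<Longrightarrow>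
     z' = acg_y (inner_state z l) \<Longrightarrow>
     run z (acg_queries z k @ acg_queries z l @ refine_queries z') (refine_x z', refine_u z')"
| continue:
    "stops_at (test1 z) k \<Longrightarrow> \<not> outer_test z k \<Longrightarrow>
     run (acg_y (inner_state z k)) qs out \<Longrightarrow>
     run z (acg_queries z k @ qs) out"

definition aipp_run :: "('a, 'b) query list \<Rightarrow> 'a \<Rightarrow> 'a \<Rightarrow> bool" where
  "aipp_run qs x u \<longleftrightarrow> run x0 qs (x, u)"

text \<open>The prox centers visited by the method, and the points at which the inner iterations
  that are actually executed linearize the smooth part.\<close>

inductive center :: "'a \<Rightarrow> bool" where
  "center x0"
| "center z \<Longrightarrow> stops_at (test1 z) k \<Longrightarrow> \<not> outer_test z k \<Longrightarrow> center (acg_y (inner_state z k))"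

inductive linearizes_at :: "'a \<Rightarrow> bool" where
  "center z \<Longrightarrow> not_yet (test1 z) (Suc k) \<Longrightarrow> linearizes_at (acg_xt mu L (inner_state z k))"
| "center z \<Longrightarrow> stops_at (test1 z) j \<Longrightarrow> outer_test z j \<Longrightarrow> not_yet (test2 z) (Suc k) \<Longrightarrow>
   linearizes_at (acg_xt mu L (inner_state z k))"

text \<open>The linearization points are extrapolated and may leave \<open>X\<close>, even \<open>Om\<close>, where \<open>f\<close>
  need not be differentiable and its curvature is not controlled.  The following condition
  makes the method meaningful: these points stay in a convex region \<open>S\<close> between \<open>X\<close> and \<open>Om\<close>
  on which the curvature bounds still hold.  It holds with \<open>S = X\<close> if no point leaves \<open>X\<close>, and
  automatically with \<open>S = UNIV\<close> if the bounds are global.\<close>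

definition well_posed :: "'a set \<Rightarrow> 'a set \<Rightarrow> bool" where
  "well_posed X Om \<longleftrightarrow>
     (\<exists>S. convex S \<and> X \<subseteq> S \<and> S \<subseteq> Om \<and> curvature_bounds S Y Phi m Lx Ly \<and>
          (\<forall>w. linearizes_at w \<longrightarrow> w \<in> S))"

end

end

theory Submission
  imports Defs
begin

text \<open>
  The smoothed function \<open>f\<close> is differentiable with gradient \<open>\<nabla>\<^sub>x \<Phi>(x, y(x))\<close>, where
  \<open>y(x)\<close> is the unique maximizer; since \<open>y\<close> is \<open>\<xi> L\<^sub>y\<close>-Lipschitz, \<open>f\<close> has upper
  curvature \<open>M\<close> and lower curvature \<open>m\<close>.  Every prox subproblem is thus \<open>1/2\<close>-strongly convex and
  \<open>L\<close>-smooth with \<open>L \<le> \<Omega>\<^sub>\<xi>\<^sup>2\<close>, and the estimate sequence of the accelerated method gives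
  \<open>A\<^sub>k \<ge> k\<^sup>2/(4 L)\<close>, so ACG1 stops after \<open>O(\<Omega>\<^sub>\<xi>)\<close> iterations, and geometric growth of
  \<open>A\<^sub>k\<close>, so ACG2 stops after \<open>O(\<Omega>\<^sub>\<xi> log \<Omega>\<^sub>\<xi>)\<close> iterations.  An outer step that does not
  stop decreases the objective by a fixed amount; the first outer step already brings the gap down to
  the Moreau gap \<open>R\<close>.

  ACG2 may stop earlier than ACG1 did, so its residual has to be bounded separately.  Let \<open>d\<close> be the
  distance from the prox center to the exact prox point \<open>x\<^sup>*\<close>.  The outer test makes \<open>d\<close> small.
  Each \<open>y\<^sub>k\<close> is a convex combination of \<open>x\<^sub>1, \<dots>, x\<^sub>k\<close>, all of which lie within \<open>d\<close> of
  \<open>x\<^sup>*\<close>, so \<open>|y\<^sub>k - x\<^sup>*| \<le> d\<close>; this bounds the residual of any accurate output by a multiple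
  of \<open>d\<close>.

  For part (b), the output \<open>x\<close> minimizes the convex function
  \<open>p(u) + h(u) + m/2 |u - x|\<^sup>2 - <w, u - x>\<close> up to \<open>D\<^sub>y\<^sup>2/(2 \<xi>)\<close>, where \<open>|w| \<le> \<delta>/2\<close>, and the
  minimizer of this function plus \<open>m/2 |u - x|\<^sup>2\<close> is the required nearly stationary point.
\<close>

section \<open>Strong convexity and minimizers\<close>

text \<open>Two numerical margins shape the residual estimates. With \<open>mu = 1 / 2\<close>, ACG1
  stops only at A >= 18, and then the outer test yields no more than 0.729 d <= P / 5, where P = lam
  rho / 4. Conversely, the refinement tolerates a residual of P (1 + 1 / L), and an accurate output
  of ACG2 is shown to stay below it only for d up to about 0.274 P. The two bounds meet with hardly
  any room, so cruder triangle inequalities would not do.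

  A second obstacle is that linearization points are known to lie in \<open>S\<close> only for
  iterations that are really executed. Every estimate for iteration k is therefore conditional on no
  earlier stop, and the iteration counts are derived by assuming that the test has not fired yet.

  All decrease is measured on the smoothed objective. Passing between it and p costs D_y^2 / (2 xi):
  in the lower bound of the objective, where it produces the middle term of the complexity, and in
  the distance from x to the stationary point, where the condition on tau absorbs it.\<close>

definition strongly_convex_on :: "'a::real_inner set \<Rightarrow> real \<Rightarrow> ('a \<Rightarrow> real) \<Rightarrow> bool" where
  "strongly_convex_on X c G \<longleftrightarrow>
     (\<forall>u\<in>X. \<forall>v\<in>X. \<forall>t. 0 \<le> t \<and> t \<le> 1 \<longrightarrow>
        G ((1 - t) *\<^sub>R u + t *\<^sub>R v)
          \<le> (1 - t) * G u + t * G v - c / 2 * (t * (1 - t)) * (norm (u - v))\<^sup>2)"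

lemma strongly_convex_onD:
  assumes "strongly_convex_on X c G" "u \<in> X" "v \<in> X" "0 \<le> t" "t \<le> 1"
  shows "G ((1 - t) *\<^sub>R u + t *\<^sub>R v)
          \<le> (1 - t) * G u + t * G v - c / 2 * (t * (1 - t)) * (norm (u - v))\<^sup>2"
  using assms unfolding strongly_convex_on_def by blast

lemma convex_combI:
  assumes "convex X" "u \<in> X" "v \<in> X" "0 \<le> t" "t \<le> 1"
  shows "(1 - t) *\<^sub>R u + t *\<^sub>R v \<in> X"
  using convexD_alt[OF assms] .

lemma strongly_convex_on_growth:
  assumes X: "convex X" and G: "strongly_convex_on X c G"
    and x: "x \<in> X" and min: "\<And>v. v \<in> X \<Longrightarrow> G x \<le> G v" and u: "u \<in> X"
  shows "G x + c / 2 * (norm (u - x))\<^sup>2 \<le> G u"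
proof -
  have "c / 2 * (norm (u - x))\<^sup>2 \<le> G u - G x"
  \<comment> \<open>Strong convexity at (1 - t) x + t u, divided by t, bounds 1 - t times the left
    side. This rule, with z = 1 - t, replaces the limit of t to 0.\<close>
  proof (rule field_le_mult_one_interval)
    fix z :: real assume z: "0 < z" "z < 1"
    define t where "t = 1 - z"
    have t: "0 < t" "t < 1" "z = 1 - t" using z by (auto simp: t_def)
    have "G x \<le> G ((1 - t) *\<^sub>R x + t *\<^sub>R u)"
      by (rule min) (use convex_combI[OF X x u] t in auto)
    also have "\<dots> \<le> (1 - t) * G x + t * G u - c / 2 * (t * (1 - t)) * (norm (x - u))\<^sup>2"
      using strongly_convex_onD[OF G x u] t by auto
    finally have "t * (z * (c / 2 * (norm (u - x))\<^sup>2)) \<le> t * (G u - G x)"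
      by (simp add: t norm_minus_commute algebra_simps)
    then show "z * (c / 2 * (norm (u - x))\<^sup>2) \<le> G u - G x"
      using t by simp
  qed
  then show ?thesis by simp
qed

text \<open>Moduli add whatever their signs. Modulus 0 is convexity and \<open>- m\<close> is weak
  convexity, so one notion covers \<open>h\<close>, the max function and every regularized
  objective.\<close>

lemma strongly_convex_on_add:
  assumes "strongly_convex_on X c F" "strongly_convex_on X c' G"
  shows "strongly_convex_on X (c + c') (\<lambda>u. F u + G u)"
  unfolding strongly_convex_on_def
proof (intro ballI allI impI)
  fix u v t assume uv: "u \<in> X" "v \<in> X" "0 \<le> t \<and> t \<le> (1::real)"
  show "F ((1 - t) *\<^sub>R u + t *\<^sub>R v) + G ((1 - t) *\<^sub>R u + t *\<^sub>R v)
       \<le> (1 - t) * (F u + G u) + t * (F v + G v) - (c + c') / 2 * (t * (1 - t)) * (norm (u - v))\<^sup>2"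
    using strongly_convex_onD[OF assms(1), of u v t] strongly_convex_onD[OF assms(2), of u v t] uv
    by (simp add: algebra_simps add_divide_distrib)
qed

lemma strongly_convex_on_cong:
  assumes "convex X" "\<And>u. u \<in> X \<Longrightarrow> F u = G u"
  shows "strongly_convex_on X c F \<longleftrightarrow> strongly_convex_on X c G"
  unfolding strongly_convex_on_def using assms convex_combI[OF assms(1)] by (auto cong: ball_cong)

lemma norm_comb_sq:
  fixes u v a :: "'a::real_inner"
  shows "(norm ((1 - t) *\<^sub>R u + t *\<^sub>R v - a))\<^sup>2
     = (1 - t) * (norm (u - a))\<^sup>2 + t * (norm (v - a))\<^sup>2 - t * (1 - t) * (norm (u - v))\<^sup>2"
  by (simp add: power2_norm_eq_inner inner_simps inner_commute algebra_simps)

lemma strongly_convex_on_quadratic: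
  "strongly_convex_on X c (\<lambda>u. k + inner g (u - a) + c / 2 * (norm (u - b))\<^sup>2)"
  unfolding strongly_convex_on_def
proof (intro ballI allI impI)
  fix u v t assume uv: "u \<in> X" "v \<in> X" "0 \<le> t \<and> t \<le> (1::real)"
  show "k + inner g ((1 - t) *\<^sub>R u + t *\<^sub>R v - a) + c / 2 * (norm ((1 - t) *\<^sub>R u + t *\<^sub>R v - b))\<^sup>2
      \<le> (1 - t) * (k + inner g (u - a) + c / 2 * (norm (u - b))\<^sup>2)
        + t * (k + inner g (v - a) + c / 2 * (norm (v - b))\<^sup>2)
        - c / 2 * (t * (1 - t)) * (norm (u - v))\<^sup>2"
    unfolding norm_comb_sq by (rule eq_refl) (simp add: inner_simps field_simps)
qed

lemma strongly_convex_on_first_order: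
  assumes X: "convex X"
    and fo: "\<And>u v. u \<in> X \<Longrightarrow> v \<in> X \<Longrightarrow> G v + inner (D v) (u - v) + c / 2 * (norm (u - v))\<^sup>2 \<le> G u"
  shows "strongly_convex_on X c G"
  unfolding strongly_convex_on_def
proof (intro ballI allI impI)
  fix u v t assume uv: "u \<in> X" "v \<in> X" "0 \<le> t \<and> t \<le> (1::real)"
  define w where "w = (1 - t) *\<^sub>R u + t *\<^sub>R v"
  have w: "w \<in> X" unfolding w_def using convex_combI[OF X] uv by auto
  have uw: "u - w = t *\<^sub>R (u - v)" and vw: "v - w = (1 - t) *\<^sub>R (v - u)"
    by (simp_all add: w_def algebra_simps)
  have n: "(norm (t *\<^sub>R (u - v)))\<^sup>2 = t^2 * (norm (u - v))\<^sup>2"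
    "(norm ((1 - t) *\<^sub>R (v - u)))\<^sup>2 = (1 - t)^2 * (norm (u - v))\<^sup>2"
    using uv by (simp_all add: power_mult_distrib norm_minus_commute)
  have "(1 - t) * (G w + inner (D w) (u - w) + c / 2 * (norm (u - w))\<^sup>2) \<le> (1 - t) * G u"
    using fo[OF uv(1) w] uv by (intro mult_left_mono) auto
  moreover have "t * (G w + inner (D w) (v - w) + c / 2 * (norm (v - w))\<^sup>2) \<le> t * G v"
    using fo[OF uv(2) w] uv by (intro mult_left_mono) auto
  moreover have "(1 - t) * (G w + inner (D w) (u - w) + c / 2 * (norm (u - w))\<^sup>2)
      + t * (G w + inner (D w) (v - w) + c / 2 * (norm (v - w))\<^sup>2)
      = G w + c / 2 * (t * (1 - t)) * (norm (u - v))\<^sup>2"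
    unfolding uw vw n by (simp add: inner_simps field_simps power2_eq_square)
  ultimately show "G w \<le> (1 - t) * G u + t * G v - c / 2 * (t * (1 - t)) * (norm (u - v))\<^sup>2"
    by linarith
qed

section \<open>Lower semicontinuous convex functions and existence of minimizers\<close>

lemma closed_convex_fun_finite:
  assumes "closed_convex_fun X h" "x \<in> X"
  shows "h x = ereal (real_of_ereal (h x))"
  using assms unfolding closed_convex_fun_def by (auto simp: ereal_real)

lemma closed_convex_fun_outside:
  assumes "closed_convex_fun X h" "x \<notin> X"
  shows "h x = \<infinity>"
  using assms unfolding closed_convex_fun_def by auto

lemma closed_convex_fun_convex:
  assumes h: "closed_convex_fun X h" and X: "convex X"
  shows "strongly_convex_on X 0 (\<lambda>u. real_of_ereal (h u))"
  unfolding strongly_convex_on_def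
proof (intro ballI allI impI)
  fix u v t assume uv: "u \<in> X" "v \<in> X" "0 \<le> t \<and> t \<le> (1::real)"
  define w where "w = (1 - t) *\<^sub>R u + t *\<^sub>R v"
  have w: "w \<in> X" unfolding w_def using convex_combI[OF X] uv by auto
  have "real_of_ereal (h w) \<le> (1 - t) * real_of_ereal (h u) + t * real_of_ereal (h v)"
  proof (cases "t = 0 \<or> t = 1")
    case True then show ?thesis by (auto simp: w_def)
  next
    case False
    then have "h w \<le> ereal (1 - t) * h u + ereal t * h v"
      using h uv unfolding closed_convex_fun_def w_def by auto
    then show ?thesis
      by (subst (asm) (1 2 3) closed_convex_fun_finite[OF h]) (use uv w in simp_all)
  qed
  then show "real_of_ereal (h w) \<le> (1 - t) * real_of_ereal (h u) + t * real_of_ereal (h v)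
      - 0 / 2 * (t * (1 - t)) * (norm (u - v))\<^sup>2" by simp
qed

text \<open>\<open>X\<close> is not assumed closed. The value infinity outside \<open>X\<close>
  makes up for it: a limit along which \<open>h\<close> stays bounded cannot leave
  \<open>X\<close>.\<close>

lemma closed_convex_fun_lsc:
  assumes h: "closed_convex_fun X h" and w: "\<And>n. w n \<in> X" "w \<longlonglongrightarrow> u"
    and le: "\<And>n. real_of_ereal (h (w n)) \<le> c"
  shows "u \<in> X \<and> real_of_ereal (h u) \<le> c"
proof -
  have hw: "h (w n) \<le> ereal c" for n
    by (subst closed_convex_fun_finite[OF h w(1)]) (simp add: le)
  have "h u \<le> ereal c"
  proof (rule ccontr)
    assume "\<not> h u \<le> ereal c"
    then have lt: "ereal c < h u" by simp
    have "h u \<le> Liminf (at u) h" using h unfolding closed_convex_fun_def by blast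
    then have "\<forall>\<^sub>F v in at u. ereal c < h v" using lt unfolding le_Liminf_iff by blast
    \<comment> \<open>The punctured filter requires \<open>w n \<noteq> u\<close>, which holds
      because h (w n) \<le> c < h u.\<close>
    moreover have "filterlim w (at u) sequentially"
      unfolding filterlim_at using w lt hw by (auto simp: not_less[symmetric] intro!: always_eventually)
    ultimately have "\<forall>\<^sub>F n in sequentially. ereal c < h (w n)"
      by (rule eventually_compose_filterlim)
    then show False using hw by (auto simp: not_le[symmetric] eventually_sequentially)
  qed
  then show ?thesis
    using closed_convex_fun_outside[OF h, of u] closed_convex_fun_finite[OF h, of u]
    by (metis PInfty_neq_ereal(1) ereal_less_eq(3) ereal_infty_less_eq(1))
qed

lemma bounded_seq_subseq:
  fixes w :: "nat \<Rightarrow> 'a::euclidean_space"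
  assumes "\<And>n. w n \<in> B" "bounded B"
  obtains u r where "strict_mono (r :: nat \<Rightarrow> nat)" "(w \<circ> r) \<longlonglongrightarrow> u"
proof -
  have "bounded (range w)" using assms by (meson bounded_subset image_subsetI)
  then show ?thesis using bounded_imp_convergent_subsequence[of w] that by metis
qed

lemma closed_convex_fun_bounded_below:
  fixes X :: "'a::euclidean_space set"
  assumes h: "closed_convex_fun X h" and B: "bounded B"
  shows "\<exists>b. \<forall>u\<in>X \<inter> B. b \<le> real_of_ereal (h u)"
proof (rule ccontr)
  assume "\<not> ?thesis"
  then have "\<forall>n. \<exists>u. u \<in> X \<inter> B \<and> real_of_ereal (h u) < - real n"
    by (meson not_le)
  then obtain w where w: "\<And>n. w n \<in> X" "\<And>n. w n \<in> B" "\<And>n. real_of_ereal (h (w n)) < - real n"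
    by (metis IntE)
  obtain u r where r: "strict_mono (r :: nat \<Rightarrow> nat)" "(w \<circ> r) \<longlonglongrightarrow> u"
    by (rule bounded_seq_subseq[OF w(2) B])
  have "real_of_ereal (h u) \<le> - real N" for N
  proof -
    have lim: "(\<lambda>n. (w \<circ> r) (n + N)) \<longlonglongrightarrow> u" by (rule LIMSEQ_ignore_initial_segment[OF r(2)])
    have "real_of_ereal (h ((w \<circ> r) (n + N))) \<le> - real N" for n
      using w(3)[of "r (n + N)"] seq_suble[OF r(1), of "n + N"] by simp
    then show ?thesis using closed_convex_fun_lsc[OF h _ lim] w(1) by simp
  qed
  then have "real N \<le> - real_of_ereal (h u)" for N by (metis le_minus_iff)
  then show False by (meson reals_Archimedean2 not_le)
qed

text \<open>The direct method without compactness: the quadratic minorant \<open>sb\<close> bounds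
  \<open>s\<close> below on bounded sets, strong convexity bounds the sublevel set, and lower
  semicontinuity of \<open>h\<close> keeps the limit of a minimizing sequence in
  \<open>X\<close>.\<close>

lemma strongly_convex_attains_min:
  fixes X :: "'a::euclidean_space set"
  assumes h: "closed_convex_fun X h" and X: "convex X" "X \<noteq> {}"
    and s: "continuous_on X s"
    and sb: "\<And>u. u \<in> X \<Longrightarrow> k + inner g (u - a) - kk * (norm (u - a))\<^sup>2 \<le> s u"
    and sc: "strongly_convex_on X c (\<lambda>u. s u + real_of_ereal (h u))" and c: "c > 0"
  shows "\<exists>x\<in>X. \<forall>u\<in>X. s x + real_of_ereal (h x) \<le> s u + real_of_ereal (h u)"
proof -
  define G where "G u = s u + real_of_ereal (h u)" for u
  have sbb: "\<exists>b. \<forall>u\<in>X \<inter> B. b \<le> s u" if B: "bounded B" for B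
  proof -
    have "continuous_on (closure B) (\<lambda>u. k + inner g (u - a) - kk * (norm (u - a))\<^sup>2)"
      by (intro continuous_intros)
    then have "bounded ((\<lambda>u. k + inner g (u - a) - kk * (norm (u - a))\<^sup>2) ` closure B)"
      using B by (intro compact_imp_bounded compact_continuous_image) (auto simp: compact_closure)
    then obtain b where b: "\<And>u. u \<in> closure B \<Longrightarrow> b \<le> k + inner g (u - a) - kk * (norm (u - a))\<^sup>2"
      by (meson bounded_imp_bdd_below bdd_below.unfold imageI)
    show ?thesis
    proof (rule exI[of _ b], intro ballI)
      fix u assume "u \<in> X \<inter> B"
      then show "b \<le> s u" using b[of u] sb[of u] closure_subset[of B] by fastforce
    qed
  qed
  have Gb: "\<exists>b. \<forall>u\<in>X \<inter> B. b \<le> G u" if B: "bounded B" for B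
  proof -
    obtain b b' where "\<forall>u\<in>X \<inter> B. b \<le> s u" "\<forall>u\<in>X \<inter> B. b' \<le> real_of_ereal (h u)"
      using sbb[OF B] closed_convex_fun_bounded_below[OF h B] by auto
    then show ?thesis by (intro exI[of _ "b + b'"]) (auto simp: G_def add_mono)
  qed
  obtain u0 where u0: "u0 \<in> X" using X by blast
  define V where "V = {u\<in>X. G u \<le> G u0}"
  obtain b where "\<forall>u\<in>X \<inter> cball u0 1. b \<le> G u"
    using Gb[OF bounded_cball[of u0 1]] by blast
  then have b: "\<And>u. u \<in> X \<Longrightarrow> norm (u - u0) \<le> 1 \<Longrightarrow> b \<le> G u"
    by (simp add: dist_norm norm_minus_commute)
  have Vb: "norm (u - u0) \<le> 1 + 2 * (G u0 - b) / c" if u: "u \<in> V" for u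
  proof (cases "norm (u - u0) \<le> 1")
    case True
    have "b \<le> G u0" using b[OF u0] by simp
    then have "0 \<le> 2 * (G u0 - b) / c" using c by simp
    then show ?thesis using True by linarith
  next
    case False
    define R where "R = norm (u - u0)"
    define t where "t = 1 / R"
    have R: "R > 1" using False by (simp add: R_def)
    have t: "0 < t" "t < 1" "t * R = 1" using R by (auto simp: t_def)
    \<comment> \<open>\<open>v\<close> has distance 1 from \<open>u0\<close>, where \<open>b\<close>
      bounds \<open>G\<close>. Strong convexity between \<open>u0\<close> and \<open>u\<close> turns
      this into b \<le> G u0 - c/2 (R - 1), a bound on R.\<close>
    define v where "v = (1 - t) *\<^sub>R u0 + t *\<^sub>R u"
    have vX: "v \<in> X" unfolding v_def using convex_combI[OF X(1) u0, of u t] u t by (auto simp: V_def)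
    have "v - u0 = t *\<^sub>R (u - u0)" by (simp add: v_def algebra_simps)
    then have "norm (v - u0) = t * R" using t by (simp add: R_def)
    then have "b \<le> G v" using b[OF vX] t by simp
    also have "G v \<le> (1 - t) * G u0 + t * G u - c / 2 * (t * (1 - t)) * (norm (u0 - u))\<^sup>2"
      using strongly_convex_onD[OF sc u0, of u t] u t by (simp add: v_def G_def V_def)
    also have "\<dots> \<le> (1 - t) * G u0 + t * G u0 - c / 2 * (t * (1 - t)) * (norm (u0 - u))\<^sup>2"
      using u t by (simp add: V_def)
    also have "\<dots> = G u0 - c / 2 * (R - 1)"
    proof -
      have "t * (1 - t) * (norm (u0 - u))\<^sup>2 = (t * R) * (R - t * R)"
        by (simp add: R_def norm_minus_commute power2_eq_square algebra_simps)
      also have "\<dots> = R - 1" using t by simp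
      finally have "c / 2 * (t * (1 - t)) * (norm (u0 - u))\<^sup>2 = c / 2 * (R - 1)" by (metis mult.assoc)
      moreover have "(1 - t) * G u0 + t * G u0 = G u0" by (simp add: algebra_simps)
      ultimately show ?thesis by linarith
    qed
    finally show ?thesis using c unfolding R_def[symmetric] by (simp add: field_simps)
  qed
  then have Vbd: "bounded V" 
    by (intro bounded_subset[OF bounded_cball[of u0 "1 + 2 * (G u0 - b) / c"]])
      (auto simp: dist_norm norm_minus_commute)
  have u0V: "u0 \<in> V" using u0 by (simp add: V_def)
  obtain b1 where "\<forall>u\<in>X \<inter> V. b1 \<le> G u" using Gb[OF Vbd] by blast
  then have b1: "\<And>u. u \<in> V \<Longrightarrow> b1 \<le> G u" by (simp add: V_def)
  define I where "I = Inf (G ` V)"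
  have bdd: "bdd_below (G ` V)" using b1 by (intro bdd_belowI[of _ b1]) auto
  have I_le: "I \<le> G u" if "u \<in> X" for u
  proof (cases "u \<in> V")
    case True then show ?thesis unfolding I_def using bdd by (auto intro: cInf_lower)
  next
    case False
    have "I \<le> G u0" unfolding I_def using bdd u0V by (auto intro: cInf_lower)
    then show ?thesis using False that by (simp add: V_def)
  qed
  have "\<exists>u. u \<in> V \<and> G u < I + 1 / (real n + 1)" for n :: nat
  proof -
    have "Inf (G ` V) < I + 1 / (real n + 1)" by (simp add: I_def)
    then show ?thesis using cInf_lessD[of "G ` V"] u0V by blast
  qed
  then obtain w where w: "\<And>n. w n \<in> V" "\<And>n. G (w n) < I + 1 / (real n + 1)" by metis
  have wX: "w n \<in> X" for n using w(1)[of n] by (simp add: V_def)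
  obtain u r where r: "strict_mono (r :: nat \<Rightarrow> nat)" "(w \<circ> r) \<longlonglongrightarrow> u"
    by (rule bounded_seq_subseq[OF w(1) Vbd])
  obtain b2 where "\<forall>u\<in>X \<inter> V. b2 \<le> s u" using sbb[OF Vbd] by blast
  then have b2: "\<And>u. u \<in> V \<Longrightarrow> b2 \<le> s u" by (simp add: V_def)
  have "real_of_ereal (h ((w \<circ> r) n)) \<le> I + 1 - b2" for n
  proof -
    have "G (w (r n)) < I + 1 / (real (r n) + 1)" "1 / (real (r n) + 1) \<le> 1" using w(2) by auto
    then show ?thesis using b2[OF w(1), of "r n"] unfolding G_def o_def by linarith
  qed
  note hb = this
  have uX: "u \<in> X" by (rule closed_convex_fun_lsc[OF h _ r(2) hb, THEN conjunct1]) (simp add: wX)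
  have su: "(\<lambda>n. s ((w \<circ> r) n)) \<longlonglongrightarrow> s u"
    by (rule continuous_on_tendsto_compose[OF s r(2) uX]) (simp add: wX)
  \<comment> \<open>The closedness lemma speaks of \<open>h\<close> alone, so the continuous part
    \<open>s\<close> is first replaced by its limit, at the cost of \<open>e\<close>.\<close>
  have "real_of_ereal (h u) \<le> I - s u + e" if e: "e > 0" for e
  proof -
    have "\<forall>\<^sub>F n in sequentially. s u - e / 2 < s ((w \<circ> r) n)"
      using order_tendstoD(1)[OF su, of "s u - e / 2"] e by simp
    moreover have "\<forall>\<^sub>F n in sequentially. 1 / (real n + 1) < e / 2"
      using order_tendstoD(2)[OF LIMSEQ_inverse_real_of_nat, of "e / 2"] e by (simp add: inverse_eq_divide add.commute)
    ultimately have "\<forall>\<^sub>F n in sequentially. s u - e / 2 < s ((w \<circ> r) n) \<and> 1 / (real n + 1) < e / 2"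
      by (rule eventually_conj)
    then obtain N where N: "\<And>n. n \<ge> N \<Longrightarrow> s u - e / 2 < s ((w \<circ> r) n) \<and> 1 / (real n + 1) < e / 2"
      by (auto simp: eventually_sequentially)
    have lim: "(\<lambda>n. (w \<circ> r) (n + N)) \<longlonglongrightarrow> u" by (rule LIMSEQ_ignore_initial_segment[OF r(2)])
    have "real_of_ereal (h ((w \<circ> r) (n + N))) \<le> I - s u + e" for n
    proof -
      have "1 / (real (r (n + N)) + 1) \<le> 1 / (real (n + N) + 1)"
        using seq_suble[OF r(1), of "n + N"] by (intro divide_left_mono) auto
      moreover have "s u - e / 2 < s ((w \<circ> r) (n + N))" "1 / (real (n + N) + 1) < e / 2"
        using N[of "n + N"] by auto
      ultimately show ?thesis using w(2)[of "r (n + N)"] unfolding G_def o_def by linarith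
    qed
    note hb = this
    show ?thesis by (rule closed_convex_fun_lsc[OF h _ lim hb, THEN conjunct2]) (simp add: wX)
  qed
  then have "real_of_ereal (h u) \<le> I - s u" by (rule field_le_epsilon)
  then have "G u \<le> I" by (simp add: G_def)
  then show ?thesis using uX I_le by (intro bexI[of _ u]) (auto simp: G_def[symmetric] intro: order_trans)
qed

section \<open>Gradients and mean values along segments\<close>

lemma GDERIV_unique:
  assumes "GDERIV f x :> g" "GDERIV f x :> g'"
  shows "g = g'"
proof -
  have "(\<lambda>h. inner h g) = (\<lambda>h. inner h g')"
    using assms unfolding gderiv_def by (rule has_derivative_unique)
  then have "inner h (g - g') = 0" for h by (metis inner_diff_right right_minus_eq)
  then show ?thesis using inner_eq_zero_iff right_minus_eq by blast
qed

lemma grad_eqI: "GDERIV f x :> g \<Longrightarrow> grad f x = g"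
  unfolding grad_def by (rule the_equality) (auto dest: GDERIV_unique)

lemma GDERIV_grad: "GDERIV f x :> g \<Longrightarrow> GDERIV f x :> grad f x"
  using grad_eqI[of f x g] by simp

lemma GDERIV_along_segment:
  assumes "GDERIV F (a + t *\<^sub>R d) :> g"
  shows "((\<lambda>t. F (a + t *\<^sub>R d)) has_real_derivative inner g d) (at t)"
proof -
  have "((\<lambda>t. a + t *\<^sub>R d) has_derivative (\<lambda>s. s *\<^sub>R d)) (at t)"
    by (auto intro!: derivative_eq_intros)
  then have "((\<lambda>t. F (a + t *\<^sub>R d)) has_derivative (\<lambda>s. inner (s *\<^sub>R d) g)) (at t)"
    using assms unfolding gderiv_def by (rule has_derivative_compose)
  then show ?thesis
    unfolding has_field_derivative_def by (simp add: inner_commute mult_commute_abs)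
qed

lemma GDERIV_mvt:
  assumes "\<And>t. 0 \<le> t \<Longrightarrow> t \<le> 1 \<Longrightarrow> GDERIV F (a + t *\<^sub>R (b - a)) :> D (a + t *\<^sub>R (b - a))"
  shows "\<exists>t. 0 < t \<and> t < 1 \<and> F b - F a = inner (D (a + t *\<^sub>R (b - a))) (b - a)"
proof -
  have "\<exists>t. 0 < t \<and> t < 1 \<and>
    (\<lambda>t. F (a + t *\<^sub>R (b - a))) 1 - (\<lambda>t. F (a + t *\<^sub>R (b - a))) 0
      = (1 - 0) * inner (D (a + t *\<^sub>R (b - a))) (b - a)"
    by (rule MVT2) (auto intro!: GDERIV_along_segment assms)
  then show ?thesis by simp
qed

lemma segment_mem:
  assumes "convex S" "a \<in> S" "b \<in> S" "0 \<le> t" "t \<le> 1"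
  shows "a + t *\<^sub>R (b - a) \<in> S"
proof -
  have "a + t *\<^sub>R (b - a) = (1 - t) *\<^sub>R a + t *\<^sub>R b" by (simp add: algebra_simps)
  then show ?thesis using convex_combI[OF assms] by simp
qed

text \<open>The descent lemma without an integral: the Lipschitz bound makes the derivative of
  \<open>g\<close>, the error of the quadratic upper model along the segment, nonpositive.\<close>

lemma smooth_upper_bound:
  assumes S: "convex S" and D: "\<And>x. x \<in> S \<Longrightarrow> GDERIV F x :> D x"
    and lip: "\<And>x y. x \<in> S \<Longrightarrow> y \<in> S \<Longrightarrow> norm (D x - D y) \<le> K * norm (x - y)"
    and x: "x \<in> S" and u: "u \<in> S"
  shows "F u \<le> F x + inner (D x) (u - x) + K / 2 * (norm (u - x))\<^sup>2"
proof -
  define d where "d = u - x"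
  define g where "g t = F (x + t *\<^sub>R d) - t * inner (D x) d - K / 2 * t^2 * (norm d)\<^sup>2" for t
  have "\<exists>y. (g has_real_derivative y) (at t) \<and> y \<le> 0" if t: "0 \<le> t" "t \<le> 1" for t
  proof -
    have xt: "x + t *\<^sub>R d \<in> S" using segment_mem[OF S x u t] by (simp add: d_def)
    have "(g has_real_derivative (inner (D (x + t *\<^sub>R d)) d - inner (D x) d - K * t * (norm d)\<^sup>2)) (at t)"
      unfolding g_def
      by (auto intro!: derivative_eq_intros GDERIV_along_segment[OF D[OF xt]])
    moreover have "inner (D (x + t *\<^sub>R d) - D x) d \<le> K * t * (norm d)\<^sup>2"
    proof -
      have "inner (D (x + t *\<^sub>R d) - D x) d \<le> norm (D (x + t *\<^sub>R d) - D x) * norm d"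
        by (rule norm_cauchy_schwarz)
      also have "\<dots> \<le> (K * norm (x + t *\<^sub>R d - x)) * norm d"
        by (rule mult_right_mono[OF lip[OF xt x]]) simp
      finally show ?thesis using t by (simp add: power2_eq_square)
    qed
    ultimately show ?thesis by (auto simp: inner_diff_left)
  qed
  then have "g 1 \<le> g 0" by (intro DERIV_nonpos_imp_nonincreasing[of 0 1 g]) auto
  then show ?thesis by (simp add: g_def d_def)
qed

section \<open>The accelerated composite gradient iteration\<close>

text \<open>\<open>arg_min\<close> is a choice operator that says nothing unless a minimizer exists,
  so every algorithmic step first needs attainment. The infinite values outside \<open>X\<close>
  force the choice into \<open>X\<close>.\<close>

lemma arg_min_ereal:
  fixes F :: "'a \<Rightarrow> ereal"
  assumes fin: "\<And>u. u \<in> X \<Longrightarrow> F u = ereal (G u)" and inf: "\<And>u. u \<notin> X \<Longrightarrow> F u = \<infinity>"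
    and ex: "\<exists>x\<in>X. \<forall>u\<in>X. G x \<le> G u"
  shows "arg_min F (\<lambda>_. True) \<in> X" "\<And>u. u \<in> X \<Longrightarrow> G (arg_min F (\<lambda>_. True)) \<le> G u"
proof -
  obtain x where x: "x \<in> X" "\<And>u. u \<in> X \<Longrightarrow> G x \<le> G u" using ex by blast
  have "is_arg_min F (\<lambda>_. True) x"
    unfolding is_arg_min_linorder
  proof (intro conjI allI impI)
    fix u show "F x \<le> F u" using x fin inf by (cases "u \<in> X") auto
  qed simp
  then have "is_arg_min F (\<lambda>_. True) (arg_min F (\<lambda>_. True))"
    unfolding arg_min_def by (rule someI)
  then have le: "F (arg_min F (\<lambda>_. True)) \<le> F u" for u by (simp add: is_arg_min_linorder)
  show X: "arg_min F (\<lambda>_. True) \<in> X"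
    using le[of x] fin[OF x(1)] inf by (metis ereal_infty_less_eq(1) PInfty_neq_ereal(1))
  show "G (arg_min F (\<lambda>_. True)) \<le> G u" if "u \<in> X" for u
    using le[of u] fin[OF X] fin[OF that] by simp
qed

text \<open>The curvature inequalities are required on \<open>S\<close> because a linearization
  point mixes \<open>acg_y\<close>, which stays in \<open>X\<close>, with \<open>acg_x\<close>,
  which is extrapolated and may leave it.\<close>

locale accelerated_gradient =
  fixes X S :: "'a::euclidean_space set" and psis :: "'a \<Rightarrow> real" and psin :: "'a \<Rightarrow> ereal"
    and w0 :: 'a and mu L :: real
  assumes X_convex: "convex X" and X_sub: "X \<subseteq> S" and w0_mem: "w0 \<in> X"
    and psin_closed: "closed_convex_fun X psin" and psis_cont: "continuous_on X psis"
    and mu_pos: "0 < mu" and L_pos: "0 < L"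
    and lower: "\<And>u v. u \<in> S \<Longrightarrow> v \<in> S \<Longrightarrow>
      linearization psis v u + mu / 2 * (norm (u - v))\<^sup>2 \<le> psis u"
    and upper: "\<And>u v. u \<in> S \<Longrightarrow> v \<in> S \<Longrightarrow>
      psis u \<le> linearization psis v u + L / 2 * (norm (u - v))\<^sup>2"
begin

definition "pn u = real_of_ereal (psin u)"
definition "psi u = psis u + pn u"

text \<open>The estimate sequence invariant: A Gam + |. - w0|^2 / 2 is a quadratic with minimizer
  \<open>acg_x\<close> and curvature 1 + mu A; Gam minorizes \<open>psi\<close> on \<open>X\<close>;
  and A psi at \<open>acg_y\<close> is at most the minimum of that quadratic. The factors
  \<open>acg_A\<close> make the initial state, where A = 0, satisfy it.\<close>

definition acg_inv :: "'a acg_state \<Rightarrow> bool" where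
  "acg_inv s \<longleftrightarrow> 0 \<le> acg_A s \<and> acg_y s \<in> X \<and>
     (\<forall>u. acg_A s * acg_Gam s u + (norm (u - w0))\<^sup>2 / 2
        = acg_A s * acg_Gam s (acg_x s) + (norm (acg_x s - w0))\<^sup>2 / 2
          + (1 + mu * acg_A s) / 2 * (norm (u - acg_x s))\<^sup>2) \<and>
     (\<forall>u\<in>X. acg_A s * acg_Gam s u \<le> acg_A s * psi u) \<and>
     acg_A s * psi (acg_y s) \<le> acg_A s * acg_Gam s (acg_x s) + (norm (acg_x s - w0))\<^sup>2 / 2"

lemma psin_eq: "u \<in> X \<Longrightarrow> psin u = ereal (pn u)"
  unfolding pn_def by (rule closed_convex_fun_finite[OF psin_closed])

lemma pn_convex: "strongly_convex_on X 0 pn"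
  using closed_convex_fun_convex[OF psin_closed X_convex] by (simp add: pn_def[abs_def])

definition q :: "'a \<Rightarrow> 'a \<Rightarrow> real" where
  "q v u = linearization psis v u + pn u + mu / 2 * (norm (u - v))\<^sup>2"

lemma q_le_psi: "u \<in> X \<Longrightarrow> v \<in> S \<Longrightarrow> q v u \<le> psi u"
  using lower[of u v] X_sub unfolding q_def psi_def by auto

lemma prox_strongly_convex:
  "strongly_convex_on X (L + mu) (\<lambda>u. q v u + L / 2 * (norm (u - v))\<^sup>2)"
proof -
  have "strongly_convex_on X (L + mu + 0)
     (\<lambda>u. (psis v + inner (grad psis v) (u - v) + (L + mu) / 2 * (norm (u - v))\<^sup>2) + pn u)"
    by (rule strongly_convex_on_add[OF strongly_convex_on_quadratic pn_convex])
  then show ?thesis by (simp add: q_def linearization_def add_divide_distrib ring_distribs add.assoc add.commute add.left_commute)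
qed

lemma prox_exists: "\<exists>x\<in>X. \<forall>u\<in>X. q v x + L / 2 * (norm (x - v))\<^sup>2 \<le> q v u + L / 2 * (norm (u - v))\<^sup>2"
proof -
  define s where "s u = psis v + inner (grad psis v) (u - v) + (L + mu) / 2 * (norm (u - v))\<^sup>2" for u
  have eq: "q v u + L / 2 * (norm (u - v))\<^sup>2 = s u + real_of_ereal (psin u)" for u
    by (simp add: q_def s_def linearization_def pn_def field_simps)
  have "\<exists>x\<in>X. \<forall>u\<in>X. s x + real_of_ereal (psin x) \<le> s u + real_of_ereal (psin u)"
  proof (rule strongly_convex_attains_min[OF psin_closed X_convex, where k="psis v"
        and g="grad psis v" and a=v and kk=0 and c="L + mu"])
    show "continuous_on X s" unfolding s_def by (intro continuous_intros)
    show "strongly_convex_on X (L + mu) (\<lambda>u. s u + real_of_ereal (psin u))"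
      using prox_strongly_convex[of v] unfolding eq .
  qed (use w0_mem mu_pos L_pos in \<open>auto simp: s_def\<close>)
  then show ?thesis unfolding eq .
qed

text \<open>The prox objective has modulus L + mu and \<open>y\<close> minimizes it; subtracting L/2
  |u - v|^2 leaves growth mu. So the quadratic that the method averages into \<open>acg_Gam\<close>
  minorizes the model \<open>q\<close> on \<open>X\<close>.\<close>

lemma q_lower:
  assumes y: "y \<in> X"
    and min: "\<And>u. u \<in> X \<Longrightarrow> q v y + L / 2 * (norm (y - v))\<^sup>2 \<le> q v u + L / 2 * (norm (u - v))\<^sup>2"
    and u: "u \<in> X"
  shows "q v y + L * inner (v - y) (u - y) + mu / 2 * (norm (u - y))\<^sup>2 \<le> q v u"
proof -
  have "q v y + L / 2 * (norm (y - v))\<^sup>2 + (L + mu) / 2 * (norm (u - y))\<^sup>2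
      \<le> q v u + L / 2 * (norm (u - v))\<^sup>2"
    using strongly_convex_on_growth[OF X_convex prox_strongly_convex y min u] .
  moreover have "L / 2 * (norm (u - v))\<^sup>2
      = L / 2 * (norm (y - v))\<^sup>2 + L / 2 * (norm (u - y))\<^sup>2 - L * inner (v - y) (u - y)"
    by (simp add: power2_norm_eq_inner inner_simps inner_commute field_simps)
  ultimately show ?thesis by (simp add: field_simps)
qed

lemma acg_step_y:
  defines "s' \<equiv> \<lambda>s. acg_step psis psin mu L s"
  shows "acg_y (s' s) \<in> X"
    and "u \<in> X \<Longrightarrow> q (acg_xt mu L s) (acg_y (s' s)) + L / 2 * (norm (acg_y (s' s) - acg_xt mu L s))\<^sup>2
       \<le> q (acg_xt mu L s) u + L / 2 * (norm (u - acg_xt mu L s))\<^sup>2"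
proof -
  define v where "v = acg_xt mu L s"
  define F where "F u = ereal (1 / L) * (ereal (linearization psis v u) + psin u
     + ereal (mu / 2 * (norm (u - v))\<^sup>2)) + ereal ((norm (u - v))\<^sup>2 / 2)" for u
  define H where "H u = q v u + L / 2 * (norm (u - v))\<^sup>2" for u
  have y: "acg_y (s' s) = arg_min F (\<lambda>_. True)"
    by (simp add: s'_def acg_step_def Let_def v_def F_def[abs_def])
  have fin: "F u = ereal (H u / L)" if "u \<in> X" for u
    using L_pos by (simp add: F_def H_def psin_eq[OF that] q_def field_simps)
  have inf: "F u = \<infinity>" if "u \<notin> X" for u
    using L_pos closed_convex_fun_outside[OF psin_closed that] by (simp add: F_def)
  have ex: "\<exists>x\<in>X. \<forall>u\<in>X. H x / L \<le> H u / L"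
    using prox_exists[of v] L_pos by (simp add: H_def divide_le_cancel)
  have am: "arg_min F (\<lambda>_. True) \<in> X" "\<forall>u\<in>X. H (arg_min F (\<lambda>_. True)) / L \<le> H u / L"
    using arg_min_ereal[of X F "\<lambda>u. H u / L"] fin inf ex by auto
  show "acg_y (s' s) \<in> X" unfolding y by (rule am(1))
  show "q (acg_xt mu L s) (acg_y (s' s)) + L / 2 * (norm (acg_y (s' s) - acg_xt mu L s))\<^sup>2
       \<le> q (acg_xt mu L s) u + L / 2 * (norm (u - acg_xt mu L s))\<^sup>2" if "u \<in> X"
    using bspec[OF am(2) that] L_pos unfolding y v_def[symmetric] H_def by (simp add: divide_le_cancel)
qed

text \<open>\<open>a\<close> is the positive root of L a^2 = (1 + mu A) (A + a). For the growth law
  in the last claim, the root inside \<open>a\<close> is at least 2 sqrt (tau A), which makes A + a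
  dominate the square of sqrt A + sqrt tau / 2.\<close>

lemma acg_a_facts:
  assumes "0 \<le> acg_A s"
  defines "a \<equiv> acg_a mu L s" and "tau \<equiv> (1 + mu * acg_A s) / L"
  shows "0 < tau" "0 < a" "a\<^sup>2 = tau * (acg_A s + a)"
    and "sqrt (acg_A s) + sqrt tau / 2 \<le> sqrt (acg_A s + a)"
proof -
  define A where "A = acg_A s"
  have A: "0 \<le> A" using assms by (simp add: A_def)
  show tau: "0 < tau" using A L_pos mu_pos unfolding tau_def A_def[symmetric]
    by (intro divide_pos_pos add_pos_nonneg) auto
  have a: "a = (tau + sqrt (tau\<^sup>2 + 4 * tau * A)) / 2"
    by (simp add: a_def acg_a_def tau_def A_def Let_def)
  define R where "R = sqrt (tau\<^sup>2 + 4 * tau * A)"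
  have R2: "R\<^sup>2 = tau\<^sup>2 + 4 * tau * A" and R0: "0 \<le> R" using tau A by (simp_all add: R_def)
  show "0 < a" using tau R0 by (simp add: a R_def[symmetric])
  show "a\<^sup>2 = tau * (acg_A s + a)"
    using R2 unfolding a R_def[symmetric] A_def[symmetric]
    by (simp add: power2_eq_square field_simps)
  have "2 * sqrt tau * sqrt A \<le> R"
    unfolding R_def using tau A by (intro real_le_rsqrt) (simp add: power_mult_distrib)
  moreover have "(sqrt A + sqrt tau / 2)\<^sup>2 = A + sqrt tau * sqrt A + tau / 4"
    using tau A by (simp add: power2_sum power_divide)
  moreover have "A + a = A + tau / 2 + R / 2" by (simp add: a R_def add_divide_distrib)
  ultimately have "(sqrt A + sqrt tau / 2)\<^sup>2 \<le> A + a" using tau by linarith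
  then show "sqrt (acg_A s) + sqrt tau / 2 \<le> sqrt (acg_A s + a)"
    unfolding A_def[symmetric] by (rule real_le_rsqrt)
qed

lemma acg_step_simps:
  fixes s :: "'a acg_state"
  defines "v \<equiv> acg_xt mu L s" and "s' \<equiv> acg_step psis psin mu L s" and "a \<equiv> acg_a mu L s"
  shows "acg_A s' = acg_A s + a"
    and "acg_x s' = acg_x s + (a / (1 + mu * acg_A s')) *\<^sub>R (L *\<^sub>R (acg_y s' - v) + mu *\<^sub>R (acg_y s' - acg_x s))"
    and "acg_Gam s' u = acg_A s / acg_A s' * acg_Gam s u + a / acg_A s' * 
      (q v (acg_y s') + L * inner (v - acg_y s') (u - acg_y s') + mu / 2 * (norm (u - acg_y s'))\<^sup>2)"
    and "v = (acg_A s / acg_A s') *\<^sub>R acg_y s + (a / acg_A s') *\<^sub>R acg_x s"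
proof -
  show A': "acg_A s' = acg_A s + a" by (simp add: s'_def a_def acg_step_def Let_def)
  show "acg_x s' = acg_x s + (a / (1 + mu * acg_A s')) *\<^sub>R (L *\<^sub>R (acg_y s' - v) + mu *\<^sub>R (acg_y s' - acg_x s))"
    by (simp add: s'_def a_def v_def acg_step_def Let_def)
  have y': "acg_y s' \<in> X" unfolding s'_def by (rule acg_step_y)
  show "acg_Gam s' u = acg_A s / acg_A s' * acg_Gam s u + a / acg_A s' * 
      (q v (acg_y s') + L * inner (v - acg_y s') (u - acg_y s') + mu / 2 * (norm (u - acg_y s'))\<^sup>2)"
    using psin_eq[OF y'] by (simp add: s'_def a_def v_def acg_step_def Let_def q_def)
  show "v = (acg_A s / acg_A s') *\<^sub>R acg_y s + (a / acg_A s') *\<^sub>R acg_x s"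
    unfolding A' by (simp add: v_def a_def acg_xt_def Let_def)
qed

lemma acg_inv_init: "acg_inv (acg_init w0)"
  using w0_mem by (simp add: acg_inv_def acg_init_def)

text \<open>The update of \<open>acg_x\<close> cleared of its denominator: it is the stationarity
  condition for the new quadratic A' Gam' + |. - w0|^2 / 2.\<close>

lemma acg_step_balance:
  assumes A: "0 \<le> acg_A s"
  defines "v \<equiv> acg_xt mu L s" and "s' \<equiv> acg_step psis psin mu L s" and "a \<equiv> acg_a mu L s"
  shows "(1 + mu * acg_A s') *\<^sub>R (acg_x s' - acg_x s) = a *\<^sub>R (L *\<^sub>R (acg_y s' - v) + mu *\<^sub>R (acg_y s' - acg_x s))"
proof -
  have "0 < 1 + mu * acg_A s'"
    using acg_a_facts(2)[OF A] A mu_pos unfolding s'_def acg_step_simps(1) by (simp add: add_pos_nonneg)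
  then show ?thesis unfolding s'_def v_def a_def acg_step_simps(2)[of s] by simp
qed

text \<open>The balance equation solved for the new \<open>acg_y\<close>: the coefficient of the old
  \<open>acg_x\<close> vanishes because L a^2 / A' = 1 + mu A. The remaining weights are
  nonnegative.\<close>

lemma acg_y_convex_comb:
  assumes A: "0 \<le> acg_A s"
  defines "s' \<equiv> acg_step psis psin mu L s" and "a \<equiv> acg_a mu L s"
  shows "(a * (L + mu)) *\<^sub>R acg_y s' = (1 + mu * acg_A s') *\<^sub>R acg_x s' + (a * L * acg_A s / acg_A s') *\<^sub>R acg_y s"
    and "a * (L + mu) = (1 + mu * acg_A s') + a * L * acg_A s / acg_A s'"
proof -
  define v where "v = acg_xt mu L s"
  note f = acg_a_facts[OF A, folded a_def]
  have A': "acg_A s' = acg_A s + a" unfolding s'_def a_def by (rule acg_step_simps)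
  have A'p: "acg_A s' > 0" using f(2) A A' by simp
  have tau: "L * a * (a / acg_A s') = 1 + mu * acg_A s"
    using f(3) A'p L_pos A' by (simp add: field_simps power2_eq_square)
  have v: "v = (acg_A s / acg_A s') *\<^sub>R acg_y s + (a / acg_A s') *\<^sub>R acg_x s"
    unfolding v_def s'_def a_def by (rule acg_step_simps)
  have bal: "(1 + mu * acg_A s') *\<^sub>R (acg_x s' - acg_x s) = a *\<^sub>R (L *\<^sub>R (acg_y s' - v) + mu *\<^sub>R (acg_y s' - acg_x s))"
    unfolding s'_def v_def a_def by (rule acg_step_balance[OF A])
  have Lv: "(a * L) *\<^sub>R v = (a * L * acg_A s / acg_A s') *\<^sub>R acg_y s + (1 + mu * acg_A s) *\<^sub>R acg_x s"
    unfolding v tau[symmetric] by (simp add: scaleR_add_right mult.commute mult.left_commute)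
  have "(a * (L + mu)) *\<^sub>R acg_y s' = (1 + mu * acg_A s') *\<^sub>R (acg_x s' - acg_x s) + (a * L) *\<^sub>R v + (a * mu) *\<^sub>R acg_x s"
    unfolding bal by (simp add: algebra_simps)
  also have "\<dots> = (1 + mu * acg_A s') *\<^sub>R acg_x s' + (a * L * acg_A s / acg_A s') *\<^sub>R acg_y s"
    unfolding Lv A' by (simp add: algebra_simps)
  finally show "(a * (L + mu)) *\<^sub>R acg_y s' = (1 + mu * acg_A s') *\<^sub>R acg_x s' + (a * L * acg_A s / acg_A s') *\<^sub>R acg_y s" .
  have "acg_A s / acg_A s' + a / acg_A s' = 1"
    using A'p A' by (simp add: add_divide_distrib[symmetric])
  then have "a * L * (acg_A s / acg_A s' + a / acg_A s') = a * L" by simp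
  then have "a * L = a * L * acg_A s / acg_A s' + L * a * (a / acg_A s')"
    by (simp add: ring_distribs mult.commute)
  then show "a * (L + mu) = (1 + mu * acg_A s') + a * L * acg_A s / acg_A s'"
    unfolding tau using arg_cong[OF A', of "\<lambda>z. mu * z"] by (simp add: ring_distribs)
qed

lemma acg_inv_step:
  assumes inv: "acg_inv s" and v_S: "acg_xt mu L s \<in> S"
  shows "acg_inv (acg_step psis psin mu L s)"
proof -
  define s' where "s' = acg_step psis psin mu L s"
  define v where "v = acg_xt mu L s"
  define a where "a = acg_a mu L s"
  define A where "A = acg_A s"
  define A' where "A' = acg_A s'"
  define x where "x = acg_x s"
  define x' where "x' = acg_x s'"
  define y where "y = acg_y s"
  define y' where "y' = acg_y s'"
  define gam where "gam u = q v y' + L * inner (v - y') (u - y') + mu / 2 * (norm (u - y'))\<^sup>2" for u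
  have A: "0 \<le> A" and yX: "y \<in> X"
    and i1: "A * acg_Gam s u + (norm (u - w0))\<^sup>2 / 2
        = A * acg_Gam s x + (norm (x - w0))\<^sup>2 / 2 + (1 + mu * A) / 2 * (norm (u - x))\<^sup>2"
    and i2: "u \<in> X \<Longrightarrow> A * acg_Gam s u \<le> A * psi u"
    and i3: "A * psi y \<le> A * acg_Gam s x + (norm (x - w0))\<^sup>2 / 2" for u
    using inv unfolding acg_inv_def A_def x_def y_def by blast+
  note f = acg_a_facts[OF A[unfolded A_def], folded a_def A_def]
  have A'_eq: "A' = A + a" unfolding A'_def A_def s'_def a_def by (rule acg_step_simps)
  have A'p: "A' > 0" using f(2) A A'_eq by simp
  have y'X: "y' \<in> X" unfolding y'_def s'_def by (rule acg_step_y)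
  have gam_q: "gam u \<le> q v u" if "u \<in> X" for u
    unfolding gam_def
  proof (rule q_lower[OF y'X _ that])
    show "q v y' + L / 2 * (norm (y' - v))\<^sup>2 \<le> q v u + L / 2 * (norm (u - v))\<^sup>2" if "u \<in> X" for u
      unfolding y'_def s'_def v_def using that by (rule acg_step_y(2))
  qed
  have gam_psi: "gam u \<le> psi u" if "u \<in> X" for u
    using gam_q[OF that] q_le_psi[OF that v_S] by (simp add: v_def)
  have Gam': "A' * acg_Gam s' u = A * acg_Gam s u + a * gam u" for u
  proof -
    have "acg_Gam s' u = A / A' * acg_Gam s u + a / A' * gam u"
      unfolding gam_def A'_def A_def s'_def v_def a_def y'_def by (rule acg_step_simps)
    then show ?thesis using A'p by (simp add: ring_distribs)
  qed
  have bal: "(1 + mu * A') *\<^sub>R (x' - x) = a *\<^sub>R (L *\<^sub>R (y' - v) + mu *\<^sub>R (y' - x))"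
    unfolding A'_def x'_def x_def a_def y'_def v_def s'_def
    by (rule acg_step_balance) (use A in \<open>simp add: A_def\<close>)
  define m0 where "m0 = A * acg_Gam s x + (norm (x - w0))\<^sup>2 / 2"
  have tot: "A' * acg_Gam s' u + (norm (u - w0))\<^sup>2 / 2
      = m0 + (1 + mu * A) / 2 * (norm (u - x))\<^sup>2 + a * gam u" for u
    using i1[of u] unfolding Gam' m0_def by linarith
  \<comment> \<open>Expanded around \<open>x'\<close>, the terms linear in \<open>d\<close> cancel
    by \<open>bal\<close>; this makes \<open>x'\<close> the minimizer of the new quadratic.\<close>
  have "A' * acg_Gam s' u + (norm (u - w0))\<^sup>2 / 2
      = A' * acg_Gam s' x' + (norm (x' - w0))\<^sup>2 / 2 + (1 + mu * A') / 2 * (norm (u - x'))\<^sup>2" for u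
  proof -
    define d where "d = u - x'"
    define e where "e = x' - x"
    have u: "u - x = e + d" "u - y' = (x' - y') + d" by (simp_all add: d_def e_def)
    have "inner ((1 + mu * A') *\<^sub>R e) d = inner (a *\<^sub>R (L *\<^sub>R (y' - v) + mu *\<^sub>R (y' - x))) d"
      using bal by (simp add: e_def)
    then have l: "(1 + mu * A') * inner e d = a * (L * inner (y' - v) d + mu * inner (y' - x) d)"
      by (simp add: inner_simps)
    have "y' - x = e - (x' - y')" by (simp add: e_def)
    then have l2: "(1 + mu * A) * inner e d = a * L * inner (y' - v) d - a * mu * inner (x' - y') d"
      using l unfolding A'_eq by (simp add: inner_simps algebra_simps)
    have n: "(norm (e + d))\<^sup>2 = (norm e)\<^sup>2 + 2 * inner e d + (norm d)\<^sup>2"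
      "(norm (x' - y' + d))\<^sup>2 = (norm (x' - y'))\<^sup>2 + 2 * inner (x' - y') d + (norm d)\<^sup>2"
      by (simp_all add: power2_norm_eq_inner inner_simps inner_commute)
    have "(1 + mu * A) / 2 * (norm (u - x))\<^sup>2 + a * gam u
       = (1 + mu * A) / 2 * (norm e)\<^sup>2 + (1 + mu * A) * inner e d + (1 + mu * A) / 2 * (norm d)\<^sup>2
         + a * (q v y' + L * (inner (v - y') (x' - y') - inner (y' - v) d)
            + mu / 2 * (norm (x' - y'))\<^sup>2 + mu * inner (x' - y') d + mu / 2 * (norm d)\<^sup>2)"
      unfolding gam_def u n by (simp add: inner_simps field_simps)
    also have "\<dots> = (1 + mu * A) / 2 * (norm e)\<^sup>2 + a * gam x' + (1 + mu * A') / 2 * (norm d)\<^sup>2"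
      unfolding l2 gam_def A'_eq by (simp add: field_simps)
    finally show ?thesis unfolding tot by (simp add: d_def e_def)
  qed
  moreover have "A' * acg_Gam s' u \<le> A' * psi u" if "u \<in> X" for u
    using i2[OF that] mult_left_mono[OF gam_psi[OF that] less_imp_le[OF f(2)]]
    unfolding Gam' unfolding A'_eq distrib_right by linarith
  moreover have "A' * psi y' \<le> A' * acg_Gam s' x' + (norm (x' - w0))\<^sup>2 / 2"
  proof -
    \<comment> \<open>\<open>w\<close> replaces \<open>x\<close> by \<open>x'\<close> in the
      combination defining \<open>v\<close>, so w - v = (a / A') (x' - x). As A' L (a / A')^2 = 1 +
      mu A, the prox term at \<open>w\<close> costs exactly the growth stored in the old
      invariant.\<close>
    define w where "w = (1 - a / A') *\<^sub>R y + (a / A') *\<^sub>R x'"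
    have tt: "1 - a / A' = A / A'" "0 \<le> a / A'" "a / A' \<le> 1"
      using A'p A'_eq A f(2) by (auto simp: field_simps)
    have v: "v = (A / A') *\<^sub>R y + (a / A') *\<^sub>R x"
      unfolding v_def A_def A'_def y_def x_def a_def s'_def by (rule acg_step_simps)
    have "w - v = (a / A') *\<^sub>R (x' - x)" unfolding w_def tt v by (simp add: algebra_simps)
    then have wv: "(norm (w - v))\<^sup>2 = (a / A')\<^sup>2 * (norm (x' - x))\<^sup>2"
      by (simp only: norm_scaleR power_mult_distrib power2_abs)
    have "A' * (L / 2 * (norm (w - v))\<^sup>2) = (1 + mu * A) / 2 * (norm (x' - x))\<^sup>2"
    proof -
      have "A' * L * (a / A')\<^sup>2 = 1 + mu * A"
      proof -
        have "a\<^sup>2 = (1 + mu * A) / L * A'" using f(3) by (simp add: A'_eq)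
        moreover have "A' * L * (a / A')\<^sup>2 = L * (a\<^sup>2 / A')" using A'p by (simp add: power2_eq_square)
        ultimately show ?thesis using A'p L_pos by simp
      qed
      then have "A' * L * ((a / A')\<^sup>2 * (norm (x' - x))\<^sup>2) = (1 + mu * A) * (norm (x' - x))\<^sup>2"
        by (metis mult.assoc)
      then show ?thesis unfolding wv by simp
    qed
    moreover have "A' * gam w \<le> A * gam y + a * gam x'"
    proof -
      have "strongly_convex_on UNIV mu gam" unfolding gam_def
        using strongly_convex_on_quadratic[of UNIV mu "q v y'" "L *\<^sub>R (v - y')" y' y'] by simp
      from strongly_convex_onD[OF this, of y x' "a / A'"] tt
      have "gam w \<le> (A / A') * gam y + (a / A') * gam x'
         - mu / 2 * (a / A' * (1 - a / A')) * (norm (y - x'))\<^sup>2" by (simp add: w_def)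
      also have "\<dots> \<le> (A / A') * gam y + (a / A') * gam x'"
      proof -
        have "0 \<le> mu / 2 * (a / A' * (1 - a / A')) * (norm (y - x'))\<^sup>2"
          using tt(2,3) mu_pos by (intro mult_nonneg_nonneg) auto
        then show ?thesis by linarith
      qed
      finally show ?thesis using A'p by (simp add: field_simps)
    qed
    moreover have "A * gam y \<le> A * psi y" using gam_psi[OF yX] A by (rule mult_left_mono)
    moreover have "A' * (psi y') \<le> A' * (gam w + L / 2 * (norm (w - v))\<^sup>2)"
    proof -
      \<comment> \<open>\<open>y'\<close> minimizes gam + L/2 |. - v|^2 over the whole space, which
        allows the comparison with \<open>w\<close> even if \<open>w\<close> is outside
        \<open>X\<close>.\<close>
      have "gam w + L / 2 * (norm (w - v))\<^sup>2 = q v y' + L / 2 * (norm (y' - v))\<^sup>2 + (L + mu) / 2 * (norm (w - y'))\<^sup>2"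
        unfolding gam_def by (simp add: power2_norm_eq_inner inner_simps inner_commute field_simps)
      moreover have "psi y' \<le> q v y' + L / 2 * (norm (y' - v))\<^sup>2"
        using upper[of y' v] y'X X_sub v_S mu_pos unfolding psi_def q_def v_def
        by (smt (verit) subsetD mult_nonneg_nonneg zero_le_power2 half_gt_zero)
      moreover have "0 \<le> (L + mu) / 2 * (norm (w - y'))\<^sup>2" using L_pos mu_pos by simp
      ultimately have "psi y' \<le> gam w + L / 2 * (norm (w - v))\<^sup>2" by linarith
      then show ?thesis using A'p by simp
    qed
    ultimately show ?thesis
      unfolding tot using i3 unfolding m0_def[symmetric] by (simp add: ring_distribs)
  qed
  ultimately show ?thesis
    using less_imp_le[OF A'p] y'X unfolding s'_def[symmetric] acg_inv_def A'_def x'_def y'_def by blast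
qed

section \<open>Growth of \<open>acg_A\<close> and certificates read off from the invariant\<close>

abbreviation "st \<equiv> acg psis psin w0 mu L"

definition "linearized n \<longleftrightarrow> (\<forall>k<n. acg_xt mu L (st k) \<in> S)"

lemma st_0: "st 0 = acg_init w0" and st_Suc: "st (Suc k) = acg_step psis psin mu L (st k)"
  by (simp_all add: acg_def)

lemma linearized_mono: "linearized n \<Longrightarrow> k \<le> n \<Longrightarrow> linearized k"
  by (simp add: linearized_def)

lemma acg_inv_st: "linearized k \<Longrightarrow> acg_inv (st k)"
proof (induction k)
  case (Suc k)
  then show ?case unfolding st_Suc by (intro acg_inv_step) (auto simp: linearized_def)
qed (simp add: st_0 acg_inv_init)

lemma acg_A_growth:
  assumes "linearized k"
  shows "sqrt (acg_A (st k)) + sqrt ((1 + mu * acg_A (st k)) / L) / 2 \<le> sqrt (acg_A (st (Suc k)))"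
    and "acg_A (st k) < acg_A (st (Suc k))"
  using acg_a_facts[of "st k"] acg_inv_st[OF assms]
  unfolding st_Suc acg_step_simps(1) acg_inv_def by auto

lemma acg_A_nonneg: "linearized k \<Longrightarrow> 0 \<le> acg_A (st k)"
  using acg_inv_st by (simp add: acg_inv_def)

lemma acg_A_pos: "linearized k \<Longrightarrow> 1 \<le> k \<Longrightarrow> 0 < acg_A (st k)"
  using acg_A_growth(2)[of "k - 1"] acg_A_nonneg[of "k - 1"] linearized_mono[of k "k - 1"] by force

lemma acg_A_quadratic: "linearized k \<Longrightarrow> real k / (2 * sqrt L) \<le> sqrt (acg_A (st k))"
proof (induction k)
  case (Suc k)
  have lk: "linearized k" using Suc.prems by (rule linearized_mono) simp
  have "1 / L \<le> (1 + mu * acg_A (st k)) / L"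
    using acg_A_nonneg[OF lk] mu_pos L_pos by (simp add: divide_right_mono)
  then have "1 / sqrt L \<le> sqrt ((1 + mu * acg_A (st k)) / L)"
    by (metis real_sqrt_divide real_sqrt_le_mono real_sqrt_one)
  then show ?case using acg_A_growth(1)[OF lk] Suc.IH[OF lk] by (simp add: add_divide_distrib)
qed (simp add: st_0 acg_init_def)

text \<open>Dropping the 1 in 1 + mu A makes the growth law multiplicative. The induction starts at
  index 1 with the quadratic bound, since A_0 = 0 cannot be multiplied up.\<close>

lemma acg_A_geometric:
  assumes "linearized (Suc k)"
  shows "(1 + sqrt (mu / L) / 2) ^ k / (2 * sqrt L) \<le> sqrt (acg_A (st (Suc k)))"
  using assms
proof (induction k)
  case 0
  then show ?case using acg_A_quadratic[of "Suc 0"] by simp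
next
  case (Suc k)
  have lk: "linearized (Suc k)" using Suc.prems by (rule linearized_mono) simp
  define A where "A = acg_A (st (Suc k))"
  have A: "0 \<le> A" unfolding A_def by (rule acg_A_nonneg[OF lk])
  have "mu / L * A \<le> (1 + mu * A) / L" using L_pos by (simp add: field_simps)
  then have "sqrt (mu / L) * sqrt A \<le> sqrt ((1 + mu * A) / L)"
    by (metis real_sqrt_mult real_sqrt_le_mono)
  then have "(1 + sqrt (mu / L) / 2) * sqrt A \<le> sqrt (acg_A (st (Suc (Suc k))))"
    using acg_A_growth(1)[OF lk] unfolding A_def[symmetric] by (simp add: ring_distribs)
  moreover have "(1 + sqrt (mu / L) / 2) * ((1 + sqrt (mu / L) / 2) ^ k / (2 * sqrt L))
      \<le> (1 + sqrt (mu / L) / 2) * sqrt A"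
    using Suc.IH[OF lk] mu_pos L_pos unfolding A_def[symmetric] by (intro mult_left_mono) auto
  ultimately show ?case by simp
qed

context
  fixes k :: nat
  assumes lin: "linearized k" and k: "1 \<le> k"
begin

abbreviation (input) "Ak \<equiv> acg_A (st k)"
abbreviation (input) "yk \<equiv> acg_y (st k)"
abbreviation (input) "xk \<equiv> acg_x (st k)"
abbreviation (input) "rk \<equiv> acg_r w0 (st k)"
abbreviation (input) "etak \<equiv> acg_eta psis psin w0 (st k)"

lemma acg_y_mem: "yk \<in> X"
  using acg_inv_st[OF lin] by (simp add: acg_inv_def)

lemma acg_eta_eq: "etak = psi yk - acg_Gam (st k) xk - inner rk (yk - xk)"
  using psin_eq[OF acg_y_mem] by (simp add: acg_eta_def psi_def)

lemma acg_r_eq: "Ak *\<^sub>R rk = w0 - xk"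
  using acg_A_pos[OF lin k] by (simp add: acg_r_def)

text \<open>As A r = w0 - x_k, the first invariant says that Gam has slope r and curvature mu at
  x_k. The curvature term is kept: it gives the lower bound on eta and part of the gap
  estimate.\<close>

lemma acg_subgradient:
  assumes u: "u \<in> X"
  shows "psi yk + inner rk (u - yk) - etak + mu / 2 * (norm (u - xk))\<^sup>2 \<le> psi u"
proof -
  note Ap = acg_A_pos[OF lin k]
  have i1: "Ak * acg_Gam (st k) u + (norm (u - w0))\<^sup>2 / 2
        = Ak * acg_Gam (st k) xk + (norm (xk - w0))\<^sup>2 / 2 + (1 + mu * Ak) / 2 * (norm (u - xk))\<^sup>2"
    and i2: "Ak * acg_Gam (st k) u \<le> Ak * psi u"
    using acg_inv_st[OF lin] u unfolding acg_inv_def by blast+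
  have "Ak * inner rk (u - xk) = inner (w0 - xk) (u - xk)"
    using acg_r_eq by (metis inner_scaleR_left)
  also have "\<dots> = (norm (xk - w0))\<^sup>2 / 2 - (norm (u - w0))\<^sup>2 / 2 + (norm (u - xk))\<^sup>2 / 2"
    by (simp add: power2_norm_eq_inner inner_simps inner_commute field_simps)
  finally have "Ak * acg_Gam (st k) u
      = Ak * (acg_Gam (st k) xk + inner rk (u - xk) + mu / 2 * (norm (u - xk))\<^sup>2)"
    using i1 by (simp add: field_simps)
  then have "acg_Gam (st k) xk + inner rk (u - xk) + mu / 2 * (norm (u - xk))\<^sup>2 \<le> psi u"
    using i2 Ap by simp
  then show ?thesis unfolding acg_eta_eq by (simp add: inner_simps)
qed

lemma acg_eta_lower: "mu / 2 * (norm (yk - xk))\<^sup>2 \<le> etak"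
  using acg_subgradient[OF acg_y_mem] by simp

text \<open>The third invariant in terms of r. Multiplied by A, it reads |A r + y - w0|^2 + 2 A eta
  \<le> |y - w0|^2.\<close>

lemma acg_eta_upper: "Ak * (norm rk)\<^sup>2 + 2 * inner rk (yk - w0) + 2 * etak \<le> 0"
proof -
  note Ap = acg_A_pos[OF lin k]
  have i3: "Ak * psi yk \<le> Ak * acg_Gam (st k) xk + (norm (xk - w0))\<^sup>2 / 2"
    using acg_inv_st[OF lin] unfolding acg_inv_def by blast
  have r: "Ak * inner rk z = inner (w0 - xk) z" for z
    using acg_r_eq by (metis inner_scaleR_left)
  have "Ak * (Ak * (norm rk)\<^sup>2) = (norm (w0 - xk))\<^sup>2"
    using arg_cong[OF acg_r_eq, of "\<lambda>z. (norm z)\<^sup>2"] Ap by (simp add: power_mult_distrib power2_eq_square mult.assoc mult.left_commute)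
  moreover have "Ak * etak \<le> (norm (xk - w0))\<^sup>2 / 2 - inner (w0 - xk) (yk - xk)"
    using i3 r[of "yk - xk"] unfolding acg_eta_eq by (simp add: algebra_simps)
  ultimately have "Ak * (Ak * (norm rk)\<^sup>2 + 2 * inner rk (yk - w0) + 2 * etak)
    \<le> (norm (w0 - xk))\<^sup>2 + 2 * inner (w0 - xk) (yk - w0) + (norm (xk - w0))\<^sup>2 - 2 * inner (w0 - xk) (yk - xk)"
    using r[of "yk - w0"] by (simp add: ring_distribs)
  also have "\<dots> = 0"
    by (simp add: power2_norm_eq_inner inner_simps inner_commute)
  finally show ?thesis using Ap by (simp add: mult_le_0_iff)
qed

lemma acg_descent:
  assumes u: "u \<in> X"
  shows "psi yk \<le> psi u + (norm (u - w0))\<^sup>2 / (2 * Ak) - (1 + mu * Ak) / (2 * Ak) * (norm (u - xk))\<^sup>2"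
proof -
  note Ap = acg_A_pos[OF lin k]
  have "Ak * acg_Gam (st k) u + (norm (u - w0))\<^sup>2 / 2
        = Ak * acg_Gam (st k) xk + (norm (xk - w0))\<^sup>2 / 2 + (1 + mu * Ak) / 2 * (norm (u - xk))\<^sup>2"
    "Ak * acg_Gam (st k) u \<le> Ak * psi u"
    "Ak * psi yk \<le> Ak * acg_Gam (st k) xk + (norm (xk - w0))\<^sup>2 / 2"
    using acg_inv_st[OF lin] u unfolding acg_inv_def by blast+
  then have "Ak * psi yk \<le> Ak * psi u + (norm (u - w0))\<^sup>2 / 2 - (1 + mu * Ak) / 2 * (norm (u - xk))\<^sup>2"
    by linarith
  also have "\<dots> = Ak * (psi u + (norm (u - w0))\<^sup>2 / (2 * Ak) - (1 + mu * Ak) / (2 * Ak) * (norm (u - xk))\<^sup>2)"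
  proof -
    have div: "Ak * (c / (2 * Ak)) = c / 2" for c using Ap by simp
    show ?thesis unfolding right_diff_distrib distrib_left mult.assoc[of Ak, symmetric] div ..
  qed
  finally show ?thesis using Ap by simp
qed

end

section \<open>Distance of the iterates from the exact minimizer\<close>

lemma psi_strongly_convex: "strongly_convex_on X mu psi"
proof -
  have "strongly_convex_on X mu psis"
    using lower X_sub
    by (intro strongly_convex_on_first_order[OF X_convex, where D="grad psis"])
      (auto simp: linearization_def)
  from strongly_convex_on_add[OF this pn_convex] show ?thesis by (simp add: psi_def[abs_def])
qed

lemma psi_attains_min: "\<exists>x\<in>X. \<forall>u\<in>X. psi x \<le> psi u"
proof -
  have "\<exists>x\<in>X. \<forall>u\<in>X. psis x + real_of_ereal (psin x) \<le> psis u + real_of_ereal (psin u)"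
  proof (rule strongly_convex_attains_min[OF psin_closed X_convex _ psis_cont, where k="psis w0"
        and g="grad psis w0" and a=w0 and kk=0 and c=mu])
    show "strongly_convex_on X mu (\<lambda>u. psis u + real_of_ereal (psin u))"
      using psi_strongly_convex by (simp add: psi_def[abs_def] pn_def)
    show "psis w0 + inner (grad psis w0) (u - w0) - 0 * (norm (u - w0))\<^sup>2 \<le> psis u" if "u \<in> X" for u
      using lower[of u w0] that X_sub w0_mem mu_pos unfolding linearization_def
      by (smt (verit) subsetD mult_nonneg_nonneg zero_le_power2 half_gt_zero)
  qed (use w0_mem mu_pos in auto)
  then show ?thesis by (simp add: psi_def pn_def)
qed

text \<open>psi at y_k cannot undercut the minimum, so the descent estimate at \<open>xs\<close>
  yields (1 + mu A) |x_k - xs|^2 \<le> |w0 - xs|^2. The bound passes to y_k by averaging.\<close>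

lemma acg_near_minimizer:
  assumes xs: "xs \<in> X" "\<And>u. u \<in> X \<Longrightarrow> psi xs \<le> psi u"
  shows "linearized k \<Longrightarrow> norm (acg_x (st k) - xs) \<le> norm (w0 - xs) \<and> norm (acg_y (st k) - xs) \<le> norm (w0 - xs)"
proof (induction k)
  case 0 then show ?case by (simp add: st_0 acg_init_def)
next
  case (Suc k)
  have lk: "linearized k" using Suc.prems by (rule linearized_mono) simp
  define d where "d = norm (w0 - xs)"
  define s where "s = st k"
  define s' where "s' = acg_step psis psin mu L s"
  define a where "a = acg_a mu L s"
  have s': "st (Suc k) = s'" by (simp add: s'_def s_def st_Suc)
  have A: "0 \<le> acg_A s" unfolding s_def by (rule acg_A_nonneg[OF lk])
  have A': "0 < acg_A s'" unfolding s'[symmetric] by (rule acg_A_pos[OF Suc.prems]) simp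
  have a: "0 < a" unfolding a_def by (rule acg_a_facts(2)[OF A])
  have "psi (acg_y s') \<ge> psi xs"
    using acg_y_mem[OF Suc.prems] unfolding s' by (intro xs(2)) simp
  then have "(1 + mu * acg_A s') / (2 * acg_A s') * (norm (xs - acg_x s'))\<^sup>2 \<le> d\<^sup>2 / (2 * acg_A s')"
    using acg_descent[OF Suc.prems _ xs(1)] unfolding s' by (simp add: d_def norm_minus_commute)
  then have "(1 + mu * acg_A s') * (norm (xs - acg_x s'))\<^sup>2 \<le> d\<^sup>2"
    using A' by (simp add: divide_le_cancel)
  moreover have "1 * (norm (xs - acg_x s'))\<^sup>2 \<le> (1 + mu * acg_A s') * (norm (xs - acg_x s'))\<^sup>2"
    using A' mu_pos by (intro mult_right_mono) auto
  ultimately have "(norm (xs - acg_x s'))\<^sup>2 \<le> d\<^sup>2" by linarith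
  then have "norm (xs - acg_x s') \<le> d" by (rule power2_le_imp_le) (simp add: d_def)
  then have xd: "norm (acg_x s' - xs) \<le> d" by (simp only: norm_minus_commute)
  define c1 where "c1 = 1 + mu * acg_A s'"
  define c2 where "c2 = a * L * acg_A s / acg_A s'"
  have c: "0 \<le> c1" "0 \<le> c2" "0 < c1 + c2" using A A' a L_pos mu_pos
    by (auto simp: c1_def c2_def intro!: add_pos_nonneg)
  have "(a * (L + mu)) *\<^sub>R acg_y s' = c1 *\<^sub>R acg_x s' + c2 *\<^sub>R acg_y s" "a * (L + mu) = c1 + c2"
    unfolding c1_def c2_def a_def s'_def using acg_y_convex_comb[OF A] by auto
  then have "(c1 + c2) *\<^sub>R acg_y s' = c1 *\<^sub>R acg_x s' + c2 *\<^sub>R acg_y s" by simp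
  then have "(c1 + c2) *\<^sub>R (acg_y s' - xs) = c1 *\<^sub>R (acg_x s' - xs) + c2 *\<^sub>R (acg_y s - xs)"
    unfolding scaleR_right_diff_distrib by (simp add: scaleR_left_distrib)
  then have "(c1 + c2) * norm (acg_y s' - xs) = norm (c1 *\<^sub>R (acg_x s' - xs) + c2 *\<^sub>R (acg_y s - xs))"
    using c by (metis norm_scaleR abs_of_pos)
  also have "\<dots> \<le> c1 * norm (acg_x s' - xs) + c2 * norm (acg_y s - xs)"
    using c by (metis norm_triangle_ineq norm_scaleR abs_of_nonneg)
  also have "\<dots> \<le> c1 * d + c2 * d"
    using c xd Suc.IH[OF lk] by (intro add_mono mult_left_mono) (auto simp: d_def s_def)
  finally have "norm (acg_y s' - xs) \<le> d" using c by (simp add: ring_distribs[symmetric])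
  then show ?case using xd by (simp add: s' d_def)
qed

text \<open>Growth of \<open>psi\<close> from \<open>xs\<close> to y_k is added to the subgradient
  inequality at \<open>xs\<close>; the values of \<open>psi\<close> cancel, and both iterates are
  controlled by r and eta alone.\<close>

lemma acg_gap:
  assumes xs: "xs \<in> X" "\<And>u. u \<in> X \<Longrightarrow> psi xs \<le> psi u" and lin: "linearized k" and k: "1 \<le> k"
  shows "mu / 2 * (norm (acg_y (st k) - xs))\<^sup>2 + mu / 2 * (norm (xs - acg_x (st k)))\<^sup>2
     \<le> inner (acg_r w0 (st k)) (acg_y (st k) - xs) + acg_eta psis psin w0 (st k)"
  using acg_subgradient[OF lin k xs(1)]
    strongly_convex_on_growth[OF X_convex psi_strongly_convex xs acg_y_mem[OF lin k]]
  by (simp add: inner_simps)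

end

section \<open>Smoothing the max function\<close>

lemma max_fun_attained:
  fixes Y :: "'b::topological_space set"
  assumes "compact Y" "Y \<noteq> {}" "continuous_on Y (Psi x)"
  shows "\<exists>y\<in>Y. max_fun Y Psi x = Psi x y \<and> (\<forall>y'\<in>Y. Psi x y' \<le> Psi x y)"
proof -
  obtain y where y: "y \<in> Y" "\<And>y'. y' \<in> Y \<Longrightarrow> Psi x y' \<le> Psi x y"
    using continuous_attains_sup[OF assms] by blast
  have "max_fun Y Psi x = Psi x y"
    unfolding max_fun_def by (rule cSup_eq_maximum) (use y in auto)
  then show ?thesis using y by blast
qed

lemma continuous_on_slice:
  assumes "continuous_on (U \<times> Y) (\<lambda>(x, y). Psi x y)" "x \<in> U"
  shows "continuous_on Y (Psi x)"
proof -
  have "continuous_on Y (\<lambda>y. (\<lambda>(x, y). Psi x y) (x, y))"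
    by (rule continuous_on_compose2[OF assms(1)]) (use assms(2) in \<open>auto intro!: continuous_intros\<close>)
  then show ?thesis by simp
qed

lemma uniformly_close_on_compact:
  fixes Psi :: "'a::topological_space \<Rightarrow> 'b::topological_space \<Rightarrow> real"
  assumes c: "continuous_on (U \<times> Y) (\<lambda>(x, y). Psi x y)" and Y: "compact Y"
    and x: "x \<in> U" and e: "0 < e"
  shows "\<forall>\<^sub>F x' in at x within U. \<forall>y\<in>Y. \<bar>Psi x' y - Psi x y\<bar> \<le> e"
proof -
  obtain X0 where X0: "x \<in> X0" "open X0"
    "\<forall>x'\<in>X0 \<inter> U. \<forall>y\<in>Y. dist ((\<lambda>(x, y). Psi x y) (x', y)) ((\<lambda>(x, y). Psi x y) (x, y)) \<le> e"
    by (rule continuous_on_prod_compactE[OF c Y x e])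
  then show ?thesis
    unfolding eventually_at_topological by (intro exI[of _ X0]) (auto simp: dist_real_def)
qed

lemma continuous_on_max_fun:
  fixes Psi :: "'a::topological_space \<Rightarrow> 'b::topological_space \<Rightarrow> real"
  assumes c: "continuous_on (U \<times> Y) (\<lambda>(x, y). Psi x y)" and Y: "compact Y" "Y \<noteq> {}"
  shows "continuous_on U (max_fun Y Psi)"
  unfolding continuous_on
proof
  fix x assume x: "x \<in> U"
  show "(max_fun Y Psi \<longlongrightarrow> max_fun Y Psi x) (at x within U)"
  proof (rule tendstoI)
    fix e :: real assume e: "e > 0"
    have "\<forall>\<^sub>F x' in at x within U. \<forall>y\<in>Y. \<bar>Psi x' y - Psi x y\<bar> \<le> e / 2"
      by (rule uniformly_close_on_compact[OF c Y(1) x]) (use e in simp)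
    moreover have "\<forall>\<^sub>F x' in at x within U. x' \<in> U"
      by (simp add: eventually_at_filter)
    ultimately show "\<forall>\<^sub>F x' in at x within U. dist (max_fun Y Psi x') (max_fun Y Psi x) < e"
    proof eventually_elim
      case (elim x')
      obtain y where y: "y \<in> Y" "max_fun Y Psi x = Psi x y" "\<And>y'. y' \<in> Y \<Longrightarrow> Psi x y' \<le> Psi x y"
        using max_fun_attained[of Y Psi x, OF Y continuous_on_slice[OF c x]] by blast
      obtain y' where y': "y' \<in> Y" "max_fun Y Psi x' = Psi x' y'" "\<And>y. y \<in> Y \<Longrightarrow> Psi x' y \<le> Psi x' y'"
        using max_fun_attained[of Y Psi x', OF Y continuous_on_slice[OF c elim(2)]] by blast
      have "\<bar>Psi x' y - Psi x y\<bar> \<le> e / 2" "\<bar>Psi x' y' - Psi x y'\<bar> \<le> e / 2" using elim(1) y y' by auto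
      then show ?case using y(2) y'(2) y(3)[OF y'(1)] y'(3)[OF y(1)] e unfolding dist_real_def by linarith
    qed
  qed
qed

section \<open>One-sided directional derivatives\<close>

lemma monotone_tendsto_at_right:
  fixes K :: "real \<Rightarrow> real"
  assumes t0: "0 < t0" and mono: "\<And>s t. 0 < s \<Longrightarrow> s \<le> t \<Longrightarrow> t \<le> t0 \<Longrightarrow> K s \<le> K t"
    and lb: "\<And>t. 0 < t \<Longrightarrow> t \<le> t0 \<Longrightarrow> b \<le> K t"
  shows "(K \<longlongrightarrow> Inf (K ` {0<..t0})) (at_right 0)"
proof (rule order_tendstoI)
  have bdd: "bdd_below (K ` {0<..t0})" using lb by (intro bdd_belowI[of _ b]) auto
  fix a assume a: "a < Inf (K ` {0<..t0})"
  have "a < K t" if "0 < t" "t < t0" for t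
    using cInf_lower[OF _ bdd, of "K t"] a that by force
  then show "\<forall>\<^sub>F t in at_right 0. a < K t"
    unfolding eventually_at_right_field using t0 by blast
next
  fix a assume a: "Inf (K ` {0<..t0}) < a"
  have "K ` {0<..t0} \<noteq> {}" using t0 by auto
  then obtain t where t: "0 < t" "t \<le> t0" "K t < a"
    using cInf_lessD[OF _ a] by force
  then have "K s < a" if "0 < s" "s < t" for s using mono[of s t] that by force
  then show "\<forall>\<^sub>F t in at_right 0. K t < a"
    unfolding eventually_at_right_field using t by blast
qed

lemma dir_derivI: "has_dir_deriv F x d l \<Longrightarrow> dir_deriv F x d = l"
  unfolding dir_deriv_def has_dir_deriv_def
  by (rule the_equality) (auto intro: tendsto_unique[rotated])

text \<open>Adding \<open>c/2 |t d|^2\<close> makes the function convex along the ray, so its difference quotients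
  are monotone.\<close>

lemma weakly_convex_has_dir_deriv:
  fixes X :: "'a::euclidean_space set"
  assumes X: "convex X" and x: "x \<in> X" and fin: "\<And>v. v \<in> X \<Longrightarrow> F v = ereal (Fr v)"
    and inf: "\<And>v. v \<notin> X \<Longrightarrow> F v = \<infinity>"
    and sc: "strongly_convex_on X (- c) Fr" and c: "0 \<le> c"
    and lb: "\<And>v. v \<in> X \<Longrightarrow> Fr x - b * norm (v - x) - k * (norm (v - x))\<^sup>2 \<le> Fr v"
    and b: "0 \<le> b" and k: "0 \<le> k" and d: "norm d \<le> 1"
  shows "\<exists>l. has_dir_deriv F x d l \<and> ereal (- b) \<le> l"
\<comment> \<open>If the ray leaves \<open>X\<close> at once, all difference quotients are infinite;
  otherwise convexity puts the whole segment up to \<open>t0\<close> into \<open>X\<close>.\<close>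
proof (cases "\<exists>t>0. x + t *\<^sub>R d \<in> X")
  case False
  have "((\<lambda>t. (F (x + t *\<^sub>R d) - F x) / ereal t) \<longlongrightarrow> \<infinity>) (at_right 0)"
  proof (rule Lim_transform_eventually[OF tendsto_const])
    show "\<forall>\<^sub>F t in at_right 0. \<infinity> = (F (x + t *\<^sub>R d) - F x) / ereal t"
      unfolding eventually_at_right_field
      using False inf fin[OF x] by (intro exI[of _ 1]) auto
  qed
  then show ?thesis unfolding has_dir_deriv_def by (intro exI[of _ \<infinity>]) auto
next
  case True
  then obtain t0 where t0: "0 < t0" "x + t0 *\<^sub>R d \<in> X" by blast
  have mem: "x + t *\<^sub>R d \<in> X" if "0 \<le> t" "t \<le> t0" for t
    using segment_mem[OF X x t0(2), of "t / t0"] that t0 by simp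
  define K where "K t = (Fr (x + t *\<^sub>R d) - Fr x) / t + c / 2 * t * (norm d)\<^sup>2" for t
  have lbK: "- b - k * t \<le> K t" if t: "0 < t" "t \<le> t0" for t
  proof -
    have "b * (t * norm d) \<le> b * (t * 1)" using b t d by (intro mult_left_mono) auto
    moreover have "k * (t\<^sup>2 * (norm d)\<^sup>2) \<le> k * (t\<^sup>2 * 1)"
      using k t d power_mono[of "norm d" 1 2] by (intro mult_left_mono) auto
    ultimately have "- b * t - k * t\<^sup>2 \<le> Fr (x + t *\<^sub>R d) - Fr x"
      using lb[OF mem, of t] t by (simp add: power_mult_distrib)
    then have "- b - k * t \<le> (Fr (x + t *\<^sub>R d) - Fr x) / t"
      using t by (simp add: field_simps power2_eq_square)
    moreover have "0 \<le> c / 2 * t * (norm d)\<^sup>2" using c t by simp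
    ultimately show ?thesis unfolding K_def by linarith
  qed
  have mono: "K s \<le> K t" if s: "0 < s" "s \<le> t" "t \<le> t0" for s t
  proof -
    define th where "th = s / t"
    have th: "0 \<le> th" "th \<le> 1" "s = th * t" using s by (auto simp: th_def)
    have e: "(1 - th) *\<^sub>R x + th *\<^sub>R (x + t *\<^sub>R d) = x + s *\<^sub>R d"
      by (simp add: th(3) algebra_simps)
    have "Fr (x + s *\<^sub>R d) \<le> (1 - th) * Fr x + th * Fr (x + t *\<^sub>R d)
        - (- c) / 2 * (th * (1 - th)) * (norm (x - (x + t *\<^sub>R d)))\<^sup>2"
      using strongly_convex_onD[OF sc x mem[of t] th(1,2)] s unfolding e by simp
    then have "Fr (x + s *\<^sub>R d) - Fr x \<le> th * (Fr (x + t *\<^sub>R d) - Fr x)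
        + c / 2 * (th * (1 - th)) * (t\<^sup>2 * (norm d)\<^sup>2)"
      using s by (simp add: power_mult_distrib algebra_simps)
    then have "(Fr (x + s *\<^sub>R d) - Fr x) / s \<le> (th * (Fr (x + t *\<^sub>R d) - Fr x)
        + c / 2 * (th * (1 - th)) * (t\<^sup>2 * (norm d)\<^sup>2)) / s"
      using s by (intro divide_right_mono) auto
    also have "(th * (Fr (x + t *\<^sub>R d) - Fr x)
        + c / 2 * (th * (1 - th)) * (t\<^sup>2 * (norm d)\<^sup>2)) / s = (Fr (x + t *\<^sub>R d) - Fr x) / t + c / 2 * (t - s) * (norm d)\<^sup>2"
      using s by (simp add: th_def field_simps power2_eq_square)
    moreover have "c / 2 * (t - s) * (norm d)\<^sup>2 = c / 2 * t * (norm d)\<^sup>2 - c / 2 * s * (norm d)\<^sup>2"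
      by (simp add: algebra_simps diff_divide_distrib)
    ultimately show ?thesis unfolding K_def by linarith
  qed
  define I where "I = Inf (K ` {0<..t0})"
  have lim: "(K \<longlongrightarrow> I) (at_right 0)"
    unfolding I_def
  proof (rule monotone_tendsto_at_right[OF t0(1) mono, where b = "- b - k * t0"])
    show "- b - k * t0 \<le> K t" if "0 < t" "t \<le> t0" for t
      using lbK[OF that] mult_left_mono[OF that(2) k] by linarith
  qed auto
  have "((\<lambda>t. ereal (K t - c / 2 * t * (norm d)\<^sup>2)) \<longlongrightarrow> ereal (I - c / 2 * 0 * (norm d)\<^sup>2)) (at_right 0)"
    by (intro tendsto_intros lim)
  then have K: "((\<lambda>t. ereal (K t - c / 2 * t * (norm d)\<^sup>2)) \<longlongrightarrow> ereal I) (at_right 0)" by simp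
  have "((\<lambda>t. (F (x + t *\<^sub>R d) - F x) / ereal t) \<longlongrightarrow> ereal I) (at_right 0)"
  proof (rule Lim_transform_eventually[OF K])
    show "\<forall>\<^sub>F t in at_right 0. ereal (K t - c / 2 * t * (norm d)\<^sup>2) = (F (x + t *\<^sub>R d) - F x) / ereal t"
      unfolding eventually_at_right_field
      using t0(1) fin[OF mem] fin[OF x] by (intro exI[of _ t0]) (auto simp: K_def)
  qed
  moreover have "- b \<le> I"
  proof (rule tendsto_le[OF _ lim])
    show "((\<lambda>t. - b - k * t) \<longlongrightarrow> - b) (at_right 0)"
      by (auto intro!: tendsto_eq_intros)
    show "\<forall>\<^sub>F t in at_right 0. - b - k * t \<le> K t"
      unfolding eventually_at_right_field using t0(1) lbK by (intro exI[of _ t0]) auto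
  qed simp
  ultimately show ?thesis unfolding has_dir_deriv_def by (intro exI[of _ "ereal I"]) auto
qed

section \<open>The regularized maximizer and the gradient of the smoothed function\<close>

locale smoothed_minmax = minmax X Y Om Phi h m Lx Ly
  for X :: "'a::euclidean_space set" and Y :: "'b::euclidean_space set" and Om Phi h m Lx Ly +
  fixes y0 :: 'b and xi :: real
  assumes xi_pos: "0 < xi" and y0_mem: "y0 \<in> Y"
begin

definition "p = max_fun Y Phi"
definition "ps = smooth_max Y Phi xi y0"
definition "hr u = real_of_ereal (h u)"
definition "phi x y = Phi x y - (norm (y - y0))\<^sup>2 / (2 * xi)"
definition "ym x = (SOME y. y \<in> Y \<and> (\<forall>y'\<in>Y. phi x y' \<le> phi x y))"

lemma h_eq: "u \<in> X \<Longrightarrow> h u = ereal (hr u)"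
  unfolding hr_def by (rule closed_convex_fun_finite[OF h_convex])

lemma hr_convex: "strongly_convex_on X 0 hr"
  using closed_convex_fun_convex[OF h_convex X_convex] by (simp add: hr_def[abs_def])

lemma phi_continuous: "continuous_on (Om \<times> Y) (\<lambda>(x, y). phi x y)"
proof -
  have "continuous_on (Om \<times> Y) (\<lambda>z. (case z of (x, y) \<Rightarrow> Phi x y) - (norm (snd z - y0))\<^sup>2 / (2 * xi))"
    by (intro continuous_intros Phi_continuous) (use xi_pos in auto)
  then show ?thesis by (simp add: phi_def case_prod_beta)
qed

lemma ps_eq_max_fun: "ps = max_fun Y phi"
  by (simp add: ps_def smooth_max_def phi_def[abs_def])

lemma ym:
  assumes x: "x \<in> Om"
  shows ym_mem: "ym x \<in> Y" and ym_max: "y \<in> Y \<Longrightarrow> phi x y \<le> phi x (ym x)"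
    and ps_eq: "ps x = phi x (ym x)"
proof -
  obtain y' where y': "y' \<in> Y" "max_fun Y phi x = phi x y'" "\<And>y. y \<in> Y \<Longrightarrow> phi x y \<le> phi x y'"
    using max_fun_attained[of Y phi x, OF Y_compact Y_nonempty continuous_on_slice[OF phi_continuous x]] by blast
  then have "\<exists>y. y \<in> Y \<and> (\<forall>y'\<in>Y. phi x y' \<le> phi x y)" by blast
  then have "ym x \<in> Y \<and> (\<forall>y\<in>Y. phi x y \<le> phi x (ym x))"
    unfolding ym_def by (rule someI_ex)
  then show 1: "ym x \<in> Y" and 2: "\<And>y. y \<in> Y \<Longrightarrow> phi x y \<le> phi x (ym x)" by auto
  show "ps x = phi x (ym x)"
    unfolding ps_eq_max_fun y'(2) using 1 2 y' by (intro antisym) auto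
qed

lemma ps_ge: "x \<in> Om \<Longrightarrow> y \<in> Y \<Longrightarrow> phi x y \<le> ps x"
  using ym_max ps_eq by simp

lemma ym_growth:
  assumes x: "x \<in> Om" and y: "y \<in> Y"
  shows "phi x y + (norm (y - ym x))\<^sup>2 / (2 * xi) \<le> phi x (ym x)"
proof -
  have "strongly_convex_on Y 0 (\<lambda>y. real_of_ereal (if y \<in> Y then ereal (- Phi x y) else \<infinity>))"
    by (rule closed_convex_fun_convex[OF Phi_concave[OF x] Y_convex])
  then have "strongly_convex_on Y 0 (\<lambda>y. - Phi x y)"
    by (subst (asm) strongly_convex_on_cong[OF Y_convex, of _ "\<lambda>y. - Phi x y"]) auto
  from strongly_convex_on_add[OF this strongly_convex_on_quadratic[of Y "1 / xi" 0 0 y0 y0]]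
  have sc: "strongly_convex_on Y (1 / xi) (\<lambda>y. - phi x y)"
    by (simp add: phi_def mult.commute)
  have "- phi x (ym x) + (1 / xi) / 2 * (norm (y - ym x))\<^sup>2 \<le> - phi x y"
    by (rule strongly_convex_on_growth[OF Y_convex sc ym_mem[OF x] _ y]) (simp add: ym_max[OF x])
  then show ?thesis by simp
qed

lemma gradx_GDERIV: "x \<in> Om \<Longrightarrow> y \<in> Y \<Longrightarrow> GDERIV (\<lambda>x. Phi x y) x :> gradx Phi x y"
  using Phi_grad GDERIV_grad by blast

lemma Phi_mvt:
  assumes "\<And>t. 0 \<le> t \<Longrightarrow> t \<le> 1 \<Longrightarrow> a + t *\<^sub>R (b - a) \<in> Om" "y \<in> Y"
  shows "\<exists>t. 0 < t \<and> t < 1 \<and> Phi b y - Phi a y = inner (gradx Phi (a + t *\<^sub>R (b - a)) y) (b - a)"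
  using GDERIV_mvt[of "\<lambda>x. Phi x y" a b "\<lambda>x. gradx Phi x y"] assms gradx_GDERIV by blast

text \<open>The Lipschitz bound on \<open>ym\<close> rests on the curvature bounds and is confined
  to \<open>S\<close>. Differentiability on the open set \<open>Om\<close> asks only for continuity,
  which growth and uniform closeness on compact \<open>Y\<close> provide.\<close>

lemma ym_tendsto:
  assumes x: "x \<in> Om"
  shows "(ym \<longlongrightarrow> ym x) (at x within Om)"
proof (rule tendstoI)
  fix e :: real assume e: "0 < e"
  \<comment> \<open>The growth inequality at \<open>x\<close> loses e' twice: |ym x' - ym x|^2 \<le>
    4 xi e' = e^2 / 2.\<close>
  define e' where "e' = e\<^sup>2 / (8 * xi)"
  have "\<forall>\<^sub>F x' in at x within Om. \<forall>y\<in>Y. \<bar>Phi x' y - Phi x y\<bar> \<le> e'"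
    by (rule uniformly_close_on_compact[OF Phi_continuous Y_compact x]) (use e xi_pos in \<open>simp add: e'_def\<close>)
  moreover have "\<forall>\<^sub>F x' in at x within Om. x' \<in> Om"
    by (simp add: eventually_at_filter)
  ultimately show "\<forall>\<^sub>F x' in at x within Om. dist (ym x') (ym x) < e"
  proof eventually_elim
    case (elim x')
    note y = ym_mem[OF x] and y' = ym_mem[OF elim(2)]
    have "(norm (ym x' - ym x))\<^sup>2 / (2 * xi) \<le> phi x (ym x) - phi x (ym x')"
      using ym_growth[OF x y'] by simp
    also have "\<dots> \<le> (phi x (ym x) - phi x' (ym x)) + (phi x' (ym x') - phi x (ym x'))"
      using ym_max[OF elim(2) y] by simp
    also have "\<dots> = - (Phi x' (ym x) - Phi x (ym x)) + (Phi x' (ym x') - Phi x (ym x'))"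
      by (simp add: phi_def)
    also have "\<dots> \<le> e' + e'"
      using bspec[OF elim(1) y] bspec[OF elim(1) y'] by linarith
    finally have "(norm (ym x' - ym x))\<^sup>2 \<le> e\<^sup>2 / 2"
      using xi_pos by (simp add: e'_def field_simps)
    also have "\<dots> < e\<^sup>2" using e by simp
    finally show ?case using e unfolding dist_norm by (simp add: power2_less_imp_less)
  qed
qed

text \<open>Danskin's formula: the increment of \<open>ps\<close> is squeezed between the increments
  of \<open>Phi\<close> at the old and at the new maximizer, and both are nearly linear by the mean
  value theorem and joint continuity of the gradient.\<close>

lemma ps_GDERIV:
  assumes x: "x \<in> Om"
  shows "GDERIV ps x :> gradx Phi x (ym x)"
proof -
  define D where "D = gradx Phi x (ym x)"
  have "\<exists>d>0. \<forall>x'. norm (x' - x) < d \<longrightarrow> norm (ps x' - ps x - inner (x' - x) D) \<le> e * norm (x' - x)"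
    if e: "0 < e" for e
  proof -
    have "((\<lambda>(x, y). gradx Phi x y) \<longlongrightarrow> D) (at (x, ym x) within Om \<times> Y)"
      using Phi_grad_continuous x ym_mem[OF x] unfolding continuous_on D_def by fastforce
    then have "\<forall>\<^sub>F z in at (x, ym x) within Om \<times> Y. dist ((\<lambda>(x, y). gradx Phi x y) z) D < e"
      using e by (rule tendstoD)
    then obtain d1 where d1: "d1 > 0"
      "\<And>z. z \<in> Om \<times> Y \<Longrightarrow> z \<noteq> (x, ym x) \<Longrightarrow> dist z (x, ym x) < d1 \<Longrightarrow> dist ((\<lambda>(x, y). gradx Phi x y) z) D < e"
      unfolding eventually_at by blast
    have near: "norm (gradx Phi x' y - D) \<le> e"
      if "x' \<in> Om" "y \<in> Y" "dist x' x < d1 / 2" "dist y (ym x) < d1 / 2" for x' y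
    proof (cases "(x', y) = (x, ym x)")
      case True then show ?thesis using e by (simp add: D_def)
    next
      case False
      have "dist (x', y) (x, ym x) \<le> dist x' x + dist y (ym x)"
        unfolding dist_Pair_Pair by (rule sqrt_sum_squares_le_sum) auto
      then show ?thesis using d1(2)[of "(x', y)"] False that by (auto simp: dist_norm)
    qed
    obtain d2 where d2: "d2 > 0" "\<And>x'. x' \<in> Om \<Longrightarrow> dist x' x < d2 \<Longrightarrow> dist (ym x') (ym x) < d1 / 2"
    proof -
      obtain d2 where "d2 > 0" "\<forall>x'\<in>Om. x' \<noteq> x \<and> dist x' x < d2 \<longrightarrow> dist (ym x') (ym x) < d1 / 2"
        using tendstoD[OF ym_tendsto[OF x], of "d1 / 2"] d1(1) unfolding eventually_at by auto
      then show thesis using d1(1) that[of d2] by (metis dist_self half_gt_zero)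
    qed
    obtain d3 where d3: "d3 > 0" "ball x d3 \<subseteq> Om" using Om_open x open_contains_ball by blast
    define d where "d = min (d1 / 2) (min d2 d3)"
    have dpos: "d > 0" using d1 d2 d3 by (simp add: d_def)
    show ?thesis
    proof (intro exI[of _ d] conjI allI impI dpos)
      fix x' assume x': "norm (x' - x) < d"
      have seg: "x + t *\<^sub>R (x' - x) \<in> Om \<and> dist (x + t *\<^sub>R (x' - x)) x < d1 / 2" if t: "0 \<le> t" "t \<le> 1" for t
      proof -
        have "dist (x + t *\<^sub>R (x' - x)) x = t * norm (x' - x)" using t by (simp add: dist_norm)
        also have "\<dots> \<le> 1 * norm (x' - x)" using t by (intro mult_right_mono) auto
        finally have "dist (x + t *\<^sub>R (x' - x)) x < d" using x' by simp
        then show ?thesis using d3(2) by (auto simp: d_def dist_commute)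
      qed
      have x'Om: "x' \<in> Om" using seg[of 1] by simp
      note y = ym_mem[OF x] and y' = ym_mem[OF x'Om]
      have dy: "dist (ym x') (ym x) < d1 / 2" using d2(2)[OF x'Om] x' by (simp add: d_def dist_norm)
      have est: "\<bar>Phi x' z - Phi x z - inner (x' - x) D\<bar> \<le> e * norm (x' - x)"
        if z: "z \<in> Y" "dist z (ym x) < d1 / 2" for z
      proof -
        obtain t where t: "0 < t" "t < 1" "Phi x' z - Phi x z = inner (gradx Phi (x + t *\<^sub>R (x' - x)) z) (x' - x)"
          using Phi_mvt[of x x' z] seg z(1) by blast
        have "\<bar>Phi x' z - Phi x z - inner (x' - x) D\<bar> = \<bar>inner (gradx Phi (x + t *\<^sub>R (x' - x)) z - D) (x' - x)\<bar>"
          unfolding t(3) inner_diff_left[of _ D] by (simp only: inner_commute)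
        also have "\<dots> \<le> norm (gradx Phi (x + t *\<^sub>R (x' - x)) z - D) * norm (x' - x)"
          by (rule Cauchy_Schwarz_ineq2)
        also have "\<dots> \<le> e * norm (x' - x)"
          using near[of "x + t *\<^sub>R (x' - x)" z] seg[of t] t z by (intro mult_right_mono) auto
        finally show ?thesis .
      qed
      have "ps x' - ps x \<le> Phi x' (ym x') - Phi x (ym x')"
        using ps_ge[OF x y'] ps_eq[OF x'Om] by (simp add: phi_def)
      moreover have "Phi x' (ym x) - Phi x (ym x) \<le> ps x' - ps x"
        using ps_ge[OF x'Om y] ps_eq[OF x] by (simp add: phi_def)
      ultimately show "norm (ps x' - ps x - inner (x' - x) D) \<le> e * norm (x' - x)"
        using est[OF y'] est[OF y] dy d1(1) by (simp add: abs_le_iff)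
    qed
  qed
  then show ?thesis
    unfolding gderiv_def has_derivative_at_alt D_def by (auto intro: bounded_linear_inner_left)
qed

lemma grad_ps: "x \<in> Om \<Longrightarrow> grad ps x = gradx Phi x (ym x)"
  by (rule grad_eqI[OF ps_GDERIV])

lemma ps_lower_curvature:
  assumes S: "S \<subseteq> Om" and cb: "curvature_bounds S Y Phi m Lx Ly" and u: "u \<in> S" and v: "v \<in> S"
  shows "linearization ps v u - m / 2 * (norm (u - v))\<^sup>2 \<le> ps u"
proof -
  have uv: "u \<in> Om" "v \<in> Om" using S u v by auto
  have "Phi u (ym v) - (Phi v (ym v) + inner (gradx Phi v (ym v)) (u - v)) \<ge> - (m / 2) * (norm (u - v))\<^sup>2"
    using cb u v ym_mem[OF uv(2)] unfolding curvature_bounds_def by blast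
  then show ?thesis
    using ps_ge[OF uv(1) ym_mem[OF uv(2)]] ps_eq[OF uv(2)]
    by (simp add: linearization_def grad_ps[OF uv(2)] phi_def)
qed

text \<open>Growth at \<open>u\<close> and at \<open>v\<close> adds up to d^2 / xi \<le> g u - g v,
  while the mean value theorem bounds g u - g v by Ly d |u - v|; one factor d cancels.\<close>

lemma ym_Lipschitz:
  assumes S: "convex S" "S \<subseteq> Om" and cb: "curvature_bounds S Y Phi m Lx Ly" and u: "u \<in> S" and v: "v \<in> S"
  shows "norm (ym u - ym v) \<le> xi * Ly * norm (u - v)"
proof -
  have uv: "u \<in> Om" "v \<in> Om" using S u v by auto
  note yu = ym_mem[OF uv(1)] and yv = ym_mem[OF uv(2)]
  define d where "d = norm (ym u - ym v)"
  define g where "g x = Phi x (ym u) - Phi x (ym v)" for x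
  have seg: "v + t *\<^sub>R (u - v) \<in> S" if "0 \<le> t" "t \<le> 1" for t
    using segment_mem[OF S(1) v u that] .
  have "\<exists>t. 0 < t \<and> t < 1 \<and> g u - g v
     = inner (gradx Phi (v + t *\<^sub>R (u - v)) (ym u) - gradx Phi (v + t *\<^sub>R (u - v)) (ym v)) (u - v)"
    unfolding g_def
    by (rule GDERIV_mvt[where D = "\<lambda>x. gradx Phi x (ym u) - gradx Phi x (ym v)"])
      (use seg S yu yv in \<open>auto intro!: GDERIV_diff gradx_GDERIV\<close>)
  then obtain t where t: "0 < t" "t < 1" and gt: "g u - g v
     = inner (gradx Phi (v + t *\<^sub>R (u - v)) (ym u) - gradx Phi (v + t *\<^sub>R (u - v)) (ym v)) (u - v)" by blast
  have "norm (gradx Phi (v + t *\<^sub>R (u - v)) (ym u) - gradx Phi (v + t *\<^sub>R (u - v)) (ym v))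
      \<le> Lx * norm (v + t *\<^sub>R (u - v) - (v + t *\<^sub>R (u - v))) + Ly * d"
    unfolding d_def using cb seg[of t] t yu yv unfolding curvature_bounds_def by (meson less_imp_le)
  then have "g u - g v \<le> Ly * d * norm (u - v)"
    unfolding gt by (intro order_trans[OF norm_cauchy_schwarz] mult_right_mono) auto
  moreover have "d\<^sup>2 / xi \<le> g u - g v"
  proof -
    have "phi u (ym v) + d\<^sup>2 / (2 * xi) \<le> phi u (ym u)"
      using ym_growth[OF uv(1) yv] by (simp add: d_def norm_minus_commute)
    moreover have "phi v (ym u) + d\<^sup>2 / (2 * xi) \<le> phi v (ym v)"
      using ym_growth[OF uv(2) yu] by (simp add: d_def)
    moreover have "d\<^sup>2 / xi = d\<^sup>2 / (2 * xi) + d\<^sup>2 / (2 * xi)" by (simp add: field_simps)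
    ultimately show ?thesis unfolding phi_def g_def by linarith
  qed
  ultimately have q: "d\<^sup>2 / xi \<le> Ly * d * norm (u - v)" by linarith
  have "d * d \<le> d * (xi * Ly * norm (u - v))"
  proof -
    have "d\<^sup>2 \<le> Ly * d * norm (u - v) * xi" using q xi_pos by (simp add: divide_le_eq)
    then show ?thesis by (simp add: power2_eq_square ac_simps)
  qed
  moreover have "0 \<le> xi * Ly * norm (u - v)" "0 \<le> d" using xi_pos Ly_pos by (auto simp: d_def)
  ultimately show ?thesis unfolding d_def[symmetric] by (metis mult_le_cancel_left_pos less_eq_real_def)
qed

lemma grad_ps_Lipschitz:
  assumes S: "convex S" "S \<subseteq> Om" and cb: "curvature_bounds S Y Phi m Lx Ly" and u: "u \<in> S" and v: "v \<in> S"
  shows "norm (grad ps u - grad ps v) \<le> (Ly * (xi * Ly) + Lx) * norm (u - v)"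
proof -
  have uv: "u \<in> Om" "v \<in> Om" using S u v by auto
  have "norm (grad ps u - grad ps v) \<le> Lx * norm (u - v) + Ly * norm (ym u - ym v)"
    using cb u v ym_mem[OF uv(1)] ym_mem[OF uv(2)]
    unfolding grad_ps[OF uv(1)] grad_ps[OF uv(2)] curvature_bounds_def by blast
  also have "\<dots> \<le> Lx * norm (u - v) + Ly * (xi * Ly * norm (u - v))"
    using ym_Lipschitz[OF assms] Ly_pos by simp
  finally show ?thesis by (simp add: algebra_simps)
qed

lemma ps_continuous: "continuous_on Om ps"
  unfolding ps_eq_max_fun by (rule continuous_on_max_fun[OF phi_continuous Y_compact Y_nonempty])

section \<open>The unsmoothed max function and its near-stationary points\<close>

lemma p_continuous: "continuous_on Om p"
  unfolding p_def by (rule continuous_on_max_fun[OF Phi_continuous Y_compact Y_nonempty])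

lemma p_max:
  assumes x: "x \<in> Om"
  obtains y where "y \<in> Y" "p x = Phi x y" "\<And>y'. y' \<in> Y \<Longrightarrow> Phi x y' \<le> Phi x y"
  unfolding p_def
  using max_fun_attained[of Y Phi x, OF Y_compact Y_nonempty continuous_on_slice[OF Phi_continuous x]] that by blast

lemma p_ge: "x \<in> Om \<Longrightarrow> y \<in> Y \<Longrightarrow> Phi x y \<le> p x"
  by (metis p_max)

lemma ps_le_p: "x \<in> Om \<Longrightarrow> ps x \<le> p x"
  using p_ge[of x "ym x"] ym_mem[of x] ps_eq[of x] xi_pos by (simp add: phi_def)
    (smt (verit) zero_le_divide_iff zero_le_power2)

lemma p_le_ps:
  assumes x: "x \<in> Om"
  shows "p x \<le> ps x + (diameter Y)\<^sup>2 / (2 * xi)"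
proof -
  obtain y where y: "y \<in> Y" "p x = Phi x y" using p_max[OF x] by metis
  have "norm (y - y0) \<le> diameter Y"
    using diameter_bounded_bound[OF compact_imp_bounded[OF Y_compact] y(1) y0_mem] by (simp add: dist_norm)
  then have "(norm (y - y0))\<^sup>2 / (2 * xi) \<le> (diameter Y)\<^sup>2 / (2 * xi)"
    using xi_pos by (intro divide_right_mono power_mono) auto
  then show ?thesis using ps_ge[OF x y(1)] y(2) by (simp add: phi_def)
qed

text \<open>The gradient of \<open>Phi\<close> at a maximizer serves as slope: that maximizer is
  exact at the base point and only undershoots \<open>p\<close> elsewhere.\<close>

lemma p_weakly_convex: "strongly_convex_on X (- m) p"
proof (rule strongly_convex_on_first_order[OF X_convex])
  define Y1 where "Y1 v = (SOME y. y \<in> Y \<and> p v = Phi v y)" for v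
  fix u v assume uv: "u \<in> X" "v \<in> X"
  have uvO: "u \<in> Om" "v \<in> Om" using uv X_sub_Om by auto
  have y: "Y1 v \<in> Y \<and> p v = Phi v (Y1 v)"
    unfolding Y1_def by (rule someI_ex) (metis p_max[OF uvO(2)])
  have "Phi u (Y1 v) - (Phi v (Y1 v) + inner (gradx Phi v (Y1 v)) (u - v)) \<ge> - (m / 2) * (norm (u - v))\<^sup>2"
    using curvature uv y unfolding curvature_bounds_def by blast
  then show "p v + inner (gradx Phi v (Y1 v)) (u - v) + - m / 2 * (norm (u - v))\<^sup>2 \<le> p u"
    using p_ge[OF uvO(1), of "Y1 v"] y by simp
qed

lemma primal_eq: "u \<in> X \<Longrightarrow> primal_obj Y Phi h u = ereal (p u + hr u)"
  by (simp add: primal_obj_def p_def h_eq)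

lemma primal_outside: "u \<notin> X \<Longrightarrow> primal_obj Y Phi h u = \<infinity>"
  using closed_convex_fun_outside[OF h_convex] by (simp add: primal_obj_def)

lemma nearly_stationary_point:
  assumes x: "x \<in> X" and w: "norm w \<le> delta / 2"
    and stat: "\<And>v. v \<in> X \<Longrightarrow> ps x + hr x + inner w (v - x) - m / 2 * (norm (v - x))\<^sup>2 \<le> ps v + hr v"
    and e1: "(diameter Y)\<^sup>2 / (2 * xi) \<le> m * delta\<^sup>2 / 4"
    and e2: "(diameter Y)\<^sup>2 / (2 * xi) \<le> delta\<^sup>2 / (64 * m)" and delta: "0 < delta"
  shows "\<exists>xh\<in>X. norm (xh - x) \<le> delta \<and>
     (\<forall>d. norm d \<le> 1 \<longrightarrow> (\<exists>l. has_dir_deriv (primal_obj Y Phi h) xh d l \<and> ereal (- delta) \<le> l))"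
proof -
  define e where "e = (diameter Y)\<^sup>2 / (2 * xi)"
  \<comment> \<open>A quadratic of modulus 2 m: half of it cancels the weak convexity of
    \<open>p\<close>, the other half remains as strong convexity.\<close>
  define s where "s v = p v + (0 + inner (- w) (v - x) + 2 * m / 2 * (norm (v - x))\<^sup>2)" for v
  have "strongly_convex_on X (- m + 2 * m) s"
    unfolding s_def by (rule strongly_convex_on_add[OF p_weakly_convex strongly_convex_on_quadratic])
  from strongly_convex_on_add[OF this hr_convex]
  have sc: "strongly_convex_on X m (\<lambda>v. s v + hr v)" by simp
  have lowp: "Phi x y0 + inner (gradx Phi x y0) (v - x) - m / 2 * (norm (v - x))\<^sup>2 \<le> p v" if v: "v \<in> X" for v
  proof -
    have "Phi v y0 - (Phi x y0 + inner (gradx Phi x y0) (v - x)) \<ge> - (m / 2) * (norm (v - x))\<^sup>2"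
      using curvature v x y0_mem unfolding curvature_bounds_def by blast
    then show ?thesis using p_ge[OF subsetD[OF X_sub_Om v] y0_mem] by simp
  qed
  have "\<exists>xh\<in>X. \<forall>u\<in>X. s xh + real_of_ereal (h xh) \<le> s u + real_of_ereal (h u)"
  proof (rule strongly_convex_attains_min[OF h_convex X_convex X_nonempty, where k="Phi x y0"
        and g="gradx Phi x y0 - w" and a=x and kk=0 and c=m])
    show "continuous_on X s"
      unfolding s_def by (intro continuous_intros continuous_on_subset[OF p_continuous X_sub_Om])
    show "strongly_convex_on X m (\<lambda>u. s u + real_of_ereal (h u))" using sc by (simp add: hr_def)
    show "Phi x y0 + inner (gradx Phi x y0 - w) (u - x) - 0 * (norm (u - x))\<^sup>2 \<le> s u" if "u \<in> X" for u
    proof -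
      have "0 \<le> m / 2 * (norm (u - x))\<^sup>2" using m_pos by simp
      then show ?thesis using lowp[OF that] by (simp add: s_def inner_diff_left) 
    qed
  qed (rule m_pos)
  then obtain xh where xh: "xh \<in> X" and min: "\<And>u. u \<in> X \<Longrightarrow> s xh + hr xh \<le> s u + hr u"
    by (auto simp: hr_def)
  define t where "t = norm (xh - x)"
  have xhO: "xh \<in> Om" and xO: "x \<in> Om" using xh x X_sub_Om by auto
  \<comment> \<open>Growth at \<open>xh\<close> and \<open>stat\<close> each leave m/2 t^2; the only
    loss is the smoothing error at \<open>x\<close>, as \<open>ps\<close> lies below
    \<open>p\<close> at \<open>xh\<close>.\<close>
  have mt: "m * t\<^sup>2 \<le> e"
  proof -
    have "s xh + hr xh + m / 2 * t\<^sup>2 \<le> s x + hr x"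
      using strongly_convex_on_growth[OF X_convex sc xh min x] by (simp add: t_def norm_minus_commute)
    moreover have "s x = p x" by (simp add: s_def)
    moreover have "p x \<le> ps x + e" using p_le_ps[OF xO] by (simp add: e_def)
    moreover have "ps xh \<le> p xh" by (rule ps_le_p[OF xhO])
    moreover have "s xh = p xh - inner w (xh - x) + m * t\<^sup>2" by (simp add: s_def t_def)
    ultimately show ?thesis using stat[OF xh] unfolding t_def[symmetric] by linarith
  qed
  have t0: "0 \<le> t" by (simp add: t_def)
  have "m * t\<^sup>2 \<le> m * (delta\<^sup>2 / 4)" using mt e1 by (simp add: e_def)
  then have "t\<^sup>2 \<le> (delta / 2)\<^sup>2" using m_pos by (simp add: power_divide)
  then have t1: "t \<le> delta / 2" by (rule power2_le_imp_le) (use delta in simp)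
  have "m * t\<^sup>2 \<le> delta\<^sup>2 / (64 * m)" using mt e2 by (simp add: e_def)
  then have "(2 * m * t)\<^sup>2 \<le> (delta / 4)\<^sup>2"
    using m_pos by (simp add: field_simps power2_eq_square)
  then have t2: "2 * m * t \<le> delta / 4" by (rule power2_le_imp_le) (use delta in simp)
  \<comment> \<open>The slope budget is delta/2 from \<open>w\<close> plus delta/4 from 2 m (xh -
    x), the gradient of the added quadratic.\<close>
  have low: "(p xh + hr xh) - 3 / 4 * delta * norm (v - xh) - m * (norm (v - xh))\<^sup>2 \<le> p v + hr v" if v: "v \<in> X" for v
  proof -
    have "(norm (v - x))\<^sup>2 = (norm (v - xh))\<^sup>2 + 2 * inner (xh - x) (v - xh) + t\<^sup>2"
      by (simp add: t_def power2_norm_eq_inner inner_simps inner_commute)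
    then have "m * (norm (v - x))\<^sup>2 = m * ((norm (v - xh))\<^sup>2 + 2 * inner (xh - x) (v - xh) + t\<^sup>2)"
      by simp
    then have "m * (norm (v - x))\<^sup>2 = m * (norm (v - xh))\<^sup>2 + 2 * m * inner (xh - x) (v - xh) + m * t\<^sup>2"
      unfolding distrib_left by simp
    moreover have "inner w (v - x) = inner w (v - xh) + inner w (xh - x)" by (simp add: inner_simps)
    moreover have "2 * m * inner (xh - x) (v - xh) \<le> delta / 4 * norm (v - xh)"
    proof -
      have "2 * m * inner (xh - x) (v - xh) \<le> 2 * m * (t * norm (v - xh))"
        unfolding t_def using m_pos by (intro mult_left_mono norm_cauchy_schwarz) auto
      also have "\<dots> = (2 * m * t) * norm (v - xh)" by simp
      also have "\<dots> \<le> delta / 4 * norm (v - xh)" using t2 by (rule mult_right_mono) simp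
      finally show ?thesis .
    qed
    moreover have "- inner w (v - xh) \<le> delta / 2 * norm (v - xh)"
    proof -
      have "- inner w (v - xh) \<le> norm w * norm (v - xh)"
        using norm_cauchy_schwarz[of "- w" "v - xh"] by simp
      also have "\<dots> \<le> delta / 2 * norm (v - xh)" using w by (rule mult_right_mono) simp
      finally show ?thesis .
    qed
    ultimately show ?thesis using min[OF v] by (simp add: s_def t_def algebra_simps)
  qed
  have scF: "strongly_convex_on X (- m) (\<lambda>v. p v + hr v)"
    using strongly_convex_on_add[OF p_weakly_convex hr_convex] by simp
  have "\<exists>l. has_dir_deriv (primal_obj Y Phi h) xh d l \<and> ereal (- delta) \<le> l" if d: "norm d \<le> 1" for d
  proof -
    have "\<exists>l. has_dir_deriv (primal_obj Y Phi h) xh d l \<and> ereal (- (3 / 4 * delta)) \<le> l"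
      by (rule weakly_convex_has_dir_deriv[OF X_convex xh primal_eq primal_outside scF _ low _ _ d])
        (use m_pos delta in auto)
    then obtain l where l: "has_dir_deriv (primal_obj Y Phi h) xh d l" "ereal (- (3 / 4 * delta)) \<le> l" by blast
    moreover have "ereal (- delta) \<le> ereal (- (3 / 4 * delta))" using delta by simp
    ultimately show ?thesis using order_trans by blast
  qed
  then show ?thesis using xh t1 delta by (intro bexI[of _ xh]) (auto simp: t_def)
qed

end

section \<open>Residual estimates\<close>

text \<open>The value of the quadratic at \<open>s0\<close> is 3 P^2 / (L (2 L - 1)^2), so its
  positive root lies below \<open>s0\<close>. The claim is the final residual bound in scaled form:
  lam (L_bar + M) = 2 L - 1 and lam rho = 4 P.\<close>

lemma refine_step_bound:
  fixes L P s w eta :: real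
  assumes L: "1 \<le> L" and P: "0 < P" and s: "0 \<le> s"
    and q: "3 / 4 * L * s\<^sup>2 \<le> w * s + 2 * eta"
    and w: "w \<le> P * (1 + 1 / L)" and eta: "2 * eta \<le> P\<^sup>2 / L"
  shows "(2 * L - 1) * s \<le> 4 * P"
proof (rule ccontr)
  assume neg: "\<not> (2 * L - 1) * s \<le> 4 * P"
  define b where "b = P * (1 + 1 / L)"
  define c where "c = P\<^sup>2 / L"
  define s0 where "s0 = 4 * P / (2 * L - 1)"
  have s0: "0 < s0" "s0 < s" using neg L P by (auto simp: s0_def field_simps)
  have c: "0 < c" using P L by (simp add: c_def)
  have "3 / 4 * L * s0\<^sup>2 - b * s0 - c = 3 * P\<^sup>2 / (L * (2 * L - 1)\<^sup>2)"
  proof -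
    define k where "k = 2 * L - 1"
    have k: "k > 0" "L = (k + 1) / 2" using L by (auto simp: k_def)
    show ?thesis unfolding s0_def b_def c_def k_def[symmetric] 
      using k L by (simp add: field_simps power2_eq_square) (simp add: k(2) field_simps power2_eq_square)
  qed
  also have "\<dots> \<ge> 0" using L P by simp
  finally have "c \<le> s0 * (3 / 4 * L * s0 - b)" by (simp add: power2_eq_square algebra_simps)
  then have pos: "0 < 3 / 4 * L * s0 - b" using c s0 by (metis less_le_trans zero_less_mult_pos)
  have "s0 * (3 / 4 * L * s0 - b) < s * (3 / 4 * L * s - b)"
  proof (rule mult_strict_mono)
    show "3 / 4 * L * s0 - b < 3 / 4 * L * s - b" using s0 L by simp
    show "0 \<le> 3 / 4 * L * s0 - b" using pos by simp
  qed (use s0 in auto)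
  moreover have "w * s \<le> b * s" using w s unfolding b_def by (rule mult_right_mono)
  ultimately show False
    using q eta \<open>c \<le> s0 * (3 / 4 * L * s0 - b)\<close> unfolding c_def[symmetric]
    by (simp add: power2_eq_square algebra_simps)
qed

text \<open>The numbers are chosen by linearizing the two squares in \<open>a\<close> at \<open>PP = 0.32 d\<close>,
  \<open>Q = 0.09 d\<close>, which is close to the worst case for \<open>A = 18\<close>.\<close>

lemma accurate_residual_lower:
  fixes d W PP Q R k :: real
  assumes k: "0 < k" "k \<le> 1 / 18" and nn: "0 \<le> d" "0 \<le> W" "0 \<le> PP" "0 \<le> Q" "0 \<le> R"
    and a: "PP\<^sup>2 + (1 + 2 * k) * Q\<^sup>2 \<le> 2 * k * d\<^sup>2"
    and b: "10 * R\<^sup>2 \<le> W\<^sup>2"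
    and c: "PP \<le> Q + R" and e: "(1 + k) * d \<le> W + PP + k * Q"
  shows "729 / 1000 * d \<le> W"
proof (rule ccontr)
  assume "\<not> ?thesis"
  then have W: "W < 729 / 1000 * d" by simp
  then have d: "0 < d" using nn by linarith
  have "W\<^sup>2 \<le> (729 / 1000 * d)\<^sup>2" using W nn by (intro power_mono) auto
  then have "10 * R\<^sup>2 \<le> 531441 / 1000000 * d\<^sup>2" using b by (simp add: power_mult_distrib power_divide)
  \<comment> \<open>0.729 / sqrt 10 = 0.23053..., rounded up.\<close>
  also have "\<dots> \<le> 10 * (2306 / 10000 * d)\<^sup>2" by (simp add: power_mult_distrib power_divide)
  finally have "R\<^sup>2 \<le> (2306 / 10000 * d)\<^sup>2" by simp
  then have R: "R \<le> 2306 / 10000 * d" by (rule power2_le_imp_le) (use d in simp)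
  \<comment> \<open>\<open>PP\<close>, \<open>Q\<close>, \<open>R\<close> stand for |y - xs|, |x -
    xs|, |y - x|, and \<open>k\<close> for 1 / A. The constant 0.1105 below is 0.32^2 +
    0.09^2.\<close>
  have "0 \<le> (PP - 32 / 100 * d)\<^sup>2 + (Q - 9 / 100 * d)\<^sup>2 + 2 * k * Q\<^sup>2" using k by simp
  then have "d * (64 / 100 * PP + 18 / 100 * Q) \<le> PP\<^sup>2 + (1 + 2 * k) * Q\<^sup>2 + 1105 / 10000 * d\<^sup>2"
    by (simp add: power2_eq_square algebra_simps)
  also have "\<dots> \<le> d * ((2 * k + 1105 / 10000) * d)" using a by (simp add: power2_eq_square algebra_simps)
  finally have lin: "64 / 100 * PP + 18 / 100 * Q \<le> (2 * k + 1105 / 10000) * d" using d by simp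
  have kQ: "k * Q \<le> Q / 18" using k nn mult_right_mono[of k "1/18" Q] by simp
  have kd: "k * d \<le> d / 18" using k d mult_right_mono[of k "1/18" d] by simp
  show False using lin kQ kd R c e W d unfolding distrib_right by linarith
qed

text \<open>The proof adds \<open>C4\<close>, twice \<open>C1\<close> and \<open>C2\<close>, and eliminates \<open>e\<close> by completing the square;
  \<open>C5\<close> controls the surplus \<open>eta\<close>.\<close>

lemma accurate_output_bound:
  fixes b e g r :: "'a::real_inner" and d eta P L :: real
  assumes L: "0 < L" and P: "0 < P" and g: "norm g = d" and b: "norm b \<le> d" and dP: "729 / 1000 * d \<le> P / 5"
    and C1: "1 / 4 * (norm b)\<^sup>2 + 1 / 4 * (norm e)\<^sup>2 \<le> inner r b + eta"
    and C2: "1 / 4 * (norm (b - e))\<^sup>2 \<le> eta"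
    and C4: "(norm r)\<^sup>2 + 2 * eta \<le> 1 / 2 * (norm (r - (b + g)))\<^sup>2"
    and C5: "2 * eta \<le> P\<^sup>2 / L"
  shows "norm (r - (b + g)) \<le> P * (1 + 1 / L)"
proof (rule ccontr)
  define w where "w = norm (r - (b + g))"
  define x where "x = 1 / L"
  define W where "W = P * (1 + x)"
  assume "\<not> ?thesis"
  then have wW: "W < w" by (simp add: w_def W_def x_def)
  have x: "0 < x" using L by (simp add: x_def)
  have d0: "0 \<le> d" using g by auto
  have WP: "P \<le> W" using P x by (simp add: W_def)
  have Pd: "2 * d \<le> P" using dP d0 P by linarith
  have wd: "d \<le> w" using wW WP Pd d0 by linarith
  have "w \<le> norm (r - b) + d"
    unfolding w_def g[symmetric] using norm_triangle_ineq4[of "r - b" g] by (simp add: algebra_simps)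
  then have "(w - d)\<^sup>2 \<le> (norm (r - b))\<^sup>2" using wd by (intro power_mono) auto
  moreover have "(norm (r - b))\<^sup>2 - 1 / 3 * (norm b)\<^sup>2 \<le> 1 / 2 * w\<^sup>2 + eta"
  proof -
    have "0 \<le> 3 / 4 * (norm (e - (1 / 3) *\<^sub>R b))\<^sup>2" by simp
    also have "\<dots> = 1 / 2 * (norm e)\<^sup>2 + 1 / 4 * (norm (b - e))\<^sup>2 - 1 / 6 * (norm b)\<^sup>2"
      by (simp add: power2_norm_eq_inner inner_simps inner_commute field_simps)
    finally have "1 / 6 * (norm b)\<^sup>2 \<le> 1 / 2 * (norm e)\<^sup>2 + 1 / 4 * (norm (b - e))\<^sup>2" by simp
    moreover have "(norm (r - b))\<^sup>2 = (norm r)\<^sup>2 - 2 * inner r b + (norm b)\<^sup>2"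
      by (simp add: power2_norm_eq_inner inner_simps inner_commute)
    ultimately show ?thesis using C1 C2 C4 unfolding w_def[symmetric] by linarith
  qed
  moreover have "(norm b)\<^sup>2 \<le> d\<^sup>2" using b by (intro power_mono) auto
  ultimately have "(w - d)\<^sup>2 \<le> 1 / 2 * w\<^sup>2 + 1 / 2 * (P\<^sup>2 * x) + 1 / 3 * d\<^sup>2"
    using C5 by (simp add: x_def)
  then have f: "1 / 2 * w\<^sup>2 - 2 * w * d + 2 / 3 * d\<^sup>2 \<le> 1 / 2 * (P\<^sup>2 * x)"
    by (simp add: power2_eq_square algebra_simps)
  \<comment> \<open>w^2 / 2 - 2 w d increases for w above 2 d, so \<open>w\<close> may be replaced
    by the smaller \<open>W\<close>.\<close>
  have "0 < (w - W) * (1 / 2 * (w + W) - 2 * d)" using wW WP Pd P by (intro mult_pos_pos) auto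
  also have "\<dots> = (1 / 2 * w\<^sup>2 - 2 * w * d) - (1 / 2 * W\<^sup>2 - 2 * W * d)"
    by (simp add: power2_eq_square field_simps)
  finally have f2: "1 / 2 * W\<^sup>2 - 2 * W * d < 1 / 2 * w\<^sup>2 - 2 * w * d" by simp
  \<comment> \<open>The largest \<open>d\<close> that \<open>dP\<close> admits, (1/5) / (729/1000)
    times P. Up to it, 2/3 d^2 - 2 W d decreases in \<open>d\<close>.\<close>
  define D where "D = 200 / 729 * P"
  have dD: "d \<le> D" using dP by (simp add: D_def)
  have "0 \<le> (D - d) * (2 * W - 2 / 3 * (D + d))" using dD WP Pd P unfolding D_def by (intro mult_nonneg_nonneg) auto
  also have "\<dots> = (2 / 3 * d\<^sup>2 - 2 * W * d) - (2 / 3 * D\<^sup>2 - 2 * W * D)"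
    by (simp add: power2_eq_square field_simps)
  finally have f3: "2 / 3 * D\<^sup>2 - 2 * W * D \<le> 2 / 3 * d\<^sup>2 - 2 * W * d" by simp
  have "0 < P\<^sup>2 * (1 / 2 * (1 + x)\<^sup>2 - 400 / 729 * (1 + x) + 2 / 3 * (200 / 729)\<^sup>2 - 1 / 2 * x)"
  proof (intro mult_pos_pos)
    \<comment> \<open>The square is centered at the minimum, x = 400/729 - 1/2. The value there is
      about 0.0003, which shows how little room 729/1000 leaves.\<close>
    have "1 / 2 * (1 + x)\<^sup>2 - 400 / 729 * (1 + x) + 2 / 3 * (200 / 729)\<^sup>2 - 1 / 2 * x
        = 1 / 2 * (x - 71 / 1458)\<^sup>2 + (1 / 2 - 400 / 729 + 2 / 3 * (200 / 729)\<^sup>2 - 1 / 2 * (71 / 1458)\<^sup>2)"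
      by (simp add: power2_eq_square field_simps)
    moreover have "(0::real) < 1 / 2 - 400 / 729 + 2 / 3 * (200 / 729)\<^sup>2 - 1 / 2 * (71 / 1458)\<^sup>2"
      by (simp add: power2_eq_square)
    ultimately show "0 < 1 / 2 * (1 + x)\<^sup>2 - 400 / 729 * (1 + x) + 2 / 3 * (200 / 729)\<^sup>2 - 1 / 2 * x"
      using zero_le_power2[of "x - 71 / 1458"] by linarith
  qed (use P in simp)
  also have "\<dots> = 1 / 2 * W\<^sup>2 - 2 * W * D + 2 / 3 * D\<^sup>2 - 1 / 2 * (P\<^sup>2 * x)"
    by (simp add: W_def D_def power2_eq_square algebra_simps)
  finally show False using f f2 f3 by linarith
qed

section \<open>Scaling, stopping indices and counting of oracle calls\<close>

lemma closed_convex_fun_scale: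
  assumes h: "closed_convex_fun X h" and c: "0 < c"
  shows "closed_convex_fun X (\<lambda>u. ereal c * h u)"
  unfolding closed_convex_fun_def
proof (intro conjI ballI allI impI)
  show "\<bar>ereal c * h x\<bar> \<noteq> \<infinity>" if "x \<in> X" for x
    using closed_convex_fun_finite[OF h that] by (metis PInfty_neq_ereal(2) ereal_infinity_cases abs_ereal.simps(1) times_ereal.simps(1) ereal_infty_less(1) less_irrefl)
  show "ereal c * h x = \<infinity>" if "x \<notin> X" for x
    using closed_convex_fun_outside[OF h that] c by simp
  show "ereal c * h ((1 - t) *\<^sub>R x + t *\<^sub>R y) \<le> ereal (1 - t) * (ereal c * h x) + ereal t * (ereal c * h y)"
    if t: "0 < t \<and> t < 1" for x y t
  proof (cases "x \<in> X \<and> y \<in> X")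
    case True
    then obtain a b where ab: "h x = ereal a" "h y = ereal b" by (metis closed_convex_fun_finite[OF h])
    have "h ((1 - t) *\<^sub>R x + t *\<^sub>R y) \<le> ereal ((1 - t) * a + t * b)"
      using h t ab unfolding closed_convex_fun_def by (metis plus_ereal.simps(1) times_ereal.simps(1))
    then have "ereal c * h ((1 - t) *\<^sub>R x + t *\<^sub>R y) \<le> ereal c * ereal ((1 - t) * a + t * b)"
      using c by (intro ereal_mult_left_mono) auto
    then show ?thesis by (simp add: ab algebra_simps)
  next
    case False
    have ni: "h z \<noteq> - \<infinity>" for z using closed_convex_fun_finite[OF h, of z] closed_convex_fun_outside[OF h, of z]
      by (cases "z \<in> X") (metis MInfty_neq_ereal(1), simp)
    have inf: "ereal (1 - t) * (ereal c * h x) + ereal t * (ereal c * h y) = \<infinity>"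
      using False closed_convex_fun_outside[OF h, of x] closed_convex_fun_outside[OF h, of y] t c ni[of x] ni[of y]
      by (cases "h x"; cases "h y") auto
    show ?thesis unfolding inf by simp
  qed
  show "ereal c * h x \<le> Liminf (at x) (\<lambda>u. ereal c * h u)" for x
  proof -
    have "Liminf (at x) (\<lambda>u. ereal c * h u) = ereal c * Liminf (at x) h"
      by (rule Liminf_ereal_mult_left) (use c in auto)
    then show ?thesis using h c unfolding closed_convex_fun_def by (simp add: ereal_mult_left_mono)
  qed
qed

lemma not_yet_mono: "not_yet P k \<Longrightarrow> j \<le> k \<Longrightarrow> not_yet P j"
  by (auto simp: not_yet_def)

text \<open>The premise has this shape because iteration \<open>n\<close> can be analysed only if it
  is executed, that is, if the test has not fired before.\<close>

lemma stops_at_exists: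
  assumes "not_yet P n \<Longrightarrow> P n" "1 \<le> n"
  shows "\<exists>k\<le>n. stops_at P k"
proof -
  have ex: "\<exists>k. 1 \<le> k \<and> k \<le> n \<and> P k"
    using assms unfolding not_yet_def by (metis less_imp_le order_refl)
  define k where "k = (LEAST k. 1 \<le> k \<and> k \<le> n \<and> P k)"
  have k: "1 \<le> k \<and> k \<le> n \<and> P k" unfolding k_def by (rule LeastI_ex[OF ex])
  have "\<not> P j" if "1 \<le> j" "j < k" for j
    using not_less_Least[of j "\<lambda>k. 1 \<le> k \<and> k \<le> n \<and> P k"] that k unfolding k_def by auto
  then show ?thesis using k by (auto simp: stops_at_def not_yet_def)
qed

lemma stops_at_unique: "stops_at P j \<Longrightarrow> stops_at P k \<Longrightarrow> j = k"
  unfolding stops_at_def not_yet_def by (metis linorder_neqE_nat)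

lemma oracle_calls_append:
  "oracle_calls qs T \<Longrightarrow> oracle_calls qs' T' \<Longrightarrow> oracle_calls (qs @ qs') (T + T')"
  unfolding oracle_calls_def
proof (elim exE conjE)
  fix bs bs'
  assume "concat bs = qs" "length bs = T" "\<forall>b\<in>set bs. all_oracles_used b \<and> length b \<le> oracle_call_size"
    "concat bs' = qs'" "length bs' = T'" "\<forall>b\<in>set bs'. all_oracles_used b \<and> length b \<le> oracle_call_size"
  then show "\<exists>bs. concat bs = qs @ qs' \<and> length bs = T + T' \<and>
      (\<forall>b\<in>set bs. all_oracles_used b \<and> length b \<le> oracle_call_size)"
    by (intro exI[of _ "bs @ bs'"]) auto
qed

lemma oracle_calls_single:
  "all_oracles_used b \<Longrightarrow> length b \<le> oracle_call_size \<Longrightarrow> oracle_calls b 1"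
  unfolding oracle_calls_def by (intro exI[of _ "[b]"]) auto

text \<open>For y at most 1/2, ln (1 + y) is at least y - y^2 and hence at least y / 2.\<close>

lemma power_ge_of_log:
  fixes y :: real
  assumes y: "0 < y" "y \<le> 1 / 2" and B: "0 < B" and n: "2 * ln B / y \<le> real n"
  shows "B \<le> (1 + y) ^ n"
proof -
  have "y / 2 \<le> y - y\<^sup>2" using y mult_right_mono[of y "1/2" y] by (simp add: power2_eq_square)
  also have "\<dots> \<le> ln (1 + y)" by (rule ln_one_plus_pos_lower_bound) (use y in auto)
  finally have "real n * (y / 2) \<le> real n * ln (1 + y)" by (intro mult_left_mono) auto
  moreover have "ln B \<le> real n * (y / 2)" using n y by (simp add: field_simps)
  ultimately have "ln B \<le> ln ((1 + y) ^ n)" using y by (simp add: ln_realpow)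
  then show ?thesis using B y by simp
qed

section \<open>The outer iteration\<close>

locale aipp_s_minmax =
  smoothed_minmax X Y Om Phi h m Lx Ly y0 xi + aipp_s Y Phi h m Lx Ly x0 y0 xi rho
  for X :: "'a::euclidean_space set" and Y :: "'b::euclidean_space set" and Om Phi h m Lx Ly y0 xi x0 rho +
  fixes S :: "'a set"
  assumes x0_mem: "x0 \<in> X" and rho_pos: "0 < rho"
    and S_convex: "convex S" and X_sub_S: "X \<subseteq> S" and S_sub_Om: "S \<subseteq> Om"
    and S_curvature: "curvature_bounds S Y Phi m Lx Ly"
    and linearizes_in_S: "\<And>w. linearizes_at w \<Longrightarrow> w \<in> S"
begin

lemma f_eq_ps: "f = ps" by (simp add: f_def ps_def)

lemma lam_pos: "0 < lam" using m_pos by (simp add: lam_def)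

lemma mu_eq: "mu = 1 / 2" using m_pos by (simp add: mu_def lam_def)

lemma M_ge: "Ly * (xi * Ly) + Lx \<le> M" "m \<le> M"
proof -
  have "0 \<le> Ly * sqrt (xi * (Lx + m))" using Ly_pos xi_pos Lx_pos m_pos by simp
  then show "Ly * (xi * Ly) + Lx \<le> M" by (simp add: M_def algebra_simps)
  moreover have "0 \<le> Ly * (xi * Ly)" using Ly_pos xi_pos by simp
  ultimately show "m \<le> M" using m_le by linarith
qed

lemma L_eq: "L = 1 + M / (2 * m)" by (simp add: L_def lam_def)

lemma L_ge: "3 / 2 \<le> L" using M_ge(2) m_pos by (simp add: L_eq field_simps)

lemma L_bar_eq: "L_bar = M + 2 * m" using M_ge(2) by (simp add: L_bar_def lam_def)

lemma lam_L_bar: "lam * L_bar = L" using m_pos by (simp add: L_bar_eq lam_def L_eq field_simps)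

text \<open>The common scale of all tolerances: the outer test is P / 5, a continuing step gains P^2
  / 100, ACG2 aims at P^2 / (2 L), and lam rho is 4 P.\<close>

definition "P = lam * rho_bar"

lemma P_pos: "0 < P" using lam_pos rho_pos by (simp add: P_def rho_bar_def)

lemma eps_eq: "lam * eps_bar = P\<^sup>2 / (2 * L)"
proof -
  have "L_bar = L / lam" using lam_L_bar lam_pos by (simp add: field_simps)
  then have "eps_bar = rho\<^sup>2 / (32 * (L / lam))" by (simp add: eps_bar_def L_bar_def)
  then show ?thesis using lam_pos by (simp add: P_def rho_bar_def power2_eq_square field_simps)
qed

lemma f_lower: "u \<in> S \<Longrightarrow> v \<in> S \<Longrightarrow> linearization f v u - m / 2 * (norm (u - v))\<^sup>2 \<le> f u"
  unfolding f_eq_ps by (rule ps_lower_curvature[OF S_sub_Om S_curvature])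

lemma f_grad_lipschitz:
  assumes "u \<in> S" "v \<in> S"
  shows "norm (grad f u - grad f v) \<le> M * norm (u - v)"
proof -
  have "norm (grad f u - grad f v) \<le> (Ly * (xi * Ly) + Lx) * norm (u - v)"
    unfolding f_eq_ps by (rule grad_ps_Lipschitz[OF S_convex S_sub_Om S_curvature assms])
  also have "\<dots> \<le> M * norm (u - v)" using M_ge(1) by (rule mult_right_mono) simp
  finally show ?thesis .
qed

lemma f_GDERIV: "x \<in> S \<Longrightarrow> GDERIV f x :> grad f x"
  unfolding f_eq_ps using ps_GDERIV GDERIV_grad S_sub_Om by blast

lemma f_upper: "u \<in> S \<Longrightarrow> v \<in> S \<Longrightarrow> f u \<le> linearization f v u + M / 2 * (norm (u - v))\<^sup>2"
  unfolding linearization_def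
  using smooth_upper_bound[OF S_convex f_GDERIV f_grad_lipschitz, of v u] by simp

lemma half_norm_sq_GDERIV: "GDERIV (\<lambda>u. (norm (u - z))\<^sup>2 / 2) x :> x - z"
  unfolding gderiv_def power2_norm_eq_inner
  by (auto intro!: derivative_eq_intros simp: inner_commute field_simps)

lemma psis_linearization:
  assumes v: "v \<in> S"
  shows "linearization (psis z) v u
    = lam * linearization f v u + (norm (u - z))\<^sup>2 / 2 - (norm (u - v))\<^sup>2 / 2"
proof -
  have "GDERIV (\<lambda>x. lam *\<^sub>R f x) v :> lam *\<^sub>R grad f v"
    using has_derivative_mult_right[OF f_GDERIV[OF v, unfolded gderiv_def], of lam]
    by (simp add: gderiv_def)
  then have "GDERIV (psis z) v :> lam *\<^sub>R grad f v + (v - z)"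
    unfolding psis_def[abs_def] using GDERIV_add[OF _ half_norm_sq_GDERIV] by simp
  note g = grad_eqI[OF this]
  show ?thesis unfolding linearization_def g
    by (simp add: psis_def power2_norm_eq_inner inner_simps inner_commute field_simps)
qed

text \<open>By \<open>psis_linearization\<close> the prox term adds exactly |u - v|^2 / 2 to both
  curvature bounds: the lower modulus becomes 1 - lam m = 1/2 and the upper one 1 + lam M =
  L.\<close>

lemma acg_setting:
  assumes z: "z \<in> X"
  shows "accelerated_gradient X S (psis z) psin z mu L"
proof
  show "convex X" "X \<subseteq> S" "z \<in> X" by (rule X_convex X_sub_S z)+
  show "closed_convex_fun X psin"
    using closed_convex_fun_scale[OF h_convex lam_pos] by (simp add: psin_def[abs_def])
  show "continuous_on X (psis z)"
    unfolding psis_def[abs_def] f_eq_ps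
    by (intro continuous_intros continuous_on_subset[OF ps_continuous X_sub_Om]) auto
  show "0 < mu" "0 < L" using mu_eq L_ge by auto
  show "linearization (psis z) v u + mu / 2 * (norm (u - v))\<^sup>2 \<le> psis z u"
    if "u \<in> S" "v \<in> S" for u v
  proof -
    have "lam * (linearization f v u - m / 2 * (norm (u - v))\<^sup>2) \<le> lam * f u"
      using f_lower[OF that] lam_pos by simp
    moreover have "lam * (m / 2 * (norm (u - v))\<^sup>2) = 1 / 4 * (norm (u - v))\<^sup>2"
      using m_pos by (simp add: lam_def)
    ultimately show ?thesis
      unfolding psis_linearization[OF that(2)] mu_eq psis_def right_diff_distrib by linarith
  qed
  show "psis z u \<le> linearization (psis z) v u + L / 2 * (norm (u - v))\<^sup>2"
    if "u \<in> S" "v \<in> S" for u v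
  proof -
    have "lam * f u \<le> lam * (linearization f v u + M / 2 * (norm (u - v))\<^sup>2)"
      using f_upper[OF that] lam_pos by simp
    then show ?thesis
      unfolding psis_linearization[OF that(2)] psis_def L_def by (simp add: algebra_simps add_divide_distrib)
  qed
qed

definition "lphi u = lam * (f u + hr u)"

lemma psi_eq:
  assumes z: "z \<in> X" and u: "u \<in> X"
  shows "accelerated_gradient.psi (psis z) psin u = lphi u + (norm (u - z))\<^sup>2 / 2"
proof -
  interpret G: accelerated_gradient X S "psis z" psin z mu L by (rule acg_setting[OF z])
  show ?thesis
    using h_eq[OF u] by (simp add: G.psi_def G.pn_def psin_def psis_def lphi_def algebra_simps)
qed

section \<open>One inner call, seen from its prox center\<close>

definition "reached z k \<longleftrightarrow> (\<forall>i<k. acg_xt mu L (inner_state z i) \<in> S)"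

lemma reached_iff:
  assumes "z \<in> X" shows "accelerated_gradient.linearized S (psis z) psin z mu L k \<longleftrightarrow> reached z k"
proof -
  interpret G: accelerated_gradient X S "psis z" psin z mu L by (rule acg_setting[OF assms])
  show ?thesis by (simp add: G.linearized_def reached_def inner_state_def)
qed

abbreviation "Aof z k \<equiv> acg_A (inner_state z k)"
abbreviation "yof z k \<equiv> acg_y (inner_state z k)"
abbreviation "rof z k \<equiv> acg_r z (inner_state z k)"
abbreviation "etaof z k \<equiv> acg_eta (psis z) psin z (inner_state z k)"
abbreviation "wof z k \<equiv> z - yof z k + rof z k"

context
  fixes z k
  assumes z: "z \<in> X" and re: "reached z k" and k: "1 \<le> k"
begin

interpretation G: accelerated_gradient X S "psis z" psin z mu L by (rule acg_setting[OF z])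

lemma lin: "G.linearized k" using re reached_iff[OF z] by simp

lemma state_y_mem: "yof z k \<in> X"
  using G.acg_y_mem[OF lin k] by (simp add: inner_state_def)

lemma state_A_pos: "0 < Aof z k"
  using G.acg_A_pos[OF lin k] by (simp add: inner_state_def)

lemma state_A_quadratic: "real k / (2 * sqrt L) \<le> sqrt (Aof z k)"
  using G.acg_A_quadratic[OF lin] by (simp add: inner_state_def)

lemma state_A_geometric: "(1 + sqrt (1 / (2 * L)) / 2) ^ (k - 1) / (2 * sqrt L) \<le> sqrt (Aof z k)"
  using G.acg_A_geometric[of "k - 1"] lin k by (simp add: inner_state_def mu_eq)

text \<open>Moving the prox term across turns the slope \<open>rof\<close> of the prox problem into
  the slope \<open>wof\<close> of the objective itself, at the price of |u - y|^2 / 2.\<close>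

lemma state_subgradient:
  assumes u: "u \<in> X"
  shows "lphi (yof z k) + inner (wof z k) (u - yof z k) - (norm (u - yof z k))\<^sup>2 / 2 - etaof z k \<le> lphi u"
proof -
  have "0 \<le> mu / 2 * (norm (u - acg_x (inner_state z k)))\<^sup>2" by (simp add: mu_eq)
  then have "lphi (yof z k) + (norm (yof z k - z))\<^sup>2 / 2 + inner (rof z k) (u - yof z k) - etaof z k
      \<le> lphi u + (norm (u - z))\<^sup>2 / 2"
    using G.acg_subgradient[OF lin k u] psi_eq[OF z u] psi_eq[OF z state_y_mem]
    by (simp add: inner_state_def)
  moreover have "(norm (yof z k - z))\<^sup>2 / 2 - (norm (u - z))\<^sup>2 / 2
     = inner (z - yof z k) (u - yof z k) - (norm (u - yof z k))\<^sup>2 / 2"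
    by (simp add: power2_norm_eq_inner inner_simps inner_commute field_simps)
  ultimately show ?thesis by (simp add: inner_add_left)
qed

text \<open>At u = z the quadratic terms collapse to (|w|^2 - |r|^2) / 2, and accuracy lets |r|^2 +
  2 eta consume only half of |w|^2.\<close>

lemma state_decrease:
  assumes acc: "acg_accurate (psis z) psin z sig (inner_state z k)"
  shows "lphi (yof z k) + 1 / 4 * (norm (wof z k))\<^sup>2 \<le> lphi z"
proof -
  have "lphi (yof z k) + inner (wof z k) (z - yof z k) - (norm (z - yof z k))\<^sup>2 / 2 - etaof z k \<le> lphi z"
    by (rule state_subgradient[OF z])
  moreover have "inner (wof z k) (z - yof z k) - (norm (z - yof z k))\<^sup>2 / 2
     = (norm (wof z k))\<^sup>2 / 2 - (norm (rof z k))\<^sup>2 / 2"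
    by (simp add: power2_norm_eq_inner inner_simps inner_commute field_simps)
  moreover have "(norm (rof z k))\<^sup>2 + 2 * etaof z k \<le> 1 / 2 * (norm (wof z k))\<^sup>2"
    using acc by (simp add: acg_accurate_def sig_def)
  ultimately show ?thesis by linarith
qed

lemma state_descent:
  assumes u: "u \<in> X"
  shows "lphi (yof z k) \<le> lphi u + (1 + 1 / Aof z k) * ((norm (u - z))\<^sup>2 / 2)"
proof -
  define e where "e = (1 + mu * Aof z k) / (2 * Aof z k) * (norm (u - acg_x (inner_state z k)))\<^sup>2"
  have e: "0 \<le> e" unfolding e_def using state_A_pos by (simp add: mu_eq)
  have "lphi (yof z k) + (norm (yof z k - z))\<^sup>2 / 2
     \<le> lphi u + (norm (u - z))\<^sup>2 / 2 + (norm (u - z))\<^sup>2 / (2 * Aof z k) - e"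
    using G.acg_descent[OF lin k u] psi_eq[OF z u] psi_eq[OF z state_y_mem]
    by (simp add: inner_state_def e_def)
  moreover have "(1 + 1 / Aof z k) * ((norm (u - z))\<^sup>2 / 2) = (norm (u - z))\<^sup>2 / 2 + (norm (u - z))\<^sup>2 / (2 * Aof z k)"
    by (simp add: ring_distribs)
  moreover have "0 \<le> (norm (yof z k - z))\<^sup>2 / 2" by simp
  ultimately show ?thesis using e by linarith
qed

lemma state_eta_upper: "Aof z k * (norm (rof z k))\<^sup>2 + 2 * inner (rof z k) (yof z k - z) + 2 * etaof z k \<le> 0"
  using G.acg_eta_upper[OF lin k] by (simp add: inner_state_def)

lemma state_eta_lower: "1 / 4 * (norm (yof z k - acg_x (inner_state z k)))\<^sup>2 \<le> etaof z k"
  using G.acg_eta_lower[OF lin k] by (simp add: inner_state_def mu_eq)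

lemma state_eta_le: "etaof z k \<le> (norm (yof z k - z))\<^sup>2 / (2 * Aof z k)"
proof -
  define A where "A = Aof z k"
  have A: "0 < A" unfolding A_def by (rule state_A_pos)
  have "0 \<le> (norm (A *\<^sub>R rof z k + (yof z k - z)))\<^sup>2" by simp
  also have "\<dots> = A * (A * (norm (rof z k))\<^sup>2 + 2 * inner (rof z k) (yof z k - z)) + (norm (yof z k - z))\<^sup>2"
    by (simp only: power2_norm_eq_inner) (simp add: inner_simps inner_commute algebra_simps)
  also have "\<dots> \<le> A * (- 2 * etaof z k) + (norm (yof z k - z))\<^sup>2"
    using state_eta_upper A unfolding A_def[symmetric] by (intro add_mono mult_left_mono) auto
  finally show ?thesis using A unfolding A_def[symmetric] by (simp add: field_simps)
qed

text \<open>|w|^2 / 2 exceeds -2 <r, y - z> by half a square, so the accuracy test passes once A is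
  at least 1. Iteration counts thus reduce to the growth of A.\<close>

lemma state_accurate:
  assumes A: "1 \<le> Aof z k"
  shows "acg_accurate (psis z) psin z sig (inner_state z k)"
proof -
  have "1 * (norm (rof z k))\<^sup>2 \<le> Aof z k * (norm (rof z k))\<^sup>2" using A by (rule mult_right_mono) simp
  moreover have "0 \<le> 1 / 2 * (norm (rof z k - (z - yof z k)))\<^sup>2" by simp
  moreover have "1 / 2 * (norm (wof z k))\<^sup>2 - 1 / 2 * (norm (rof z k - (z - yof z k)))\<^sup>2 = - 2 * inner (rof z k) (yof z k - z)"
    by (simp add: power2_norm_eq_inner inner_simps inner_commute field_simps)
  ultimately have "(norm (rof z k))\<^sup>2 + 2 * etaof z k \<le> 1 / 2 * (norm (wof z k))\<^sup>2"
    using state_eta_upper by linarith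
  then show ?thesis by (simp add: acg_accurate_def sig_def)
qed

end

lemma test1_when: "z \<in> X \<Longrightarrow> reached z k \<Longrightarrow> 1 \<le> k \<Longrightarrow> 18 \<le> Aof z k \<Longrightarrow> test1 z k"
  using state_accurate[of z k] by (simp add: test1_def acg1_test_def mu_eq)

lemma test1_A: "test1 z k \<Longrightarrow> 18 \<le> Aof z k"
  by (simp add: test1_def acg1_test_def mu_eq)

definition "is_prox z xs \<longleftrightarrow> xs \<in> X \<and> (\<forall>u\<in>X. lphi xs + (norm (xs - z))\<^sup>2 / 2 \<le> lphi u + (norm (u - z))\<^sup>2 / 2)"

lemma prox_exists:
  assumes z: "z \<in> X"
  obtains xs where "is_prox z xs"
proof -
  interpret G: accelerated_gradient X S "psis z" psin z mu L by (rule acg_setting[OF z])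
  obtain xs where "xs \<in> X" "\<forall>u\<in>X. G.psi xs \<le> G.psi u" using G.psi_attains_min by blast
  then show thesis using that psi_eq[OF z] by (simp add: is_prox_def)
qed

context
  fixes z k xs
  assumes z: "z \<in> X" and re: "reached z k" and k: "1 \<le> k" and xs: "is_prox z xs"
begin

interpretation G: accelerated_gradient X S "psis z" psin z mu L by (rule acg_setting[OF z])

lemma xs_mem: "xs \<in> X" using xs by (simp add: is_prox_def)

lemma xs_min: "u \<in> X \<Longrightarrow> G.psi xs \<le> G.psi u"
  using xs psi_eq[OF z] xs_mem by (simp add: is_prox_def)

lemma state_near_prox: "norm (yof z k - xs) \<le> norm (z - xs)"
  using G.acg_near_minimizer[OF xs_mem xs_min lin[OF z re k]] by (simp add: inner_state_def)

lemma state_gap: "1 / 4 * (norm (yof z k - xs))\<^sup>2 + 1 / 4 * (norm (acg_x (inner_state z k) - xs))\<^sup>2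
     \<le> inner (rof z k) (yof z k - xs) + etaof z k"
  using G.acg_gap[OF xs_mem xs_min lin[OF z re k] k]
  by (simp add: inner_state_def mu_eq norm_minus_commute)

text \<open>As A r = z - x, both r and eta can be eliminated from the gap estimate, which gives
  \<open>a\<close>. The constant 10 in \<open>b\<close> is 1 + 18/2, from eta \<ge> |y - x|^2 / 4
  and A \<ge> 18.\<close>

lemma prox_distance_bound:
  assumes A: "18 \<le> Aof z k"
  shows "729 / 1000 * norm (z - xs) \<le> norm (wof z k)"
proof -
  define A where "A = Aof z k"
  define kk where "kk = 1 / A"
  define y where "y = yof z k"
  define x where "x = acg_x (inner_state z k)"
  define r where "r = rof z k"
  have A18: "18 \<le> A" using A by (simp add: A_def)
  have kk: "0 < kk" "kk \<le> 1 / 18" "A * kk = 1" using A18 by (auto simp: kk_def)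
  have Ar: "A *\<^sub>R r = z - x" using A18 by (simp add: r_def acg_r_def A_def x_def)
  then have r: "r = kk *\<^sub>R (z - x)" using kk by (metis scaleR_one scaleR_scaleR mult.commute)
  have up: "A * (norm r)\<^sup>2 + 2 * inner r (y - z) + 2 * etaof z k \<le> 0"
    unfolding A_def r_def y_def by (rule state_eta_upper[OF z re k])
  have gap: "1 / 4 * (norm (y - xs))\<^sup>2 + 1 / 4 * (norm (x - xs))\<^sup>2 \<le> inner r (y - xs) + etaof z k"
    unfolding r_def y_def x_def by (rule state_gap)
  have low: "1 / 4 * (norm (y - x))\<^sup>2 \<le> etaof z k"
    unfolding y_def x_def by (rule state_eta_lower[OF z re k])
  have rr: "A * (norm r)\<^sup>2 = kk * (norm (z - x))\<^sup>2"
    using kk unfolding r by (simp add: power_mult_distrib power2_eq_square)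
  have "1 / 2 * (norm (y - xs))\<^sup>2 + 1 / 2 * (norm (x - xs))\<^sup>2 \<le> kk * ((norm (z - xs))\<^sup>2 - (norm (x - xs))\<^sup>2)"
  proof -
    have "2 * inner r (y - xs) - (A * (norm r)\<^sup>2 + 2 * inner r (y - z)) = kk * (2 * inner (z - x) (z - xs) - (norm (z - x))\<^sup>2)"
      unfolding rr unfolding r by (simp add: inner_simps algebra_simps)
    also have "2 * inner (z - x) (z - xs) - (norm (z - x))\<^sup>2 = (norm (z - xs))\<^sup>2 - (norm (x - xs))\<^sup>2"
      by (simp add: power2_norm_eq_inner inner_simps inner_commute)
    finally show ?thesis using gap up by linarith
  qed
  then have a: "(norm (y - xs))\<^sup>2 + (1 + 2 * kk) * (norm (x - xs))\<^sup>2 \<le> 2 * kk * (norm (z - xs))\<^sup>2"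
    by (simp add: algebra_simps)
  have zy: "(norm (z - y))\<^sup>2 \<le> (norm (z - y + r))\<^sup>2"
  proof -
    have "0 \<le> A * (norm r)\<^sup>2" "0 \<le> 1 / 4 * (norm (y - x))\<^sup>2" using A18 by auto
    then have "0 \<le> - inner r (y - z)" using up low by linarith
    then have "0 \<le> 2 * inner r (z - y) + (norm r)\<^sup>2" by (simp add: inner_diff_right)
    also have "\<dots> = (norm (z - y + r))\<^sup>2 - (norm (z - y))\<^sup>2"
      by (simp add: power2_norm_eq_inner inner_simps inner_commute)
    finally show ?thesis by simp
  qed
  have b: "10 * (norm (y - x))\<^sup>2 \<le> (norm (z - y + r))\<^sup>2"
  proof -
    have "A * (A * (norm r)\<^sup>2 + 2 * inner r (y - z) + 2 * etaof z k) \<le> 0"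
      using up A18 by (simp add: mult_le_0_iff)
    moreover have "A * inner r (y - z) = inner (z - x) (y - z)" using Ar by (metis inner_scaleR_left)
    moreover have "A * (A * (norm r)\<^sup>2) = (norm (z - x))\<^sup>2"
      unfolding rr using kk by (metis mult.assoc mult_1)
    ultimately have "(norm (z - x))\<^sup>2 + 2 * inner (z - x) (y - z) + 2 * (A * etaof z k) \<le> 0"
      by (simp add: ring_distribs)
    moreover have "(norm (z - x))\<^sup>2 + 2 * inner (z - x) (y - z) = (norm (y - x))\<^sup>2 - (norm (z - y))\<^sup>2"
      by (simp add: power2_norm_eq_inner inner_simps inner_commute)
    moreover have "A * (1 / 4 * (norm (y - x))\<^sup>2) \<le> A * etaof z k"
      using low A18 by (intro mult_left_mono) auto
    moreover have "18 * (1 / 4 * (norm (y - x))\<^sup>2) \<le> A * (1 / 4 * (norm (y - x))\<^sup>2)"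
      using A18 by (intro mult_right_mono) auto
    ultimately show ?thesis using zy by linarith
  qed
  have c: "norm (y - xs) \<le> norm (x - xs) + norm (y - x)"
    using norm_triangle_ineq[of "x - xs" "y - x"] by simp
  have e: "(1 + kk) * norm (z - xs) \<le> norm (z - y + r) + norm (y - xs) + kk * norm (x - xs)"
  proof -
    have "(1 + kk) *\<^sub>R (z - xs) = (z - y + r) + (y - xs) + kk *\<^sub>R (x - xs)"
      unfolding r by (simp add: algebra_simps)
    then have "norm ((1 + kk) *\<^sub>R (z - xs)) \<le> norm (z - y + r) + norm (y - xs) + norm (kk *\<^sub>R (x - xs))"
      by (metis norm_triangle_ineq norm_triangle_le add_mono order_refl)
    then show ?thesis using kk by simp
  qed
  show ?thesis
    unfolding r_def[symmetric] y_def[symmetric]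
    by (rule accurate_residual_lower[OF kk(1,2) _ _ _ _ _ a b c e]) auto
qed

lemma residual_bound:
  assumes d: "729 / 1000 * norm (z - xs) \<le> P / 5" and t2: "test2 z k"
  shows "norm (wof z k) \<le> P * (1 + 1 / L)"
proof -
  have acc: "(norm (rof z k))\<^sup>2 + 2 * etaof z k \<le> 1 / 2 * (norm (wof z k))\<^sup>2"
    and eta: "2 * etaof z k \<le> P\<^sup>2 / L"
    using t2 by (auto simp: test2_def acg2_test_def acg_accurate_def sig_def eps_eq)
  \<comment> \<open>The residual is split at \<open>xs\<close>: the first part is bounded by
    nearness to the prox point, the second has norm d.\<close>
  have w: "rof z k - ((yof z k - xs) + (xs - z)) = wof z k" by simp
  have "norm (rof z k - ((yof z k - xs) + (xs - z))) \<le> P * (1 + 1 / L)"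
  proof (rule accurate_output_bound[where d = "norm (z - xs)" and eta = "etaof z k"
        and e = "acg_x (inner_state z k) - xs"])
    show "1 / 4 * (norm (yof z k - xs - (acg_x (inner_state z k) - xs)))\<^sup>2 \<le> etaof z k"
      using state_eta_lower[OF z re k] by simp
    show "(norm (rof z k))\<^sup>2 + 2 * etaof z k \<le> 1 / 2 * (norm (rof z k - (yof z k - xs + (xs - z))))\<^sup>2"
      unfolding w by (rule acc)
  qed (use state_gap state_near_prox d eta L_ge P_pos in \<open>auto simp: norm_minus_commute\<close>)
  then show ?thesis unfolding w .
qed

text \<open>|y - z| \<le> 2 d \<le> P because y is no farther from \<open>xs\<close> than z;
  dividing the square by 2 A with A \<ge> L meets the tolerance.\<close>

lemma test2_when:
  assumes d: "729 / 1000 * norm (z - xs) \<le> P / 5" and A: "L \<le> Aof z k"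
  shows "test2 z k"
proof -
  have acc: "acg_accurate (psis z) psin z sig (inner_state z k)"
    using state_accurate[OF z re k] A L_ge by simp
  have "norm (yof z k - z) \<le> norm (yof z k - xs) + norm (z - xs)"
    using norm_triangle_ineq4[of "yof z k - xs" "z - xs"] by simp
  also have "\<dots> \<le> P" using state_near_prox d P_pos by linarith
  finally have "(norm (yof z k - z))\<^sup>2 \<le> P\<^sup>2" by (intro power_mono) auto
  then have "(norm (yof z k - z))\<^sup>2 / (2 * Aof z k) \<le> P\<^sup>2 / (2 * L)"
    using A L_ge by (intro frac_le) auto
  then show ?thesis
    using state_eta_le[OF z re k] acc unfolding test2_def acg2_test_def eps_eq by simp
qed

end

section \<open>The refinement step\<close>

lemma refine_properties:
  assumes z: "z \<in> X"
  shows refine_x_mem: "refine_x z \<in> X"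
    and refine_x_growth: "v \<in> X \<Longrightarrow>
      linearization f z (refine_x z) + hr (refine_x z) + L_bar / 2 * (norm (refine_x z - z))\<^sup>2
        + L_bar / 2 * (norm (v - refine_x z))\<^sup>2
      \<le> linearization f z v + hr v + L_bar / 2 * (norm (v - z))\<^sup>2"
    and refine_strongly_convex:
      "strongly_convex_on X L_bar (\<lambda>v. linearization f z v + hr v + L_bar / 2 * (norm (v - z))\<^sup>2)"
proof -
  define s where "s v = f z + inner (grad f z) (v - z) + L_bar / 2 * (norm (v - z))\<^sup>2" for v
  define H where "H v = linearization f z v + hr v + L_bar / 2 * (norm (v - z))\<^sup>2" for v
  have H_eq: "H v = s v + hr v" for v by (simp add: H_def s_def linearization_def)
  have Lb: "0 < L_bar" using M_ge(2) m_pos by (simp add: L_bar_eq)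
  have sc: "strongly_convex_on X L_bar H"
    using strongly_convex_on_add[OF strongly_convex_on_quadratic[of X L_bar "f z" "grad f z" z z] hr_convex]
    by (simp add: H_eq[abs_def] s_def)
  then show "strongly_convex_on X L_bar (\<lambda>v. linearization f z v + hr v + L_bar / 2 * (norm (v - z))\<^sup>2)"
    by (simp add: H_def[abs_def])
  have ex: "\<exists>x\<in>X. \<forall>u\<in>X. s x + real_of_ereal (h x) \<le> s u + real_of_ereal (h u)"
  proof (rule strongly_convex_attains_min[OF h_convex X_convex X_nonempty, where k="f z"
        and g="grad f z" and a=z and kk=0 and c=L_bar])
    show "continuous_on X s" unfolding s_def by (intro continuous_intros)
    show "strongly_convex_on X L_bar (\<lambda>u. s u + real_of_ereal (h u))"
      using sc by (simp add: H_eq[abs_def] hr_def)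
  qed (use Lb in \<open>auto simp: s_def\<close>)
  define F where "F x' = ereal (linearization f z x') + h x' + ereal (L_bar / 2 * (norm (x' - z))\<^sup>2)" for x'
  have R: "refine_x z = arg_min F (\<lambda>_. True)" by (simp add: refine_x_def F_def[abs_def])
  have fin: "F u = ereal (H u)" if "u \<in> X" for u by (simp add: F_def H_def h_eq[OF that])
  have inf: "F u = \<infinity>" if "u \<notin> X" for u
    using closed_convex_fun_outside[OF h_convex that] by (simp add: F_def)
  have ex': "\<exists>x\<in>X. \<forall>u\<in>X. H x \<le> H u" using ex by (simp add: H_eq hr_def)
  have R_mem: "refine_x z \<in> X" and R_min: "\<And>u. u \<in> X \<Longrightarrow> H (refine_x z) \<le> H u"
    unfolding R using arg_min_ereal[of X F H] fin inf ex' by blast+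
  show "refine_x z \<in> X" by (rule R_mem)
  show "linearization f z (refine_x z) + hr (refine_x z) + L_bar / 2 * (norm (refine_x z - z))\<^sup>2
        + L_bar / 2 * (norm (v - refine_x z))\<^sup>2
      \<le> linearization f z v + hr v + L_bar / 2 * (norm (v - z))\<^sup>2" if "v \<in> X"
    using strongly_convex_on_growth[OF X_convex sc R_mem R_min that] by (simp add: H_def)
qed

text \<open>Optimality makes L_bar (z - x) - grad f z a subgradient of \<open>h\<close> at x. Adding
  grad f x produces \<open>refine_u\<close>, and the lower curvature of \<open>f\<close> costs the
  m/2 term.\<close>

lemma refine_stationary:
  assumes z: "z \<in> X" and v: "v \<in> X"
  shows "ps (refine_x z) + hr (refine_x z) + inner (refine_u z) (v - refine_x z)
     - m / 2 * (norm (v - refine_x z))\<^sup>2 \<le> ps v + hr v"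
proof -
  define x where "x = refine_x z"
  have x: "x \<in> X" unfolding x_def by (rule refine_x_mem[OF z])
  have g: "linearization f z x + hr x + L_bar / 2 * (norm (x - z))\<^sup>2 + L_bar / 2 * (norm (v - x))\<^sup>2
      \<le> linearization f z v + hr v + L_bar / 2 * (norm (v - z))\<^sup>2"
    unfolding x_def by (rule refine_x_growth[OF z v])
  have "L_bar / 2 * (norm (v - z))\<^sup>2 = L_bar / 2 * (norm (x - z))\<^sup>2 + L_bar / 2 * (norm (v - x))\<^sup>2 - L_bar * inner (z - x) (v - x)"
    by (simp add: power2_norm_eq_inner inner_simps inner_commute field_simps)
  moreover have "linearization f z v - linearization f z x = inner (grad f z) (v - x)"
    by (simp add: linearization_def inner_simps)
  ultimately have "hr x + L_bar * inner (z - x) (v - x) - inner (grad f z) (v - x) \<le> hr v"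
    using g by linarith
  moreover have "f x + inner (grad f x) (v - x) - m / 2 * (norm (v - x))\<^sup>2 \<le> f v"
    using f_lower[of v x] v x X_sub_S by (auto simp: linearization_def)
  ultimately show ?thesis
    unfolding refine_u_def x_def[symmetric] f_eq_ps[symmetric] by (simp add: inner_add_left inner_diff_left)
qed

lemma refine_u_bound:
  assumes z: "z \<in> X" and w: "norm w \<le> P * (1 + 1 / L)" and eta: "2 * eta \<le> P\<^sup>2 / L"
    and sub: "\<And>u. u \<in> X \<Longrightarrow> lphi z + inner w (u - z) - (norm (u - z))\<^sup>2 / 2 - eta \<le> lphi u"
  shows "norm (refine_u z) \<le> rho"
proof -
  define x where "x = refine_x z"
  define s where "s = norm (x - z)"
  define H where "H v = linearization f z v + hr v + L_bar / 2 * (norm (v - z))\<^sup>2" for v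
  have x: "x \<in> X" unfolding x_def by (rule refine_x_mem[OF z])
  have zx: "z \<in> S" "x \<in> S" using z x X_sub_S by auto
  \<comment> \<open>A point at fraction t of the way from \<open>z\<close> to \<open>x\<close> gives
    (1 - t/2) L s^2 \<le> |w| s + eta / t. The midpoint raises the leading factor from 1/2 to 3/4
    while only doubling eta.\<close>
  define u where "u = (1 - 1 / 2) *\<^sub>R x + (1 / 2 :: real) *\<^sub>R z"
  have u: "u \<in> X" unfolding u_def by (rule convex_combI[OF X_convex x z]) auto
  have Hz: "lam * H z = lphi z" by (simp add: H_def lphi_def linearization_def)
  have "lphi u \<le> lam * (linearization f z u + M / 2 * (norm (u - z))\<^sup>2 + hr u)"
    unfolding lphi_def using f_upper[of u z] u z X_sub_S lam_pos by (intro mult_left_mono) auto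
  \<comment> \<open>Since lam L_bar = 1 + lam M, the excess of \<open>L_bar\<close> over
    \<open>M\<close> is exactly the quadratic lost in \<open>sub\<close>.\<close>
  also have "\<dots> = lam * H u - (norm (u - z))\<^sup>2 / 2"
  proof -
    have "lam * (L_bar / 2 * (norm (u - z))\<^sup>2) = lam * (M / 2 * (norm (u - z))\<^sup>2) + (norm (u - z))\<^sup>2 / 2"
    proof -
      have "lam * (L_bar / 2 * (norm (u - z))\<^sup>2) = (lam * L_bar) / 2 * (norm (u - z))\<^sup>2" by simp
      then show ?thesis unfolding lam_L_bar L_def by (simp add: field_simps)
    qed
    then show ?thesis unfolding H_def distrib_left by linarith
  qed
  finally have 1: "lam * H z + inner w (u - z) - eta \<le> lam * H u" using sub[OF u] Hz by simp
  have "H u \<le> (1 - 1 / 2) * H x + 1 / 2 * H z - L_bar / 2 * (1 / 2 * (1 - 1 / 2)) * (norm (x - z))\<^sup>2"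
    unfolding u_def H_def
    by (rule strongly_convex_onD[OF refine_strongly_convex[OF z] x z]) auto
  then have "lam * H u \<le> lam * ((1 - 1 / 2) * H x + 1 / 2 * H z - L_bar / 2 * (1 / 2 * (1 - 1 / 2)) * s\<^sup>2)"
    unfolding s_def using lam_pos by (intro mult_left_mono) auto
  also have "\<dots> = lam * H x / 2 + lam * H z / 2 - L / 8 * s\<^sup>2"
    unfolding lam_L_bar[symmetric] by (simp add: algebra_simps)
  finally have 2: "lam * H u \<le> lam * H x / 2 + lam * H z / 2 - L / 8 * s\<^sup>2" .
  have "H x + L_bar / 2 * s\<^sup>2 \<le> H z"
    using refine_x_growth[OF z z] unfolding x_def[symmetric] H_def s_def by (simp add: norm_minus_commute)
  then have "lam * (H x + L_bar / 2 * s\<^sup>2) \<le> lam * H z" using lam_pos by simp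
  then have 3: "lam * H x + L / 2 * s\<^sup>2 \<le> lam * H z"
    unfolding lam_L_bar[symmetric] by (simp add: algebra_simps)
  have uz: "u - z = (1 / 2) *\<^sub>R (x - z)"
  proof -
    have "z = (1 / 2) *\<^sub>R z + (1 / 2) *\<^sub>R z" by (simp add: scaleR_left_distrib[symmetric])
    then show ?thesis unfolding u_def scaleR_right_diff_distrib by (simp add: algebra_simps)
  qed
  have "- inner w (x - z) \<le> norm w * s"
    unfolding s_def using norm_cauchy_schwarz[of "- w" "x - z"] by simp
  then have 4: "- inner w (u - z) \<le> norm w * s / 2" unfolding uz by simp
  have q: "3 / 4 * L * s\<^sup>2 \<le> norm w * s + 2 * eta" using 1 2 3 4 by (simp add: field_simps)
  have "(2 * L - 1) * s \<le> 4 * P"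
    by (rule refine_step_bound[OF _ P_pos _ q w eta]) (use L_ge in \<open>auto simp: s_def\<close>)
  moreover have "lam * ((L_bar + M) * s) = (2 * L - 1) * s"
    using lam_L_bar L_def by (simp add: algebra_simps)
  ultimately have "lam * ((L_bar + M) * s) \<le> 4 * P" by linarith
  also have "4 * P = lam * rho" by (simp add: P_def rho_bar_def)
  finally have "lam * ((L_bar + M) * s) \<le> lam * rho" .
  then have "(L_bar + M) * s \<le> rho" using lam_pos by simp
  moreover have "norm (refine_u z) \<le> L_bar * s + M * s"
  proof -
    have "refine_u z = L_bar *\<^sub>R (z - x) + (grad f x - grad f z)" by (simp add: refine_u_def x_def)
    then have "norm (refine_u z) \<le> norm (L_bar *\<^sub>R (z - x)) + norm (grad f x - grad f z)"
      by (simp only: norm_triangle_ineq)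
    moreover have "norm (L_bar *\<^sub>R (z - x)) = L_bar * s"
      using M_ge(2) m_pos by (simp add: s_def norm_minus_commute L_bar_eq)
    moreover have "norm (grad f x - grad f z) \<le> M * s"
      unfolding s_def by (rule f_grad_lipschitz[OF zx(2,1)])
    ultimately show ?thesis by linarith
  qed
  ultimately show ?thesis by (simp add: ring_distribs)
qed

end


section \<open>Iteration counts of the inner calls and their queries\<close>

context aipp_s_minmax
begin

lemma center_reached1: "center z \<Longrightarrow> not_yet (test1 z) k \<Longrightarrow> reached z k"
  unfolding reached_def
  by (auto intro!: linearizes_in_S linearizes_at.intros(1) elim: not_yet_mono)

lemma center_reached2:
  "center z \<Longrightarrow> stops_at (test1 z) j \<Longrightarrow> outer_test z j \<Longrightarrow> not_yet (test2 z) k \<Longrightarrow> reached z k"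
  unfolding reached_def
  by (auto intro!: linearizes_in_S linearizes_at.intros(2) elim: not_yet_mono)

lemma center_mem: "center z \<Longrightarrow> z \<in> X"
proof (induction rule: center.induct)
  case 1 show ?case by (rule x0_mem)
next
  case (2 z k)
  then show ?case using state_y_mem[OF _ center_reached1, of z k] by (auto simp: stops_at_def)
qed

lemma sqrt_L_ge: "1 \<le> sqrt L" using L_ge by simp

lemma test1_stops:
  assumes c: "center z"
  shows "\<exists>k. stops_at (test1 z) k \<and> real k \<le> 10 * sqrt L"
proof -
  \<comment> \<open>The first n for which n / (2 sqrt L) reaches sqrt 18. Rounding up still leaves
    the factor 2 * 17/4 + 1 below 10.\<close>
  define n where "n = nat \<lceil>2 * sqrt (18 * L)\<rceil>"
  have pos: "1 \<le> 2 * sqrt (18 * L)" using L_ge real_sqrt_ge_one[of "18 * L"] by linarith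
  have n: "2 * sqrt (18 * L) \<le> real n" "real n \<le> 2 * sqrt (18 * L) + 1"
    using pos unfolding n_def by linarith+
  have n1: "1 \<le> n" using pos n by linarith
  have "sqrt (18::real) \<le> 17 / 4" by (rule real_le_lsqrt) (simp_all add: power2_eq_square)
  then have "sqrt 18 * sqrt L \<le> 17 / 4 * sqrt L" using L_ge by (intro mult_right_mono) auto
  then have n10: "real n \<le> 10 * sqrt L" using n(2) sqrt_L_ge unfolding real_sqrt_mult by linarith
  have "\<exists>k\<le>n. stops_at (test1 z) k"
  proof (rule stops_at_exists[OF _ n1])
    assume ny: "not_yet (test1 z) n"
    have z: "z \<in> X" by (rule center_mem[OF c])
    have re: "reached z n" by (rule center_reached1[OF c ny])
    have "sqrt 18 * (2 * sqrt L) \<le> real n" using n(1) by (simp add: real_sqrt_mult)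
    then have "sqrt 18 \<le> real n / (2 * sqrt L)" using L_ge by (simp add: field_simps)
    also have "\<dots> \<le> sqrt (Aof z n)" by (rule state_A_quadratic[OF z re n1])
    finally have "18 \<le> Aof z n" by simp
    then show "test1 z n" by (rule test1_when[OF z re n1])
  qed
  then show ?thesis using n10 by (meson of_nat_le_iff order_trans)
qed

text \<open>The count for ACG2: 2 / y = 4 sqrt (2 L) is at most 6 sqrt L, and the 3 covers rounding
  and the index shift of the geometric bound.\<close>

definition "K2 = 3 + 6 * sqrt L * ln (2 * L)"

lemma near_prox_at_outer_stop:
  assumes c: "center z" and s: "stops_at (test1 z) j" and o: "outer_test z j" and xs: "is_prox z xs"
  shows "729 / 1000 * norm (z - xs) \<le> P / 5"
proof -
  have j: "not_yet (test1 z) j" "1 \<le> j" "test1 z j" using s by (auto simp: stops_at_def)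
  have "729 / 1000 * norm (z - xs) \<le> norm (wof z j)"
    by (rule prox_distance_bound[OF center_mem[OF c] center_reached1[OF c j(1)] j(2) xs test1_A[OF j(3)]])
  also have "\<dots> \<le> P / 5" using o by (simp add: outer_test_def P_def)
  finally show ?thesis .
qed

lemma test2_stops:
  assumes c: "center z" and s: "stops_at (test1 z) j" and o: "outer_test z j"
  shows "\<exists>l. stops_at (test2 z) l \<and> real l \<le> K2"
proof -
  have z: "z \<in> X" by (rule center_mem[OF c])
  obtain xs where xs: "is_prox z xs" by (rule prox_exists[OF z])
  define y where "y = sqrt (1 / (2 * L)) / 2"
  have y: "0 < y" "y \<le> 1 / 2" using L_ge by (auto simp: y_def)
  define n' where "n' = nat \<lceil>2 * ln (2 * L) / y\<rceil>"
  have ln: "0 \<le> ln (2 * L)" using L_ge by simp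
  then have pos: "0 \<le> 2 * ln (2 * L) / y" using y by simp
  have n': "2 * ln (2 * L) / y \<le> real n'" "real n' \<le> 2 * ln (2 * L) / y + 1"
    using pos unfolding n'_def by linarith+
  have "2 / y = 4 * sqrt (2 * L)" by (simp add: y_def real_sqrt_divide)
  moreover have "4 * sqrt (2 * L) \<le> 6 * sqrt L"
  proof -
    have "sqrt (2::real) \<le> 3 / 2" by (rule real_le_lsqrt) (simp_all add: power2_eq_square)
    then have "sqrt 2 * sqrt L \<le> 3 / 2 * sqrt L" using L_ge by (intro mult_right_mono) auto
    then show ?thesis by (simp add: real_sqrt_mult)
  qed
  ultimately have "2 / y * ln (2 * L) \<le> 6 * sqrt L * ln (2 * L)" using ln by (intro mult_right_mono) auto
  then have nK: "real (Suc n') \<le> K2" using n'(2) by (simp add: K2_def)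
  have "\<exists>l\<le>Suc n'. stops_at (test2 z) l"
  proof (rule stops_at_exists)
    assume ny: "not_yet (test2 z) (Suc n')"
    have re: "reached z (Suc n')" by (rule center_reached2[OF c s o ny])
    \<comment> \<open>Growth by 2 L is enough: divided by 2 sqrt L it leaves sqrt L, so A \<ge>
      L.\<close>
    have "2 * L \<le> (1 + y) ^ n'"
      by (rule power_ge_of_log[OF y _ n'(1)]) (use L_ge in simp)
    then have "2 * L / (2 * sqrt L) \<le> (1 + y) ^ n' / (2 * sqrt L)"
      using L_ge by (intro divide_right_mono) auto
    also have "\<dots> \<le> sqrt (Aof z (Suc n'))"
      using state_A_geometric[OF z re] by (simp add: y_def)
    finally have "sqrt L \<le> sqrt (Aof z (Suc n'))" using L_ge by (simp add: real_div_sqrt)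
    then have "L \<le> Aof z (Suc n')" by simp
    then show "test2 z (Suc n')"
      by (intro test2_when[OF z re _ xs near_prox_at_outer_stop[OF c s o xs]]) auto
  qed simp
  then show ?thesis using nK by (meson of_nat_le_iff order_trans)
qed

lemma center_decrease:
  assumes c: "center z" and s: "stops_at (test1 z) k" and o: "\<not> outer_test z k"
  shows "lphi (yof z k) + P\<^sup>2 / 100 \<le> lphi z"
proof -
  have k: "not_yet (test1 z) k" "1 \<le> k" "test1 z k" using s by (auto simp: stops_at_def)
  have "lphi (yof z k) + 1 / 4 * (norm (wof z k))\<^sup>2 \<le> lphi z"
    by (rule state_decrease[OF center_mem[OF c] center_reached1[OF c k(1)] k(2)])
      (use k(3) in \<open>simp add: test1_def acg1_test_def\<close>)
  moreover have "(P / 5)\<^sup>2 \<le> (norm (wof z k))\<^sup>2"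
    using o P_pos by (intro power_mono) (auto simp: outer_test_def P_def)
  ultimately show ?thesis by (simp add: power_divide)
qed

lemma iteration_queries_call:
  "all_oracles_used (iteration_queries z k @ qs)" "length (iteration_queries z k) = 8"
  by (auto simp: iteration_queries_def all_oracles_used_def Let_def value_queries_def grad_queries_def)

lemma acg_queries_calls: "oracle_calls (acg_queries z k) k"
proof (induction k)
  case 0
  show ?case unfolding oracle_calls_def by (intro exI[of _ "[]"]) (simp add: acg_queries_def)
next
  case (Suc k)
  have "oracle_calls (iteration_queries z k) 1"
    by (rule oracle_calls_single)
      (use iteration_queries_call(1)[of z k "[]"] in \<open>simp_all add: iteration_queries_call(2) oracle_call_size_def\<close>)
  from oracle_calls_append[OF Suc.IH this] show ?case by (simp add: acg_queries_def)
qed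

text \<open>The refinement evaluates neither \<open>Phi\<close> nor \<open>h\<close>, so its five
  queries cannot form a call of their own. They join the eight of the last iteration, which exists
  because l is at least 1.\<close>

lemma final_queries_calls:
  assumes "1 \<le> l" shows "oracle_calls (acg_queries z l @ refine_queries z') l"
proof -
  obtain n where l: "l = Suc n" using assms by (cases l) auto
  have "oracle_calls (iteration_queries z n @ refine_queries z') 1"
    by (rule oracle_calls_single)
      (simp_all add: iteration_queries_call oracle_call_size_def refine_queries_def grad_queries_def)
  from oracle_calls_append[OF acg_queries_calls[of z n] this] show ?thesis by (simp add: acg_queries_def l)
qed

lemma finish_calls:
  assumes c: "center z" and s: "stops_at (test1 z) k" and o: "outer_test z k" and t: "stops_at (test2 z) l"
  shows "oracle_calls (acg_queries z k @ acg_queries z l @ refine_queries z') (k + l)"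
    and "real (k + l) \<le> 10 * sqrt L + K2"
proof -
  have "1 \<le> l" using t by (simp add: stops_at_def)
  then show "oracle_calls (acg_queries z k @ acg_queries z l @ refine_queries z') (k + l)"
    by (intro oracle_calls_append acg_queries_calls final_queries_calls)
  have "real k \<le> 10 * sqrt L" using test1_stops[OF c] stops_at_unique[OF s] by blast
  moreover have "real l \<le> K2" using test2_stops[OF c s o] stops_at_unique[OF t] by blast
  ultimately show "real (k + l) \<le> 10 * sqrt L + K2" by simp
qed

section \<open>Total work of the outer loop\<close>

context
  fixes bnd :: real
  assumes bnd: "\<And>u. u \<in> X \<Longrightarrow> bnd \<le> lphi u"
begin

text \<open>\<open>n\<close> is a budget of outer steps: each continuing step lowers
  \<open>lphi\<close> by P^2 / 100, and an empty budget contradicts \<open>bnd\<close>.\<close>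

lemma run_exists:
  "center z \<Longrightarrow> lphi z - bnd < real n * (P\<^sup>2 / 100) \<Longrightarrow> \<exists>qs out. run z qs out"
proof (induction n arbitrary: z)
  case 0
  then show ?case using bnd[OF center_mem[OF 0(1)]] by simp
next
  case (Suc n)
  obtain k where k: "stops_at (test1 z) k" using test1_stops[OF Suc.prems(1)] by blast
  show ?case
  proof (cases "outer_test z k")
    case True
    obtain l where "stops_at (test2 z) l" using test2_stops[OF Suc.prems(1) k True] by blast
    then show ?thesis using run.finish[OF k True] by blast
  next
    case False
    have "lphi (yof z k) - bnd < real n * (P\<^sup>2 / 100)"
      using center_decrease[OF Suc.prems(1) k False] Suc.prems(2) by (simp add: algebra_simps)
    then obtain qs out where "run (yof z k) qs out"
      using Suc.IH[OF center.intros(2)[OF Suc.prems(1) k False]] by blast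
    then show ?thesis using run.continue[OF k False] by blast
  qed
qed

text \<open>A continuing step spends at most 10 sqrt L calls and one unit P^2 / 100 of the gap. The
  added 1 pays for the last ACG1 call and \<open>K2\<close> for the ACG2 call.\<close>

lemma run_calls:
  "run z qs out \<Longrightarrow> center z \<Longrightarrow>
    \<exists>T. oracle_calls qs T \<and> real T \<le> 10 * sqrt L * (1 + (lphi z - bnd) / (P\<^sup>2 / 100)) + K2"
proof (induction rule: run.induct)
  case (finish z k l z')
  have "0 \<le> (lphi z - bnd) / (P\<^sup>2 / 100)" using bnd[OF center_mem[OF finish.prems]] by simp
  then have "10 * sqrt L * 1 \<le> 10 * sqrt L * (1 + (lphi z - bnd) / (P\<^sup>2 / 100))"
    using L_ge by (intro mult_left_mono) auto
  then show ?case using finish_calls[OF finish.prems finish.hyps(1-3)] by force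
next
  case (continue z k qs out)
  have c': "center (yof z k)" by (rule center.intros(2)[OF continue.prems continue.hyps(1,2)])
  obtain T where T: "oracle_calls qs T"
    "real T \<le> 10 * sqrt L * (1 + (lphi (yof z k) - bnd) / (P\<^sup>2 / 100)) + K2"
    using continue.IH[OF c'] by blast
  have "real k \<le> 10 * sqrt L"
    using test1_stops[OF continue.prems] stops_at_unique[OF continue.hyps(1)] by blast
  moreover have "1 + (lphi (yof z k) - bnd) / (P\<^sup>2 / 100) \<le> (lphi z - bnd) / (P\<^sup>2 / 100)"
  proof -
    define c where "c = P\<^sup>2 / 100"
    have c: "0 < c" using P_pos by (simp add: c_def)
    have "lphi (yof z k) + c \<le> lphi z"
      unfolding c_def by (rule center_decrease[OF continue.prems continue.hyps(1,2)])
    then have "(c + (lphi (yof z k) - bnd)) / c \<le> (lphi z - bnd) / c"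
      using c by (intro divide_right_mono) auto
    then show ?thesis using c unfolding c_def[symmetric] by (simp add: add_divide_distrib)
  qed
  then have "10 * sqrt L * (1 + (lphi (yof z k) - bnd) / (P\<^sup>2 / 100)) \<le> 10 * sqrt L * ((lphi z - bnd) / (P\<^sup>2 / 100))"
    using L_ge by (intro mult_left_mono) auto
  ultimately have "real (k + T) \<le> 10 * sqrt L * (1 + (lphi z - bnd) / (P\<^sup>2 / 100)) + K2"
    using T(2) by (simp add: distrib_left)
  then show ?case using oracle_calls_append[OF acg_queries_calls T(1)] by blast
qed

text \<open>The first outer step replaces the gap at \<open>x0\<close> by a Moreau-type gap: its output is no worse
  than every \<open>u\<close> up to a multiple of \<open>|u - x0|^2\<close>.\<close>

lemma run_calls_from_start:
  assumes r: "run x0 qs out"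
  shows "\<exists>T E. oracle_calls qs T \<and> real T \<le> 20 * sqrt L + 10 * sqrt L * (E / (P\<^sup>2 / 100)) + K2 \<and>
    (\<forall>u\<in>X. E \<le> lphi u - bnd + 19 / 18 * ((norm (u - x0))\<^sup>2 / 2))"
proof -
  have c: "center x0" by (rule center.intros(1))
  from r show ?thesis
  proof cases
    case (finish k l z')
    \<comment> \<open>Witness E = 0: the method stops in its first outer step, and
      \<open>bnd\<close> makes the required inequality trivial.\<close>
    have "real (k + l) \<le> 20 * sqrt L + 10 * sqrt L * (0 / (P\<^sup>2 / 100)) + K2"
      using finish_calls(2)[OF c finish(3-5)] sqrt_L_ge unfolding div_0 by linarith
    moreover have "0 \<le> lphi u - bnd + 19 / 18 * ((norm (u - x0))\<^sup>2 / 2)" if "u \<in> X" for u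
      using bnd[OF that] by simp
    ultimately show ?thesis
      using finish_calls(1)[OF c finish(3-5)] finish(1) by blast
  next
    case (continue k qs')
    have k: "not_yet (test1 x0) k" "1 \<le> k" "test1 x0 k" using continue(2) by (auto simp: stops_at_def)
    have re: "reached x0 k" by (rule center_reached1[OF c k(1)])
    define z where "z = yof x0 k"
    have c': "center z" unfolding z_def by (rule center.intros(2)[OF c continue(2,3)])
    obtain T where T: "oracle_calls qs' T"
      "real T \<le> 10 * sqrt L * (1 + (lphi z - bnd) / (P\<^sup>2 / 100)) + K2"
      using run_calls[OF _ c'] continue(4) unfolding z_def by blast
    have "real k \<le> 10 * sqrt L" using test1_stops[OF c] stops_at_unique[OF continue(2)] by blast
    then have "real (k + T) \<le> 20 * sqrt L + 10 * sqrt L * ((lphi z - bnd) / (P\<^sup>2 / 100)) + K2"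
      using T(2) by (simp add: distrib_left)
    moreover have "lphi z - bnd \<le> lphi u - bnd + 19 / 18 * ((norm (u - x0))\<^sup>2 / 2)" if u: "u \<in> X" for u
    proof -
      \<comment> \<open>This is the origin of 19/18 = 1 + 1/18.\<close>
      have A: "18 \<le> Aof x0 k" by (rule test1_A[OF k(3)])
      then have "(1 + 1 / Aof x0 k) * ((norm (u - x0))\<^sup>2 / 2) \<le> 19 / 18 * ((norm (u - x0))\<^sup>2 / 2)"
        by (intro mult_right_mono) (auto simp: field_simps)
      then show ?thesis using state_descent[OF x0_mem re k(2) u] unfolding z_def by linarith
    qed
    ultimately show ?thesis
      using oracle_calls_append[OF acg_queries_calls T(1)] continue(1) by blast
  qed
qed

end

section \<open>Guarantees for the output pair\<close>

lemma run_output: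
  "run z qs out \<Longrightarrow> center z \<Longrightarrow>
    \<exists>z k l. center z \<and> stops_at (test1 z) k \<and> outer_test z k \<and> stops_at (test2 z) l \<and>
      out = (refine_x (yof z l), refine_u (yof z l))"
proof (induction rule: run.induct)
  case (continue z k qs out)
  then show ?case by (meson center.intros(2))
qed blast

lemma run_output_stationary:
  assumes r: "run x0 qs (x, u)"
  shows "x \<in> X" "norm u \<le> rho"
    "\<And>v. v \<in> X \<Longrightarrow> ps x + hr x + inner u (v - x) - m / 2 * (norm (v - x))\<^sup>2 \<le> ps v + hr v"
proof -
  obtain z k l where c: "center z" and k: "stops_at (test1 z) k" and o: "outer_test z k"
    and l: "stops_at (test2 z) l" and out: "x = refine_x (yof z l)" "u = refine_u (yof z l)"
    using run_output[OF r center.intros(1)] by blast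
  have z: "z \<in> X" by (rule center_mem[OF c])
  have l': "not_yet (test2 z) l" "1 \<le> l" "test2 z l" using l by (auto simp: stops_at_def)
  have re: "reached z l" by (rule center_reached2[OF c k o l'(1)])
  obtain xs where xs: "is_prox z xs" by (rule prox_exists[OF z])
  have y: "yof z l \<in> X" by (rule state_y_mem[OF z re l'(2)])
  have w: "norm (wof z l) \<le> P * (1 + 1 / L)"
    by (rule residual_bound[OF z re l'(2) xs near_prox_at_outer_stop[OF c k o xs] l'(3)])
  have eta: "2 * etaof z l \<le> P\<^sup>2 / L"
    using l'(3) by (auto simp: test2_def acg2_test_def eps_eq)
  show "x \<in> X" unfolding out by (rule refine_x_mem[OF y])
  show "norm u \<le> rho" unfolding out
    by (rule refine_u_bound[OF y w eta state_subgradient[OF z re l'(2)]])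
  show "ps x + hr x + inner u (v - x) - m / 2 * (norm (v - x))\<^sup>2 \<le> ps v + hr v" if "v \<in> X" for v
    unfolding out by (rule refine_stationary[OF y that])
qed

lemma primal_inf:
  "\<exists>B. (INF w. primal_obj Y Phi h w) = ereal B \<and> (\<forall>u\<in>X. B \<le> p u + hr u)"
proof -
  define I where "I = (INF w. primal_obj Y Phi h w)"
  \<comment> \<open>\<open>moreau_R\<close> takes the infimum over the whole space, the boundedness
    assumption over \<open>X\<close>; the value infinity outside \<open>X\<close> reconciles
    them.\<close>
  have "(INF x\<in>X. primal_obj Y Phi h x) \<le> I"
    unfolding I_def
  proof (rule INF_greatest)
    fix w show "(INF x\<in>X. primal_obj Y Phi h x) \<le> primal_obj Y Phi h w"
      using primal_outside[of w] by (cases "w \<in> X") (auto intro: INF_lower)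
  qed
  then have "I \<noteq> - \<infinity>" using bounded_below by auto
  moreover have le: "I \<le> ereal (p u + hr u)" if "u \<in> X" for u
    unfolding I_def primal_eq[OF that, symmetric] by (rule INF_lower) simp
  then have "I \<noteq> \<infinity>" using x0_mem by force
  ultimately obtain B where B: "I = ereal B" by (cases I) auto
  show ?thesis
    by (rule exI[of _ B]) (use B le in \<open>auto simp: I_def\<close>)
qed

lemma lphi_lower:
  assumes "\<And>u. u \<in> X \<Longrightarrow> B \<le> p u + hr u" "u \<in> X"
  shows "lam * (B - (diameter Y)\<^sup>2 / (2 * xi)) \<le> lphi u"
  unfolding lphi_def f_eq_ps
  using assms(1)[OF assms(2)] p_le_ps[of u] assms(2) X_sub_Om lam_pos by (intro mult_left_mono) auto

text \<open>m \<le> Lx turns the mixed term of \<open>M\<close> into at most 2 a b, so M \<le> (a +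
  b)^2 and L = 1 + M / (2 m) \<le> 1 + t^2 \<le> (1 + t)^2.\<close>

lemma sqrt_L_le: "sqrt L \<le> 1 + (sqrt xi * Ly + sqrt Lx) / sqrt m"
proof -
  define a where "a = sqrt xi * Ly"
  define b where "b = sqrt Lx"
  have ab: "0 \<le> a" "0 \<le> b" using xi_pos Ly_pos Lx_pos by (auto simp: a_def b_def)
  have "sqrt (xi * (Lx + m)) \<le> sqrt (xi * (4 * Lx))"
    using xi_pos m_le Lx_pos by (intro real_sqrt_le_mono mult_left_mono) auto
  also have "\<dots> = 2 * (sqrt xi * b)" by (simp add: real_sqrt_mult b_def)
  finally have "Ly * sqrt (xi * (Lx + m)) \<le> Ly * (2 * (sqrt xi * b))"
    using Ly_pos by (intro mult_left_mono) auto
  moreover have "Ly * (xi * Ly) = a\<^sup>2" "Lx = b\<^sup>2"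
    using xi_pos Lx_pos by (auto simp: a_def b_def power_mult_distrib power2_eq_square)
  moreover have "M = Ly * (xi * Ly) + Ly * sqrt (xi * (Lx + m)) + Lx"
    by (simp add: M_def distrib_left)
  moreover have "(a + b)\<^sup>2 = a\<^sup>2 + b\<^sup>2 + Ly * (2 * (sqrt xi * b))"
    by (simp add: power2_sum a_def)
  ultimately have "M \<le> (a + b)\<^sup>2" by linarith
  define t where "t = (a + b) / sqrt m"
  have t: "0 \<le> t" using ab m_pos by (simp add: t_def)
  have "M / m \<le> t\<^sup>2" using \<open>M \<le> (a + b)\<^sup>2\<close> m_pos by (simp add: t_def power_divide divide_right_mono)
  moreover have "M / (2 * m) = (M / m) / 2" by simp
  ultimately have "L \<le> 1 + t\<^sup>2" using zero_le_power2[of t] unfolding L_eq by linarith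
  also have "\<dots> \<le> (1 + t)\<^sup>2" using t by (simp add: power2_sum)
  finally have "sqrt L \<le> 1 + t" using t by (intro real_le_lsqrt) auto
  then show ?thesis by (simp add: t_def a_def b_def)
qed

lemma run_complexity:
  fixes Om_xi delta :: real
  assumes r: "run x0 qs out" and delta: "0 < delta" "rho = delta / 2"
    and Om: "Om_xi = 1 + (sqrt xi * Ly + sqrt Lx) / sqrt m"
  shows "\<exists>T. oracle_calls qs T \<and>
          within_O T (ereal Om_xi *
            (moreau_R lam (primal_obj Y Phi h) x0 / ereal (lam\<^sup>2 * delta\<^sup>2)
             + ereal ((diameter Y)\<^sup>2 / (lam * xi * delta\<^sup>2))
             + ereal (log1_plus Om_xi)))"
proof -
  define D where "D = (diameter Y)\<^sup>2"
  obtain B where B: "(INF w. primal_obj Y Phi h w) = ereal B" "\<And>u. u \<in> X \<Longrightarrow> B \<le> p u + hr u"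
    using primal_inf by blast
  define bnd where "bnd = lam * (B - D / (2 * xi))"
  have bnd: "\<And>u. u \<in> X \<Longrightarrow> bnd \<le> lphi u"
    unfolding bnd_def D_def by (rule lphi_lower[OF B(2)])
  obtain T E where T: "oracle_calls qs T" "real T \<le> 20 * sqrt L + 10 * sqrt L * (E / (P\<^sup>2 / 100)) + K2"
    and E: "\<And>u. u \<in> X \<Longrightarrow> E \<le> lphi u - bnd + 19 / 18 * ((norm (u - x0))\<^sup>2 / 2)"
    using run_calls_from_start[OF bnd r] by blast
  define R where "R = moreau_R lam (primal_obj Y Phi h) x0"
  \<comment> \<open>Dividing by 19/18 restores the coefficient 1/2 of the square in
    \<open>moreau_R\<close>, and subtracting lam D / (2 xi) passes from the smoothed gap to the true
    one. The maximum records that the Moreau gap is nonnegative.\<close>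
  define e where "e = max 0 (18 / 19 * (E - lam * D / (2 * xi)))"
  have R: "ereal e \<le> R"
    unfolding R_def moreau_R_def
  proof (rule INF_greatest)
    fix u
    show "ereal e \<le> ereal ((norm (x0 - u))\<^sup>2 / 2) + ereal lam * (primal_obj Y Phi h u - (INF w. primal_obj Y Phi h w))"
    proof (cases "u \<in> X")
      case False
      then show ?thesis using primal_outside[OF False] lam_pos B(1) by simp
    next
      case True
      define g where "g = lam * (p u + hr u - B)"
      have g: "0 \<le> g" using B(2)[OF True] lam_pos by (simp add: g_def)
      have "lam * ps u \<le> lam * p u"
        using ps_le_p[of u] True X_sub_Om lam_pos by auto
      then have "lphi u - bnd \<le> g + lam * D / (2 * xi)"
        unfolding lphi_def f_eq_ps bnd_def g_def by (simp add: algebra_simps)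
      then have "18 / 19 * (E - lam * D / (2 * xi)) \<le> (norm (x0 - u))\<^sup>2 / 2 + g"
      proof -
        define k where "k = lam * D / (2 * xi)"
        define N where "N = (norm (u - x0))\<^sup>2 / 2"
        have "lphi u - bnd \<le> g + k" using \<open>lphi u - bnd \<le> g + lam * D / (2 * xi)\<close> by (simp only: k_def)
        moreover have "E \<le> lphi u - bnd + 19 / 18 * N" unfolding N_def by (rule E[OF True])
        ultimately have "E - k \<le> 19 / 18 * (N + 18 / 19 * g)" by simp
        also have "\<dots> \<le> 19 / 18 * (N + g)" using g by simp
        finally show ?thesis unfolding norm_minus_commute[of x0 u] k_def[symmetric] N_def[symmetric] by simp
      qed
      then have "e \<le> (norm (x0 - u))\<^sup>2 / 2 + g" using g by (simp add: e_def)
      then show ?thesis unfolding B(1) primal_eq[OF True] by (simp add: g_def)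
    qed
  qed
  define l where "l = log1_plus Om_xi"
  define W where "W = ereal Om_xi * (R / ereal (lam\<^sup>2 * delta\<^sup>2) + ereal (D / (lam * xi * delta\<^sup>2)) + ereal l)"
  have sL: "sqrt L \<le> Om_xi" unfolding Om by (rule sqrt_L_le)
  have Om1: "1 \<le> Om_xi" using sL sqrt_L_ge by linarith
  have ld: "0 < lam\<^sup>2 * delta\<^sup>2" using lam_pos delta by simp
  have "ereal (real T) \<le> univ_const * max 1 W"
  proof (cases R)
    case PInf
    then have "W = \<infinity>" using ld Om1 by (simp add: W_def)
    then show ?thesis by (simp add: univ_const_def)
  next
    case MInf then show ?thesis using R by simp
  next
    case (real r)
    have er: "e \<le> r" using R real by simp
    define X1 where "X1 = r / (lam\<^sup>2 * delta\<^sup>2)"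
    define X2 where "X2 = D / (lam * xi * delta\<^sup>2)"
    have X1: "0 \<le> X1" using er ld by (simp add: X1_def e_def)
    have X2: "0 \<le> X2" using lam_pos xi_pos by (simp add: X2_def D_def)
    have W: "W = ereal (Om_xi * (X1 + X2 + l))"
      using lam_pos delta(1) by (auto simp: W_def real X1_def X2_def)
    \<comment> \<open>P = lam rho / 4 = lam delta / 8.\<close>
    have P2: "P\<^sup>2 / 100 = lam\<^sup>2 * delta\<^sup>2 / 6400"
      unfolding P_def rho_bar_def unfolding delta(2) by (simp add: power_mult_distrib power_divide)
    have E_le: "E \<le> 19 / 18 * r + k" if "18 / 19 * (E - k) \<le> r" for k
      using mult_left_mono[OF that, of "19 / 18"] by simp
    have "E \<le> 19 / 18 * r + lam * D / (2 * xi)"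
      by (rule E_le[OF order_trans[OF _ er]]) (simp only: e_def max.cobounded2)
    then have "E / (P\<^sup>2 / 100) \<le> (19 / 18 * r + lam * D / (2 * xi)) / (P\<^sup>2 / 100)"
      using P_pos by (intro divide_right_mono) auto
    also have "\<dots> = 19 / 18 * 6400 * X1 + 3200 * X2"
    proof -
      have half: "lam * D / (2 * xi) / (lam\<^sup>2 * delta\<^sup>2) = X2 / 2"
        using lam_pos by (simp add: X2_def power2_eq_square)
      have split: "(19 / 18 * r + b) / (c / 6400) = 19 / 18 * 6400 * (r / c) + 6400 * (b / c)" for b c :: real
        by (simp add: add_divide_distrib)
      show ?thesis unfolding P2 X1_def split half by simp
    qed
    also have "\<dots> \<le> 7000 * X1 + 3200 * X2" using X1 by simp
    finally have "10 * sqrt L * (E / (P\<^sup>2 / 100)) \<le> 10 * sqrt L * (7000 * X1 + 3200 * X2)"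
      using L_ge by (intro mult_left_mono) auto
    also have "\<dots> \<le> 10 * Om_xi * (7000 * X1 + 3200 * X2)"
      using sL X1 X2 by (intro mult_right_mono) auto
    also have "\<dots> = 70000 * (Om_xi * X1) + 32000 * (Om_xi * X2)" by (simp add: algebra_simps)
    finally have 1: "10 * sqrt L * (E / (P\<^sup>2 / 100)) \<le> 70000 * (Om_xi * X1) + 32000 * (Om_xi * X2)" .
    have l1: "1 \<le> l" and lO: "ln Om_xi \<le> l" by (auto simp: l_def log1_plus_def)
    \<comment> \<open>ln 2 \<le> 1 \<le> l takes one share, and twice the logarithm of sqrt L takes
      the other two.\<close>
    have "ln (2 * L) \<le> 3 * l"
    proof -
      have "ln (2 * L) = ln 2 + 2 * ln (sqrt L)" using L_ge by (simp add: ln_mult ln_sqrt)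
      also have "ln (sqrt L) \<le> ln Om_xi" using sL L_ge Om1 by simp
      finally show ?thesis using lO l1 ln_le_minus_one[of 2] by simp
    qed
    then have "sqrt L * ln (2 * L) \<le> Om_xi * (3 * l)"
      using sL L_ge Om1 by (intro mult_mono) auto
    then have 2: "K2 \<le> 3 + 18 * (Om_xi * l)" by (simp add: K2_def)
    have 3: "Om_xi * 1 \<le> Om_xi * l" using l1 Om1 by (intro mult_left_mono) auto
    have "0 \<le> Om_xi * X1" "0 \<le> Om_xi * X2" using Om1 X1 X2 by auto
    then have "real T \<le> 10000000 * (Om_xi * (X1 + X2 + l))"
      using T(2) 1 2 3 sL Om1 unfolding distrib_left mult_1_right by linarith
    then have "ereal (real T) \<le> 10000000 * W" by (simp add: W)
    also have "\<dots> \<le> univ_const * max 1 W"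
      unfolding univ_const_def by (intro ereal_mult_left_mono) auto
    finally show ?thesis .
  qed
  then show ?thesis using T(1) unfolding within_O_def W_def R_def l_def D_def by blast
qed

end

theorem proposition6p3p3:
  fixes X Om :: "'a::euclidean_space set" and Y :: "'b::euclidean_space set"
    and Phi :: "'a \<Rightarrow> 'b \<Rightarrow> real" and h :: "'a \<Rightarrow> ereal"
    and m Lx Ly delta xi rho tau lam Omega_xi :: real
    and x0 :: 'a and y0 :: 'b
  assumes "minmax X Y Om Phi h m Lx Ly"
    and "delta > 0" and "x0 \<in> X" and "y0 \<in> Y"
    and "xi > 0" and "tau > 0"
    and "xi \<ge> diameter Y / tau" and "rho = delta / 2"
    and "ereal tau \<le> min (ereal (m * delta\<^sup>2) / ereal (2 * diameter Y))
                         (ereal (delta\<^sup>2) / ereal (32 * m * diameter Y))"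
    and "aipp_s.well_posed Y Phi h m Lx Ly x0 y0 xi rho X Om"
    and "lam = 1 / (2 * m)"
    and "Omega_xi = 1 + (sqrt xi * Ly + sqrt Lx) / sqrt m"
  shows "(\<exists>qs x u. aipp_s.aipp_run Y Phi h m Lx Ly x0 y0 xi rho qs x u) \<and>
    (\<forall>qs x u. aipp_s.aipp_run Y Phi h m Lx Ly x0 y0 xi rho qs x u \<longrightarrow>
       (\<exists>T. oracle_calls qs T \<and>
          within_O T (ereal Omega_xi *
            (moreau_R (1 / (2 * m)) (primal_obj Y Phi h) x0 / ereal (lam\<^sup>2 * delta\<^sup>2)
             + ereal ((diameter Y)\<^sup>2 / (lam * xi * delta\<^sup>2))
             + ereal (log1_plus Omega_xi)))) \<and>
       (\<exists>xh\<in>X.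
          (\<forall>d. norm d \<le> 1 \<longrightarrow> (\<exists>l. has_dir_deriv (primal_obj Y Phi h) xh d l)) \<and>
          (INF d\<in>{d. norm d \<le> 1}. dir_deriv (primal_obj Y Phi h) xh d) \<ge> ereal (- delta) \<and>
          norm (xh - x) \<le> delta))"
proof -
  obtain S where S: "convex S" "X \<subseteq> S" "S \<subseteq> Om" "curvature_bounds S Y Phi m Lx Ly"
    "\<forall>w. aipp_s.linearizes_at Y Phi h m Lx Ly x0 y0 xi rho w \<longrightarrow> w \<in> S"
    using assms(10) unfolding aipp_s.well_posed_def by blast
  interpret minmax X Y Om Phi h m Lx Ly by (rule assms(1))
  interpret A: aipp_s_minmax X Y Om Phi h m Lx Ly y0 xi x0 rho S
    by unfold_locales (use assms S in auto)
  have lam: "A.lam = 1 / (2 * m)" by (simp add: A.lam_def)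
  define D where "D = diameter Y"
  have D: "0 \<le> D" unfolding D_def by (rule diameter_ge_0[OF compact_imp_bounded[OF Y_compact]])
  \<comment> \<open>D \<le> xi tau gives D^2 / (2 xi) \<le> D tau / 2, and the two bounds on tau
    finish. If D = 0, both quotients bounding tau are infinite, but then the smoothing error is
    0.\<close>
  have e: "D\<^sup>2 / (2 * xi) \<le> m * delta\<^sup>2 / 4 \<and> D\<^sup>2 / (2 * xi) \<le> delta\<^sup>2 / (64 * m)"
  proof (cases "D = 0")
    case True then show ?thesis using m_pos by simp
  next
    case False
    then have Dp: "0 < D" using D by simp
    have t: "tau \<le> m * delta\<^sup>2 / (2 * D)" "tau \<le> delta\<^sup>2 / (32 * m * D)"
      using assms(9) Dp m_pos unfolding D_def[symmetric] by simp_all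
    have "D \<le> xi * tau" using assms(6,7) unfolding D_def[symmetric] by (simp add: field_simps)
    then have "D * D \<le> D * (xi * tau)" using Dp by simp
    then have "D\<^sup>2 / (2 * xi) \<le> D * tau / 2" using assms(5) by (simp add: field_simps power2_eq_square)
    moreover have "tau * (2 * D) \<le> m * delta\<^sup>2" "tau * (32 * m * D) \<le> delta\<^sup>2"
      using t Dp m_pos by (simp_all add: pos_le_divide_eq)
    then have "D * tau \<le> m * delta\<^sup>2 / 2" "D * tau \<le> delta\<^sup>2 / (32 * m)"
      using m_pos by (simp_all add: pos_le_divide_eq ac_simps)
    ultimately show ?thesis by auto
  qed
  have ex: "\<exists>qs x u. A.aipp_run qs x u"
  proof -
    obtain B where B: "\<And>u. u \<in> X \<Longrightarrow> B \<le> A.p u + A.hr u" using A.primal_inf by blast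
    define bnd where "bnd = A.lam * (B - (diameter Y)\<^sup>2 / (2 * xi))"
    have bnd: "\<And>u. u \<in> X \<Longrightarrow> bnd \<le> A.lphi u" unfolding bnd_def by (rule A.lphi_lower[OF B])
    \<comment> \<open>The initial gap in units of the guaranteed decrease is the budget that forces
      termination.\<close>
    obtain n where "(A.lphi x0 - bnd) / (A.P\<^sup>2 / 100) < real n" using reals_Archimedean2 by blast
    then have "A.lphi x0 - bnd < real n * (A.P\<^sup>2 / 100)" using A.P_pos by (simp add: field_simps)
    from A.run_exists[OF bnd A.center.intros(1) this] show ?thesis
      unfolding A.aipp_run_def by auto
  qed
  have "(\<exists>T. oracle_calls qs T \<and>
          within_O T (ereal Omega_xi *
            (moreau_R (1 / (2 * m)) (primal_obj Y Phi h) x0 / ereal (lam\<^sup>2 * delta\<^sup>2)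
             + ereal ((diameter Y)\<^sup>2 / (lam * xi * delta\<^sup>2))
             + ereal (log1_plus Omega_xi)))) \<and>
       (\<exists>xh\<in>X.
          (\<forall>d. norm d \<le> 1 \<longrightarrow> (\<exists>l. has_dir_deriv (primal_obj Y Phi h) xh d l)) \<and>
          (INF d\<in>{d. norm d \<le> 1}. dir_deriv (primal_obj Y Phi h) xh d) \<ge> ereal (- delta) \<and>
          norm (xh - x) \<le> delta)" if "A.aipp_run qs x u" for qs x u
  proof
    have r: "A.run x0 qs (x, u)" using that by (simp add: A.aipp_run_def)
    show "\<exists>T. oracle_calls qs T \<and>
          within_O T (ereal Omega_xi *
            (moreau_R (1 / (2 * m)) (primal_obj Y Phi h) x0 / ereal (lam\<^sup>2 * delta\<^sup>2)
             + ereal ((diameter Y)\<^sup>2 / (lam * xi * delta\<^sup>2))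
             + ereal (log1_plus Omega_xi)))"
      using A.run_complexity[OF r assms(2,8,12)] unfolding lam assms(11) .
    note st = A.run_output_stationary[OF r]
    have "norm u \<le> delta / 2" using st(2) assms(8) by simp
    from A.nearly_stationary_point[OF st(1) this st(3) _ _ assms(2)] e
    obtain xh where xh: "xh \<in> X" "norm (xh - x) \<le> delta"
      "\<And>d. norm d \<le> 1 \<Longrightarrow> \<exists>l. has_dir_deriv (primal_obj Y Phi h) xh d l \<and> ereal (- delta) \<le> l"
      unfolding D_def by blast
    \<comment> \<open>\<open>dir_deriv\<close> is a definite description; existence of the limit,
      with uniqueness of limits, identifies it with \<open>l\<close>.\<close>
    have "ereal (- delta) \<le> dir_deriv (primal_obj Y Phi h) xh d" if "norm d \<le> 1" for d
      using xh(3)[OF that] dir_derivI by metis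
    then have "ereal (- delta) \<le> (INF d\<in>{d. norm d \<le> 1}. dir_deriv (primal_obj Y Phi h) xh d)"
      by (intro INF_greatest) simp
    then show "\<exists>xh\<in>X.
          (\<forall>d. norm d \<le> 1 \<longrightarrow> (\<exists>l. has_dir_deriv (primal_obj Y Phi h) xh d l)) \<and>
          (INF d\<in>{d. norm d \<le> 1}. dir_deriv (primal_obj Y Phi h) xh d) \<ge> ereal (- delta) \<and>
          norm (xh - x) \<le> delta"
      using xh by blast
  qed
  then show ?thesis using ex by blast
qed

end
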